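(* Let $\Delta,k\in\mathbb{N}$. Then there exists a deterministic algorithm which, given a multigraph $G=(V,E)$ of maximum degree at most $\Delta$, a $k$-color edge-coloring model $h$ such that $|h(\phi)-1|\le 0.35/(\Delta+1)$ for all $\phi\in\mathbb{N}^k$, and $\varepsilon>0$, computes a multiplicative $\varepsilon$-approximation to $p(G)(h)$ in time $(|V|/\varepsilon)^{O(1)}$.
   Context: A $k$-color edge-coloring model is any map $h:\mathbb{N}^k\to\mathbb{C}$ (here $0\in\mathbb{N}$). For a (multi)graph $G=(V,E)$, the partition function of $h$ is $$p(G)(h):=\sum_{\phi:E\to[k]}\ \prod_{v\in V}h(\phi(\delta(v))),$$ where $[k]=\{1,\ldots,k\}$, $\delta(v)$ denotes the set of edges incident with $v$, and $\phi(\delta(v))$ is the multiset of colors seen by $v$, identified with the vector $(a_1,\ldots,a_k)\in\mathbb{N}^k$ where $a_i$ is the number of occurrences of color $i$ amongst the edges incident with $v$. The degree of a vertex in a multigraph is the number of edges incident with it, a loop being counted twice. For non-zero complex numbers $q,\xi$, $\xi$ is called a multiplicative $\varepsilon$-approximation to $q$ if $e^{-\varepsilon}\le |q|/|\xi|\le e^{\varepsilon}$ and the angle between $\xi$ and $q$ (as vectors in $\mathbb{C}=\mathbb{R}^2$) is at most $\varepsilon$. The running time is an asymptotic bound; the constant implicit in the exponent $O(1)$ may depend on the fixed data $\Delta$ and $k$, but not on $G$, $h$ or $\varepsilon$.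
   Formalization: Here k ≥ 1 (for k = 0 and a graph with an edge, p(G)(h) = 0 has no multiplicative approximation), and the time bound is (2 + |V|/min(1,ε))^C, since (|V|/ε)^C is at most 1 when ε ≥ |V|; h is given as an oracle and arithmetic is exact at unit cost. *)

theory Defs
  imports "HOL-Analysis.Analysis" "HOL-Library.Multiset" "HOL-Library.FuncSet"
begin

section \<open>Multigraphs and partition functions\<close>

text \<open>The ends of an edge form a multiset of size two, so that a loop at \<open>v\<close> is an edge with
  ends \<open>{#v, v#}\<close>.\<close>

record ('v, 'e) multigraph =
  verts :: "'v set"
  edges :: "'e set"
  ends :: "'e \<Rightarrow> 'v multiset"

definition wf_multigraph :: "('v, 'e) multigraph \<Rightarrow> bool" where
  "wf_multigraph G \<longleftrightarrow> finite (verts G) \<and> finite (edges G) \<and>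
     (\<forall>e\<in>edges G. size (ends G e) = 2 \<and> set_mset (ends G e) \<subseteq> verts G)"

text \<open>\<open>\<delta>(v)\<close> is taken as a multiset, in which a loop at \<open>v\<close> occurs twice. Thus the entries of the
  colour vector at \<open>v\<close> add up to the degree of \<open>v\<close>.\<close>

definition incident_edges :: "('v, 'e) multigraph \<Rightarrow> 'v \<Rightarrow> 'e multiset" where
  "incident_edges G v = (\<Sum>e\<in>edges G. replicate_mset (count (ends G e) v) e)"

definition vertex_degree :: "('v, 'e) multigraph \<Rightarrow> 'v \<Rightarrow> nat" where
  "vertex_degree G v = size (incident_edges G v)"

definition max_degree_le :: "('v, 'e) multigraph \<Rightarrow> nat \<Rightarrow> bool" where
  "max_degree_le G d \<longleftrightarrow> (\<forall>v\<in>verts G. vertex_degree G v \<le> d)"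

text \<open>Elements of \<open>\<nat>\<^sup>k\<close> are lists of length \<open>k\<close>; a \<open>k\<close>-color edge-coloring model is a function on
  lists of which only the values at lists of length \<open>k\<close> are relevant.\<close>

type_synonym edge_coloring_model = "nat list \<Rightarrow> complex"

definition color_vector :: "nat \<Rightarrow> ('v, 'e) multigraph \<Rightarrow> ('e \<Rightarrow> nat) \<Rightarrow> 'v \<Rightarrow> nat list" where
  "color_vector k G \<phi> v = map (count (image_mset \<phi> (incident_edges G v))) [1..<Suc k]"

definition partition_function ::
  "nat \<Rightarrow> ('v, 'e) multigraph \<Rightarrow> edge_coloring_model \<Rightarrow> complex" where
  "partition_function k G h =
     (\<Sum>\<phi>\<in>edges G \<rightarrow>\<^sub>E {1..k}. \<Prod>v\<in>verts G. h (color_vector k G \<phi> v))"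


section \<open>Multiplicative approximation\<close>

definition vector_angle :: "complex \<Rightarrow> complex \<Rightarrow> real" where
  "vector_angle x y = arccos (inner x y / (norm x * norm y))"

definition multiplicative_approx :: "real \<Rightarrow> complex \<Rightarrow> complex \<Rightarrow> bool" where
  "multiplicative_approx \<epsilon> q \<xi> \<longleftrightarrow> q \<noteq> 0 \<and> \<xi> \<noteq> 0 \<and>
     exp (- \<epsilon>) \<le> norm q / norm \<xi> \<and> norm q / norm \<xi> \<le> exp \<epsilon> \<and> vector_angle \<xi> q \<le> \<epsilon>"


section \<open>The model of computation\<close>

text \<open>Algorithms are programs of a real RAM (an algebraic machine in the sense of Blum, Shub and
  Smale), presented as a structured programming language. The memory consists of arrays of natural
  numbers and arrays of complex numbers, where a program can mention only finitely many arrays.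
  Natural numbers serve for indexing and counting; they can only be added, subtracted and compared.
  Complex numbers are held exactly; the available operations are the field operations and
  conjugation, the only constants are \<open>1\<close> and \<open>\<i>\<close>, and the only test compares two real parts.
  There is no conversion between the two sorts, in particular no rounding.
  The edge-coloring model, being an infinite object, is given as an oracle that returns the
  value at one vector per query. Every elementary operation costs one unit of time.\<close>

datatype nexp =
    NConst nat
  | NGet nat nexp
  | NAdd nexp nexp
  | NSub nexp nexp

datatype cexp =
    COne
  | CImUnit
  | CGet nat nexp
  | COracle "nexp list"
  | CAdd cexp cexp
  | CSub cexp cexp
  | CMul cexp cexp
  | CDiv cexp cexp
  | CCnj cexp

datatype bexp =
    NLess nexp nexp
  | ReLe cexp cexp
  | Neg bexp
  | Conj bexp bexp

datatype com =
    Skip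
  | NAssign nat nexp nexp
  | CAssign nat nexp cexp
  | Seq com com
  | Cond bexp com com
  | While bexp com

record memory =
  nats :: "nat \<Rightarrow> nat \<Rightarrow> nat"
  nums :: "nat \<Rightarrow> nat \<Rightarrow> complex"

primrec nval :: "nexp \<Rightarrow> memory \<Rightarrow> nat" where
  "nval (NConst c) s = c"
| "nval (NGet A i) s = nats s A (nval i s)"
| "nval (NAdd x y) s = nval x s + nval y s"
| "nval (NSub x y) s = nval x s - nval y s"

primrec ncost :: "nexp \<Rightarrow> nat" where
  "ncost (NConst c) = 1"
| "ncost (NGet A i) = 1 + ncost i"
| "ncost (NAdd x y) = 1 + ncost x + ncost y"
| "ncost (NSub x y) = 1 + ncost x + ncost y"

text \<open>Subtraction of natural numbers is truncated, and division of complex numbers by zero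
  yields zero.\<close>

primrec cval :: "edge_coloring_model \<Rightarrow> cexp \<Rightarrow> memory \<Rightarrow> complex" where
  "cval h COne s = 1"
| "cval h CImUnit s = \<i>"
| "cval h (CGet A i) s = nums s A (nval i s)"
| "cval h (COracle es) s = h (map (\<lambda>e. nval e s) es)"
| "cval h (CAdd x y) s = cval h x s + cval h y s"
| "cval h (CSub x y) s = cval h x s - cval h y s"
| "cval h (CMul x y) s = cval h x s * cval h y s"
| "cval h (CDiv x y) s = cval h x s / cval h y s"
| "cval h (CCnj x) s = cnj (cval h x s)"

primrec ccost :: "cexp \<Rightarrow> nat" where
  "ccost COne = 1"
| "ccost CImUnit = 1"
| "ccost (CGet A i) = 1 + ncost i"
| "ccost (COracle es) = 1 + sum_list (map ncost es)"
| "ccost (CAdd x y) = 1 + ccost x + ccost y"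
| "ccost (CSub x y) = 1 + ccost x + ccost y"
| "ccost (CMul x y) = 1 + ccost x + ccost y"
| "ccost (CDiv x y) = 1 + ccost x + ccost y"
| "ccost (CCnj x) = 1 + ccost x"

primrec bval :: "edge_coloring_model \<Rightarrow> bexp \<Rightarrow> memory \<Rightarrow> bool" where
  "bval h (NLess x y) s \<longleftrightarrow> nval x s < nval y s"
| "bval h (ReLe x y) s \<longleftrightarrow> Re (cval h x s) \<le> Re (cval h y s)"
| "bval h (Neg b) s \<longleftrightarrow> \<not> bval h b s"
| "bval h (Conj b c) s \<longleftrightarrow> bval h b s \<and> bval h c s"

primrec bcost :: "bexp \<Rightarrow> nat" where
  "bcost (NLess x y) = 1 + ncost x + ncost y"
| "bcost (ReLe x y) = 1 + ccost x + ccost y"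
| "bcost (Neg b) = 1 + bcost b"
| "bcost (Conj b c) = 1 + bcost b + bcost c"

definition write_nat :: "nat \<Rightarrow> nat \<Rightarrow> nat \<Rightarrow> memory \<Rightarrow> memory" where
  "write_nat A i x s = s\<lparr>nats := (nats s)(A := (nats s A)(i := x))\<rparr>"

definition write_num :: "nat \<Rightarrow> nat \<Rightarrow> complex \<Rightarrow> memory \<Rightarrow> memory" where
  "write_num A i x s = s\<lparr>nums := (nums s)(A := (nums s A)(i := x))\<rparr>"

text \<open>\<open>exec h c s s' t\<close>: started in memory \<open>s\<close> with oracle \<open>h\<close>, the program \<open>c\<close> halts after \<open>t\<close>
  units of time with memory \<open>s'\<close>.\<close>

inductive exec :: "edge_coloring_model \<Rightarrow> com \<Rightarrow> memory \<Rightarrow> memory \<Rightarrow> nat \<Rightarrow> bool" for h where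
  Skip: "exec h Skip s s 1"
| NAssign: "exec h (NAssign A i e) s (write_nat A (nval i s) (nval e s) s) (1 + ncost i + ncost e)"
| CAssign: "exec h (CAssign A i e) s (write_num A (nval i s) (cval h e s) s) (1 + ncost i + ccost e)"
| Seq: "exec h c1 s s' t1 \<Longrightarrow> exec h c2 s' s'' t2 \<Longrightarrow> exec h (Seq c1 c2) s s'' (t1 + t2)"
| CondTrue: "bval h b s \<Longrightarrow> exec h c1 s s' t \<Longrightarrow> exec h (Cond b c1 c2) s s' (1 + bcost b + t)"
| CondFalse: "\<not> bval h b s \<Longrightarrow> exec h c2 s s' t \<Longrightarrow> exec h (Cond b c1 c2) s s' (1 + bcost b + t)"
| WhileFalse: "\<not> bval h b s \<Longrightarrow> exec h (While b c) s s (1 + bcost b)"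
| WhileTrue: "bval h b s \<Longrightarrow> exec h c s s' t1 \<Longrightarrow> exec h (While b c) s' s'' t2 \<Longrightarrow>
    exec h (While b c) s s'' (1 + bcost b + t1 + t2)"

inductive_cases exec_SkipE: "exec h Skip s s' t"
inductive_cases exec_NAssignE: "exec h (NAssign A i e) s s' t"
inductive_cases exec_CAssignE: "exec h (CAssign A i e) s s' t"
inductive_cases exec_SeqE: "exec h (Seq c1 c2) s s' t"
inductive_cases exec_CondE: "exec h (Cond b c1 c2) s s' t"
inductive_cases exec_WhileE: "exec h (While b c) s s' t"

lemma exec_deterministic:
  "exec h c s s1 t1 \<Longrightarrow> exec h c s s2 t2 \<Longrightarrow> s2 = s1 \<and> t2 = t1"
proof (induction arbitrary: s2 t2 rule: exec.induct)
  case (Seq c1 s s' t1 c2 s'' t2')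
  from Seq.prems obtain r u v where "exec h c1 s r u" "exec h c2 r s2 v" "t2 = u + v"
    by (rule exec_SeqE)
  then show ?case using Seq.IH(1)[of r u] Seq.IH(2)[of s2 v] by simp
next
  case (WhileTrue b s c s' t1 s'' t2')
  from WhileTrue.prems WhileTrue.hyps(1) obtain r u v where "exec h c s r u"
    "exec h (While b c) r s2 v" "t2 = 1 + bcost b + u + v"
    by (auto elim: exec_WhileE)
  then show ?case using WhileTrue.IH(1)[of r u] WhileTrue.IH(2)[of s2 v] by simp
next
  case (WhileFalse b s c)
  from WhileFalse.prems WhileFalse.hyps show ?case by (auto elim: exec_WhileE)
next
  case (CondTrue b s c1 s' t c2)
  from CondTrue.prems CondTrue.hyps(1) obtain u where "exec h c1 s s2 u" "t2 = 1 + bcost b + u"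
    by (auto elim: exec_CondE)
  then show ?case using CondTrue.IH[of s2 u] by simp
next
  case (CondFalse b s c2 s' t c1)
  from CondFalse.prems CondFalse.hyps(1) obtain u where "exec h c2 s s2 u" "t2 = 1 + bcost b + u"
    by (auto elim: exec_CondE)
  then show ?case using CondFalse.IH[of s2 u] by simp
qed (auto elim: exec_SkipE exec_NAssignE exec_CAssignE)


section \<open>Input and output\<close>

text \<open>A multigraph is given to a program by its number \<open>n\<close> of vertices and a list of edges, each
  edge being a pair of vertex numbers below \<open>n\<close>. The numbering of the vertices, the order of the
  edges and the order of the two ends of an edge are arbitrary.\<close>

definition presents :: "nat \<Rightarrow> (nat \<times> nat) list \<Rightarrow> ('v, 'e) multigraph \<Rightarrow> bool" where
  "presents n es G \<longleftrightarrow> (\<exists>\<nu> \<eta>. bij_betw \<nu> {..<n} (verts G) \<and> bij_betw \<eta> {..<length es} (edges G) \<and>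
     (\<forall>j<length es. fst (es ! j) < n \<and> snd (es ! j) < n \<and>
        ends G (\<eta> j) = {#\<nu> (fst (es ! j)), \<nu> (snd (es ! j))#}))"

lemma presentation_exists:
  assumes "wf_multigraph G"
  shows "\<exists>n es. presents n es G"
proof -
  obtain \<nu> where \<nu>: "bij_betw \<nu> {..<card (verts G)} (verts G)"
    using assms ex_bij_betw_nat_finite[of "verts G"]
    by (auto simp: wf_multigraph_def atLeast0LessThan)
  obtain \<eta> where \<eta>: "bij_betw \<eta> {..<card (edges G)} (edges G)"
    using assms ex_bij_betw_nat_finite[of "edges G"]
    by (auto simp: wf_multigraph_def atLeast0LessThan)
  have "\<exists>p. fst p < card (verts G) \<and> snd p < card (verts G) \<and>
      ends G (\<eta> j) = {#\<nu> (fst p), \<nu> (snd p)#}" if "j < card (edges G)" for j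
  proof -
    have "\<eta> j \<in> edges G" using \<eta> that by (auto simp: bij_betw_def)
    then have e: "size (ends G (\<eta> j)) = 2" "set_mset (ends G (\<eta> j)) \<subseteq> verts G"
      using assms by (auto simp: wf_multigraph_def)
    obtain x y where xy: "ends G (\<eta> j) = {#x, y#}"
      using e(1) size_eq_Suc_imp_eq_union[of "ends G (\<eta> j)" 1] size_1_singleton_mset
      by (metis Suc_1 size_add_mset nat.inject)
    have "x \<in> \<nu> ` {..<card (verts G)}" "y \<in> \<nu> ` {..<card (verts G)}"
      using xy e(2) \<nu> by (auto simp: bij_betw_def)
    then obtain a b where "a < card (verts G)" "\<nu> a = x" "b < card (verts G)" "\<nu> b = y"
      by blast
    with xy show ?thesis by (intro exI[of _ "(a, b)"]) auto
  qed
  then obtain f where f: "\<And>j. j < card (edges G) \<Longrightarrow> fst (f j) < card (verts G) \<and>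
      snd (f j) < card (verts G) \<and> ends G (\<eta> j) = {#\<nu> (fst (f j)), \<nu> (snd (f j))#}"
    by metis
  have "presents (card (verts G)) (map f [0..<card (edges G)]) G"
    unfolding presents_def using \<nu> \<eta> f by (intro exI[of _ \<nu>] exI[of _ \<eta>]) auto
  then show ?thesis by blast
qed

text \<open>Initially, array 0 of natural numbers holds the numbers of vertices and edges, arrays 1 and 2
  hold the first and the second ends of the edges, and array 0 of complex numbers holds \<open>\<epsilon>\<close>.
  All other cells are zero. The result is expected in cell 0 of array 1 of complex numbers.\<close>

definition initial_memory :: "nat \<Rightarrow> (nat \<times> nat) list \<Rightarrow> real \<Rightarrow> memory" where
  "initial_memory n es \<epsilon> = \<lparr>
     nats = (\<lambda>A i.
       if A = 0 \<and> i = 0 then n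
       else if A = 0 \<and> i = 1 then length es
       else if A = 1 \<and> i < length es then fst (es ! i)
       else if A = 2 \<and> i < length es then snd (es ! i)
       else 0),
     nums = (\<lambda>A i. if A = 0 \<and> i = 0 then complex_of_real \<epsilon> else 0)\<rparr>"

definition result :: "memory \<Rightarrow> complex" where
  "result s = nums s 1 0"

end

(*
  Write Z(S) for the sum over all colourings of the product of h over the vertices in S, possibly with
  some edge colours pinned. Adding a vertex v to S multiplies Z(S) by 1 + E[f w] / E[w], where the
  expectation is over the colours a of the edges at v, f(a) = h(a) - 1, and w(a) is the product of the
  analogous ratios for deleting the neighbours of v from S one at a time with the colours a pinned.
  If all ratios lie within 0.42/(Delta+1) of 1, then each w(a) lies in the disc of radius 0.55 around 1,
  hence in a cone in which |E[w]| >= 0.835 E|w|; as |f| <= 0.35/(Delta+1), the new ratio is again within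
  0.42/(Delta+1) of 1. So partition functions never vanish, and the same estimate shows that an error in
  the ratios at the neighbours is damped by the factor 0.93. Expanding this recursion to depth
  D = O(log(n/epsilon)) therefore gives an epsilon-approximation, and the computation tree has bounded
  branching, hence polynomial size in n/epsilon. The tree is generated breadth first in arrays and
  evaluated backwards.
*)

theory Submission
  imports Defs
begin

section \<open>Weighted means over a cone\<close>

text \<open>Fixing the colours at \<open>v\<close> must not remove its edges: a neighbour's factor
  still depends on the whole vector of colours that it sees. Hence only vertices are removed, edges
  are pinned, and every estimate is proved for all pinnings at once. Every edge, pinned or not,
  stays a summation variable; this only produces powers of \<open>k\<close>, which cancel in ratios
  and leave k^|E| for the empty vertex set. The constants are linked: (1 +
  0.42/(\<Delta>+1))^\<Delta> <= exp 0.42 <= 1.55 gives the disc; 0.835 lies just below sqrt (1 -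
  0.55^2), the cosine of the half-angle of the cone around it; 0.35/0.835, about 0.419, is below
  0.42, which closes the induction; 0.35 (1 + 1/0.835)/0.835, about 0.921, gives the damping. Both
  need at most \<Delta> factors per weight, so loops and parallel edges must not yield extra
  children. The machine has no recursion, no multiplication of natural numbers and no logarithm: the
  tree is laid out explicitly, offsets grow by addition, and the depth is found by multiplying an
  error bound by 0.93 until it is small.\<close>

lemma cone_bound:
  fixes w :: complex
  assumes "cmod (w - 1) \<le> 0.55"
  shows "0.835 * cmod w \<le> Re w"
proof -
  have "(cmod (w - 1))^2 \<le> 0.55^2" using assms by (intro power_mono) auto
  moreover have "(cmod (w - 1))^2 = (cmod w)^2 - 2 * Re w + 1"
    by (simp add: cmod_power2 power2_diff)
  ultimately have "(cmod w)^2 + 0.6975 \<le> 2 * Re w" by (simp add: power2_eq_square)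
  \<comment> \<open>The arithmetic-geometric mean inequality; 0.835^2 = 0.697225 stays below 0.6975
    = 1 - 0.55^2.\<close>
  moreover have "2 * 0.835 * cmod w \<le> (cmod w)^2 + 0.835^2"
    using sum_squares_ge_zero[of "cmod w - 0.835" 0] by (simp add: power2_eq_square algebra_simps)
  ultimately show ?thesis by (simp add: power2_eq_square)
qed

lemma sum_cone_bound:
  fixes w :: "'a \<Rightarrow> complex"
  assumes "\<And>a. a \<in> A \<Longrightarrow> cmod (w a - 1) \<le> 0.55"
  shows "0.835 * (\<Sum>a\<in>A. cmod (w a)) \<le> cmod (\<Sum>a\<in>A. w a)"
proof -
  have "0.835 * (\<Sum>a\<in>A. cmod (w a)) \<le> (\<Sum>a\<in>A. Re (w a))"
    unfolding sum_distrib_left using assms cone_bound by (intro sum_mono) auto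
  also have "\<dots> = Re (\<Sum>a\<in>A. w a)" by simp
  also have "\<dots> \<le> cmod (\<Sum>a\<in>A. w a)" by (rule complex_Re_le_cmod)
  finally show ?thesis .
qed

lemma sum_cone_nonzero:
  fixes w :: "'a \<Rightarrow> complex"
  assumes "finite A" "A \<noteq> {}" "\<And>a. a \<in> A \<Longrightarrow> cmod (w a - 1) \<le> 0.55"
  shows "(\<Sum>a\<in>A. w a) \<noteq> 0"
proof -
  have "cmod (w a) > 0" if "a \<in> A" for a using assms(3)[OF that] by auto
  then have "0 < (\<Sum>a\<in>A. cmod (w a))" using assms(1,2) by (intro sum_pos) auto
  with sum_cone_bound[of A w] assms(3) show ?thesis by fastforce
qed

lemma weighted_mean_bound:
  fixes w f :: "'a \<Rightarrow> complex"
  assumes "finite A" "A \<noteq> {}" "\<And>a. a \<in> A \<Longrightarrow> cmod (w a - 1) \<le> 0.55"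
    and "\<And>a. a \<in> A \<Longrightarrow> cmod (f a) \<le> l"
  shows "cmod ((\<Sum>a\<in>A. f a * w a) / (\<Sum>a\<in>A. w a)) \<le> l / 0.835"
proof -
  have l: "l \<ge> 0" using assms(2,4) norm_ge_zero order_trans by blast
  have "cmod (\<Sum>a\<in>A. f a * w a) \<le> (\<Sum>a\<in>A. l * cmod (w a))"
    by (rule order_trans[OF norm_sum]) (auto intro!: sum_mono mult_right_mono assms(4) simp: norm_mult)
  also have "\<dots> = l / 0.835 * (0.835 * (\<Sum>a\<in>A. cmod (w a)))" by (simp add: sum_distrib_left)
  also have "\<dots> \<le> l / 0.835 * cmod (\<Sum>a\<in>A. w a)"
    using l sum_cone_bound[of A w] assms(3) by (intro mult_left_mono) auto
  finally show ?thesis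
    using sum_cone_nonzero[OF assms(1,2,3)] by (simp add: norm_divide divide_le_eq)
qed

text \<open>With \<open>F\<close> the mean of \<open>f\<close> under \<open>w'\<close>, the sum of
  (f - F) w' vanishes, so the difference of the two means is the single quotient of the sum of (f -
  F) (w - w') by the sum of \<open>w\<close>. The error \<open>d\<close> is relative to
  \<open>cmod (w a)\<close> because the cone bound turns the sum of these moduli back into the
  denominator.\<close>

lemma weighted_mean_diff:
  fixes w w' f :: "'a \<Rightarrow> complex"
  assumes A: "finite A" "A \<noteq> {}"
    and w: "\<And>a. a \<in> A \<Longrightarrow> cmod (w a - 1) \<le> 0.55" "\<And>a. a \<in> A \<Longrightarrow> cmod (w' a - 1) \<le> 0.55"
    and f: "\<And>a. a \<in> A \<Longrightarrow> cmod (f a) \<le> l"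
    and d: "\<And>a. a \<in> A \<Longrightarrow> cmod (w a - w' a) \<le> d * cmod (w a)" "d \<ge> 0"
  shows "cmod ((\<Sum>a\<in>A. f a * w a) / (\<Sum>a\<in>A. w a) - (\<Sum>a\<in>A. f a * w' a) / (\<Sum>a\<in>A. w' a))
    \<le> (l + l / 0.835) * d / 0.835"
proof -
  define F where "F = (\<Sum>a\<in>A. f a * w' a) / (\<Sum>a\<in>A. w' a)"
  have l: "l \<ge> 0" using A f norm_ge_zero order_trans by blast
  have nz: "(\<Sum>a\<in>A. w a) \<noteq> 0" "(\<Sum>a\<in>A. w' a) \<noteq> 0"
    using sum_cone_nonzero[OF A] w by auto
  have F: "cmod F \<le> l / 0.835" unfolding F_def by (rule weighted_mean_bound[OF A w(2) f])
  have "(\<Sum>a\<in>A. (f a - F) * (w a - w' a)) =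
     (\<Sum>a\<in>A. f a * w a) - (\<Sum>a\<in>A. f a * w' a) - F * (\<Sum>a\<in>A. w a) + F * (\<Sum>a\<in>A. w' a)"
    by (simp add: algebra_simps sum.distrib sum_subtractf sum_distrib_left)
  also have "F * (\<Sum>a\<in>A. w' a) = (\<Sum>a\<in>A. f a * w' a)" using nz by (simp add: F_def)
  finally have eq: "(\<Sum>a\<in>A. f a * w a) / (\<Sum>a\<in>A. w a) - F =
      (\<Sum>a\<in>A. (f a - F) * (w a - w' a)) / (\<Sum>a\<in>A. w a)"
    using nz by (simp add: field_simps)
  have "cmod (\<Sum>a\<in>A. (f a - F) * (w a - w' a)) \<le> (\<Sum>a\<in>A. (l + l / 0.835) * (d * cmod (w a)))"
  proof (rule order_trans[OF norm_sum], rule sum_mono, unfold norm_mult, rule mult_mono)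
    fix a assume "a \<in> A"
    then show "cmod (f a - F) \<le> l + l / 0.835"
      using f F by (meson add_mono norm_triangle_ineq4 order_trans)
  qed (use d l in auto)
  also have "\<dots> = (l + l / 0.835) * d / 0.835 * (0.835 * (\<Sum>a\<in>A. cmod (w a)))"
  proof -
    have "(\<Sum>a\<in>A. c * (d * cmod (w a))) = c * d / 0.835 * (0.835 * (\<Sum>a\<in>A. cmod (w a)))" for c
      by (simp flip: sum_distrib_left)
    then show ?thesis .
  qed
  also have "\<dots> \<le> (l + l / 0.835) * d / 0.835 * cmod (\<Sum>a\<in>A. w a)"
    using l d sum_cone_bound[of A w] w(1) by (intro mult_left_mono) auto
  finally show ?thesis
    using nz unfolding F_def[symmetric] eq by (simp add: norm_divide divide_le_eq)
qed

text \<open>Uses 1 - x <= exp (-x) at x = 0.42/8 = 0.0525 and takes the eighth power; applied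
  directly at 0.42 it would only give 1/0.58, which exceeds 1.55.\<close>

lemma exp_042: "exp (0.42 :: real) \<le> 1.55"
proof -
  have "(1 - 0.0525 :: real) \<le> exp (- 0.0525)" using exp_ge_add_one_self[of "-0.0525 :: real"] by simp
  then have "(1 - 0.0525 :: real) ^ 8 \<le> exp (- 0.0525) ^ 8" by (intro power_mono) auto
  also have "\<dots> = exp (- 0.42 :: real)" by (simp flip: exp_of_nat_mult)
  finally have "(1 - 0.0525 :: real) ^ 8 * exp 0.42 \<le> 1"
    by (simp add: exp_minus field_simps)
  moreover have "(1 - 0.0525 :: real) ^ 8 \<ge> 1 / 1.55" by (simp add: eval_nat_numeral)
  then have "1 / 1.55 * exp 0.42 \<le> (1 - 0.0525 :: real) ^ 8 * exp 0.42"
    by (rule mult_right_mono) simp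
  ultimately have "1 / 1.55 * exp (0.42 :: real) \<le> 1" by (rule order_trans[rotated])
  then show ?thesis by simp
qed

section \<open>Products of factors near 1\<close>

lemma prod_list_near_one:
  fixes rs :: "complex list"
  assumes "\<And>r. r \<in> set rs \<Longrightarrow> cmod (r - 1) \<le> t"
  shows "cmod (prod_list rs - 1) \<le> (1 + t) ^ length rs - 1"
  using assms
proof (induction rs)
  case (Cons r rs)
  have t: "t \<ge> 0" using Cons.prems[of r] norm_ge_zero[of "r - 1"] by (simp del: norm_ge_zero)
  have "prod_list (r # rs) - 1 = (r - 1) * (prod_list rs - 1) + (r - 1) + (prod_list rs - 1)"
    by (simp add: algebra_simps)
  then have "cmod (prod_list (r # rs) - 1) \<le>
      cmod ((r - 1) * (prod_list rs - 1) + (r - 1)) + cmod (prod_list rs - 1)"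
    by (simp only: norm_triangle_ineq)
  also have "\<dots> \<le> cmod (r - 1) * cmod (prod_list rs - 1) + cmod (r - 1) + cmod (prod_list rs - 1)"
    by (metis add_right_mono norm_triangle_ineq norm_mult)
  also have "\<dots> \<le> t * ((1 + t) ^ length rs - 1) + t + ((1 + t) ^ length rs - 1)"
    using Cons t by (intro add_mono mult_mono) auto
  finally show ?case by (simp add: algebra_simps)
qed simp

lemma prod_list_in_cone:
  fixes rs :: "complex list" and \<Delta> :: nat
  assumes "\<And>r. r \<in> set rs \<Longrightarrow> cmod (r - 1) \<le> 0.42 / (real \<Delta> + 1)" "length rs \<le> \<Delta>"
  shows "cmod (prod_list rs - 1) \<le> 0.55"
proof -
  have "(1 + 0.42 / (real \<Delta> + 1)) ^ length rs \<le> (1 + 0.42 / (real \<Delta> + 1)) ^ \<Delta>"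
    using assms(2) by (intro power_increasing) auto
  also have "\<dots> \<le> exp (0.42 / (real \<Delta> + 1)) ^ \<Delta>"
    by (intro power_mono exp_ge_add_one_self) (auto intro: add_nonneg_nonneg)
  also have "\<dots> = exp (real \<Delta> * (0.42 / (real \<Delta> + 1)))" by (simp flip: exp_of_nat_mult)
  also have "\<dots> \<le> exp 0.42" by (simp add: field_simps)
  finally show ?thesis using prod_list_near_one[OF assms(1)] exp_042 by fastforce
qed

text \<open>The factors are exchanged one position at a time, so that the weights stay in the cone and the
  error stays linear in \<open>e\<close>.\<close>

lemma weighted_mean_contraction:
  fixes r r' :: "'a \<Rightarrow> complex list" and f :: "'a \<Rightarrow> complex" and \<Delta> :: nat
  assumes A: "finite A" "A \<noteq> {}"
    and r: "\<And>a x. a \<in> A \<Longrightarrow> x \<in> set (r a) \<Longrightarrow> cmod (x - 1) \<le> 0.42 / (real \<Delta> + 1)"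
    and r': "\<And>a x. a \<in> A \<Longrightarrow> x \<in> set (r' a) \<Longrightarrow> cmod (x - 1) \<le> 0.42 / (real \<Delta> + 1)"
    and len: "\<And>a. a \<in> A \<Longrightarrow> length (r a) \<le> \<Delta>" "\<And>a. a \<in> A \<Longrightarrow> length (r' a) = length (r a)"
    and e: "\<And>a i. a \<in> A \<Longrightarrow> i < length (r a) \<Longrightarrow> cmod (r a ! i - r' a ! i) \<le> e" "e \<ge> 0"
    and f: "\<And>a. a \<in> A \<Longrightarrow> cmod (f a) \<le> 0.35 / (real \<Delta> + 1)"
  shows "cmod ((\<Sum>a\<in>A. f a * prod_list (r a)) / (\<Sum>a\<in>A. prod_list (r a)) -
      (\<Sum>a\<in>A. f a * prod_list (r' a)) / (\<Sum>a\<in>A. prod_list (r' a))) \<le> 0.93 * e"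
proof -
  define hyb where "hyb i a = take i (r' a) @ drop i (r a)" for i a
  define F where "F i = (\<Sum>a\<in>A. f a * prod_list (hyb i a)) / (\<Sum>a\<in>A. prod_list (hyb i a))" for i
  define l where "l = 0.35 / (real \<Delta> + 1)"
  \<comment> \<open>An absolute error \<open>e\<close> in a factor of modulus at least 1 -
    0.42/(\<Delta>+1) is a relative error of at most \<open>d\<close>.\<close>
  define d where "d = e / (1 - 0.42 / (real \<Delta> + 1))"
  have t1: "0.42 / (real \<Delta> + 1) \<le> 0.42" by (simp add: field_simps)
  then have d0: "d \<ge> 0" using e(2) by (simp add: d_def)
  have hyb: "cmod (prod_list (hyb i a) - 1) \<le> 0.55" if "a \<in> A" for i a
    using that len[OF that] r r'
    by (intro prod_list_in_cone[where \<Delta> = \<Delta>]) (auto simp: hyb_def dest: in_set_takeD in_set_dropD)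
  have step: "cmod (F i - F (Suc i)) \<le> (l + l / 0.835) * d / 0.835" for i
    unfolding F_def
  proof (rule weighted_mean_diff[OF A])
    fix a assume a: "a \<in> A"
    show "cmod (prod_list (hyb i a) - prod_list (hyb (Suc i) a)) \<le> d * cmod (prod_list (hyb i a))"
    proof (cases "i < length (r a)")
      case True
      define p where "p = prod_list (take i (r' a)) * prod_list (drop (Suc i) (r a))"
      have 1: "prod_list (hyb i a) = p * r a ! i"
        using True by (simp add: hyb_def p_def Cons_nth_drop_Suc[symmetric])
      have 2: "prod_list (hyb (Suc i) a) = p * r' a ! i"
        using True len(2)[OF a] by (simp add: hyb_def p_def take_Suc_conv_app_nth)
      have "cmod (r a ! i - 1) \<le> 0.42 / (real \<Delta> + 1)" using r[OF a] True by simp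
      then have "1 - 0.42 / (real \<Delta> + 1) \<le> cmod (r a ! i)"
        using norm_triangle_ineq2[of 1 "1 - r a ! i"] norm_minus_commute[of "r a ! i" 1] by simp
      then have "d * (1 - 0.42 / (real \<Delta> + 1)) \<le> d * cmod (r a ! i)"
        using d0 by (intro mult_left_mono)
      moreover have "d * (1 - 0.42 / (real \<Delta> + 1)) = e" using t1 by (simp add: d_def)
      ultimately have "cmod (r a ! i - r' a ! i) \<le> d * cmod (r a ! i)" using e(1)[OF a True] by simp
      then have "cmod p * cmod (r a ! i - r' a ! i) \<le> cmod p * (d * cmod (r a ! i))"
        by (intro mult_left_mono) auto
      then show ?thesis unfolding 1 2 right_diff_distrib[symmetric] norm_mult by (simp only: mult_ac)
    qed (use d0 len(2)[OF a] in \<open>simp add: hyb_def\<close>)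
  qed (use hyb f d0 in \<open>auto simp: l_def\<close>)
  have "cmod (F 0 - F i) \<le> real i * ((l + l / 0.835) * d / 0.835)" for i
  proof (induction i)
    case (Suc i)
    have "cmod (F 0 - F (Suc i)) \<le> cmod (F 0 - F i) + cmod (F i - F (Suc i))"
      using norm_triangle_ineq[of "F 0 - F i" "F i - F (Suc i)"] by simp
    with Suc step[of i] show ?case by (simp add: algebra_simps)
  qed simp
  then have "cmod (F 0 - F \<Delta>) \<le> real \<Delta> * ((l + l / 0.835) * d / 0.835)" .
  also have "real \<Delta> * ((l + l / 0.835) * d / 0.835) \<le> 0.93 * e"
  proof -
    \<comment> \<open>(\<Delta>+1) (1 - 0.42/(\<Delta>+1)) = \<Delta> + 0.58. The \<Delta> exchange
      steps are thus outweighed by this denominator, and the bound is uniform in \<Delta>.\<close>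
    have "l * d = 0.35 * e / (real \<Delta> + 0.58)" unfolding l_def d_def
      by (simp add: divide_simps) (simp add: algebra_simps)
    moreover have "real \<Delta> * ((l + l / 0.835) * d / 0.835) = (1 + 1 / 0.835) / 0.835 * (real \<Delta> * (l * d))"
      by (simp add: algebra_simps)
    ultimately have "real \<Delta> * ((l + l / 0.835) * d / 0.835) =
        0.35 * (1 + 1 / 0.835) / 0.835 * (real \<Delta> / (real \<Delta> + 0.58) * e)"
      by (simp add: divide_simps) (simp add: algebra_simps)
    also have "\<dots> \<le> 0.35 * (1 + 1 / 0.835) / 0.835 * (1 * e)"
      using e(2) by (intro mult_left_mono mult_right_mono) auto
    also have "\<dots> \<le> 0.93 * e" using e(2) by simp
    finally show ?thesis .
  qed
  finally have "cmod (F 0 - F \<Delta>) \<le> 0.93 * e" .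
  \<comment> \<open>Exchanging a position past the end of a list changes nothing, so \<Delta> steps
    serve lists of all lengths up to \<Delta>.\<close>
  moreover have "hyb 0 a = r a" "hyb \<Delta> a = r' a" if "a \<in> A" for a
    using len[OF that] by (auto simp: hyb_def)
  ultimately show ?thesis unfolding F_def by simp
qed

section \<open>Partition functions with pinned edges\<close>

definition incident :: "(nat \<times> nat) list \<Rightarrow> nat \<Rightarrow> nat \<Rightarrow> bool" where
  "incident es j v \<longleftrightarrow> fst (es ! j) = v \<or> snd (es ! j) = v"

definition color_count :: "(nat \<times> nat) list \<Rightarrow> (nat \<Rightarrow> nat) \<Rightarrow> nat \<Rightarrow> nat \<Rightarrow> nat" where
  "color_count es \<phi> v c = (\<Sum>j<length es. if \<phi> j = c
     then (if fst (es ! j) = v then 1 else 0) + (if snd (es ! j) = v then 1 else 0) else 0)"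

definition color_counts :: "nat \<Rightarrow> (nat \<times> nat) list \<Rightarrow> (nat \<Rightarrow> nat) \<Rightarrow> nat \<Rightarrow> nat list" where
  "color_counts k es \<phi> v = map (color_count es \<phi> v) [1..<Suc k]"

text \<open>A pinning fixes the colours of some edges; the value 0 marks a free edge.\<close>

definition override :: "(nat \<Rightarrow> nat) \<Rightarrow> (nat \<Rightarrow> nat) \<Rightarrow> nat \<Rightarrow> nat" where
  "override pin \<phi> j = (if pin j = 0 then \<phi> j else pin j)"

text \<open>The sum runs over the colours of all edges, including pinned ones and those that meet no
  vertex of \<open>S\<close>. Each such idle edge contributes a factor \<open>k\<close>, so the
  index set never changes when vertices are removed or edges pinned.\<close>

definition pinned_sum ::
  "nat \<Rightarrow> (nat \<times> nat) list \<Rightarrow> edge_coloring_model \<Rightarrow> nat set \<Rightarrow> (nat \<Rightarrow> nat) \<Rightarrow> complex" where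
  "pinned_sum k es h S pin =
     (\<Sum>\<phi>\<in>{..<length es} \<rightarrow>\<^sub>E {1..k}. \<Prod>v\<in>S. h (color_counts k es (override pin \<phi>) v))"

text \<open>The free edges at \<open>v\<close> consume the stream \<open>a\<close> in list order;
  edges pinned earlier consume nothing, and a loop consumes one colour. A stream instead of a list
  matches an array read at a moving index.\<close>

fun pin_edges ::
  "(nat \<times> nat) list \<Rightarrow> nat \<Rightarrow> nat list \<Rightarrow> (nat \<Rightarrow> nat) \<Rightarrow> (nat \<Rightarrow> nat) \<Rightarrow> nat \<Rightarrow> nat" where
  "pin_edges es v [] a pin = pin"
| "pin_edges es v (j # js) a pin =
     (if incident es j v \<and> pin j = 0 then pin_edges es v js (\<lambda>i. a (Suc i)) (pin(j := a 0))
      else pin_edges es v js a pin)"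

definition pad_zero :: "nat list \<Rightarrow> nat \<Rightarrow> nat" where
  "pad_zero xs i = (if i < length xs then xs ! i else 0)"

text \<open>Sets of remaining vertices are kept as 0/1-valued functions, the form in which the
  program stores them.\<close>

definition alive :: "(nat \<Rightarrow> nat) \<Rightarrow> nat set" where
  "alive al = {u. al u \<noteq> 0}"

text \<open>Each candidate still present is paired with what remains after its own removal and all
  earlier ones, which is the set in the denominator of its ratio. Repeated candidates are skipped,
  being removed already.\<close>

fun kids :: "(nat \<Rightarrow> nat) \<Rightarrow> nat list \<Rightarrow> (nat \<times> (nat \<Rightarrow> nat)) list" where
  "kids al [] = []"
| "kids al (u # us) =
     (if al u \<noteq> 0 then (u, al(u := 0)) # kids (al(u := 0)) us else kids al us)"

text \<open>Both ends of each edge at \<open>v\<close> are listed, hence also \<open>v\<close>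
  itself and repetitions; \<open>kids\<close> skips these once \<open>v\<close> has been
  removed.\<close>

definition nbrs :: "(nat \<times> nat) list \<Rightarrow> nat \<Rightarrow> nat list" where
  "nbrs es v =
     concat (map (\<lambda>j. if incident es j v then [fst (es ! j), snd (es ! j)] else []) [0..<length es])"

definition vertex_ratio ::
  "nat \<Rightarrow> (nat \<times> nat) list \<Rightarrow> edge_coloring_model \<Rightarrow> (nat \<Rightarrow> nat) \<Rightarrow> (nat \<Rightarrow> nat) \<Rightarrow> nat \<Rightarrow> complex" where
  "vertex_ratio k es h al pin v =
     pinned_sum k es h (insert v (alive al)) pin / pinned_sum k es h (alive al) pin"

lemma pad_zero_Cons: "pad_zero (x # xs) 0 = x" "(\<lambda>i. pad_zero (x # xs) (Suc i)) = pad_zero xs"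
  by (auto simp: pad_zero_def)

lemma sum_list_n_lists_Suc:
  fixes F :: "'a list \<Rightarrow> 'b::comm_monoid_add"
  shows "(\<Sum>a\<leftarrow>List.n_lists (Suc d) xs. F a) = (\<Sum>x\<leftarrow>xs. \<Sum>ys\<leftarrow>List.n_lists d xs. F (x # ys))"
proof -
  have "(\<Sum>a\<leftarrow>concat (map (\<lambda>ys. map (\<lambda>y. y # ys) xs) yss). F a) = (\<Sum>x\<leftarrow>xs. \<Sum>ys\<leftarrow>yss. F (x # ys))"
    for yss by (induction yss) (simp_all add: sum_list_addf comp_def)
  then show ?thesis by simp
qed

text \<open>Overwriting the value at \<open>j\<close> forgets the old one, so every function arises
  once for each of the \<open>card C\<close> forgotten values.\<close>

lemma sum_PiE_update:
  fixes G :: "('a \<Rightarrow> nat) \<Rightarrow> complex"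
  assumes "finite I" "j \<in> I" "finite C"
  shows "(\<Sum>c\<in>C. \<Sum>\<phi>\<in>I \<rightarrow>\<^sub>E C. G (\<phi>(j := c))) = of_nat (card C) * (\<Sum>\<phi>\<in>I \<rightarrow>\<^sub>E C. G \<phi>)"
proof -
  define J where "J = I - {j}"
  have I: "I = insert j J" "j \<notin> J" using assms by (auto simp: J_def)
  have inj: "inj_on (\<lambda>(y, g). g(j := y)) (C \<times> (J \<rightarrow>\<^sub>E C))"
    using I(2) by (rule inj_combinator)
  have eq: "(\<Sum>\<phi>\<in>I \<rightarrow>\<^sub>E C. H \<phi>) = (\<Sum>y\<in>C. \<Sum>g\<in>J \<rightarrow>\<^sub>E C. H (g(j := y)))"
    for H :: "('a \<Rightarrow> nat) \<Rightarrow> complex"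
    unfolding I(1) PiE_insert_eq
    by (subst sum.reindex[OF inj]) (simp add: comp_def case_prod_unfold sum.cartesian_product)
  show ?thesis
    unfolding eq by (simp add: sum_distrib_left)
qed

lemma pinned_sum_average:
  assumes "j < length es" "pin j = 0"
  shows "(\<Sum>c\<leftarrow>[1..<Suc k]. pinned_sum k es h S (pin(j := c))) = of_nat k * pinned_sum k es h S pin"
proof -
  have o: "override (pin(j := c)) \<phi> = override pin (\<phi>(j := c))" if "c \<in> {1..k}" for c \<phi>
    using that assms(2) by (auto simp: override_def)
  have "(\<Sum>c\<leftarrow>[1..<Suc k]. pinned_sum k es h S (pin(j := c))) =
      (\<Sum>c\<in>{1..k}. pinned_sum k es h S (pin(j := c)))"
    by (subst sum_list_distinct_conv_sum_set)
      (simp_all add: atLeastLessThanSuc_atLeastAtMost del: upt_Suc sum.op_ivl_Suc)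
  also have "\<dots> = (\<Sum>c\<in>{1..k}. \<Sum>\<phi>\<in>{..<length es} \<rightarrow>\<^sub>E {1..k}.
      \<Prod>v\<in>S. h (color_counts k es (override pin (\<phi>(j := c))) v))"
    unfolding pinned_sum_def using o by (intro sum.cong refl) simp
  also have "\<dots> = of_nat k * pinned_sum k es h S pin"
    unfolding pinned_sum_def using assms(1) by (subst sum_PiE_update) auto
  finally show ?thesis .
qed

lemma pin_edges_other: "j \<notin> set js \<or> \<not> incident es j v \<Longrightarrow> pin_edges es v js a pin j = pin j"
  by (induction js arbitrary: a pin) auto

text \<open>A coordinate of \<open>a\<close> that pins an edge contributes a factor \<open>k\<close>
  because that edge stays a summation variable; a surplus coordinate contributes \<open>k\<close>
  because it is ignored. The total is \<open>k ^ d\<close> however many free edges there are, so all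
  vertices can use colour lists of the same length.\<close>

lemma pinned_sum_average_list:
  assumes "distinct js" "set js \<subseteq> {..<length es}" "card {j \<in> set js. incident es j v \<and> pin j = 0} \<le> d"
  shows "(\<Sum>a\<leftarrow>List.n_lists d [1..<Suc k]. pinned_sum k es h S (pin_edges es v js (pad_zero a) pin)) =
    of_nat k ^ d * pinned_sum k es h S pin"
  using assms
proof (induction js arbitrary: d pin)
  case Nil
  show ?case by (simp add: sum_list_triv length_n_lists del: upt_Suc)
next
  case (Cons j js)
  show ?case
  proof (cases "incident es j v \<and> pin j = 0")
    case True
    have s: "{i \<in> set (j # js). incident es i v \<and> pin i = 0} =
        insert j {i \<in> set js. incident es i v \<and> pin i = 0}"
      using True by auto
    then have "Suc (card {i \<in> set js. incident es i v \<and> pin i = 0}) \<le> d"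
      using Cons.prems by simp
    then obtain d' where d: "d = Suc d'" "card {i \<in> set js. incident es i v \<and> pin i = 0} \<le> d'"
      by (cases d) auto
    have IH: "(\<Sum>a\<leftarrow>List.n_lists d' [1..<Suc k].
        pinned_sum k es h S (pin_edges es v js (pad_zero a) (pin(j := c)))) =
        of_nat k ^ d' * pinned_sum k es h S (pin(j := c))" for c
    proof (rule Cons.IH)
      have "{i \<in> set js. incident es i v \<and> (pin(j := c)) i = 0} =
          {i \<in> set js. incident es i v \<and> pin i = 0}"
        using Cons.prems by auto
      then show "card {i \<in> set js. incident es i v \<and> (pin(j := c)) i = 0} \<le> d'"
        using d by simp
    qed (use Cons.prems in auto)
    have "(\<Sum>c\<leftarrow>[1..<Suc k]. of_nat k ^ d' * pinned_sum k es h S (pin(j := c))) =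
        of_nat k ^ d' * (of_nat k * pinned_sum k es h S pin)"
      using pinned_sum_average[of j es pin k h S] Cons.prems True
      by (simp add: sum_list_const_mult del: upt_Suc One_nat_def)
    then show ?thesis
      unfolding d(1) sum_list_n_lists_Suc using True
      by (simp add: IH pad_zero_Cons mult_ac del: upt_Suc One_nat_def)
  next
    case False
    then have "{i \<in> set (j # js). incident es i v \<and> pin i = 0} =
        {i \<in> set js. incident es i v \<and> pin i = 0}" by auto
    then show ?thesis
      unfolding pin_edges.simps if_not_P[OF False] using Cons.prems by (intro Cons.IH) simp_all
  qed
qed

text \<open>With enough nonzero colours no edge at \<open>v\<close> stays free, which makes the
  factor of \<open>v\<close> independent of the summation variables.\<close>

lemma pin_edges_nonzero:
  assumes "card {j \<in> set js. incident es j v \<and> pin j = 0} \<le> d" "\<And>i. i < d \<Longrightarrow> a i \<noteq> 0"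
    "distinct js" "j \<in> set js" "incident es j v"
  shows "pin_edges es v js a pin j \<noteq> 0"
  using assms
proof (induction js arbitrary: a pin d)
  case (Cons i js)
  show ?case
  proof (cases "incident es i v \<and> pin i = 0")
    case True
    have "{j \<in> set (i # js). incident es j v \<and> pin j = 0} =
        insert i {j \<in> set js. incident es j v \<and> pin j = 0}"
      using True by auto
    then have "Suc (card {j \<in> set js. incident es j v \<and> pin j = 0}) \<le> d"
      using Cons.prems by simp
    then obtain d' where d: "d = Suc d'" "card {j \<in> set js. incident es j v \<and> pin j = 0} \<le> d'"
      by (cases d) auto
    have e: "{j \<in> set js. incident es j v \<and> (pin(i := a 0)) j = 0} =
        {j \<in> set js. incident es j v \<and> pin j = 0}"
      using Cons.prems by auto
    show ?thesis
    proof (cases "j = i")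
      case True
      then show ?thesis using \<open>incident es i v \<and> pin i = 0\<close> Cons.prems d(1)
        by (simp add: pin_edges_other)
    next
      case False
      have "pin_edges es v js (\<lambda>i. a (Suc i)) (pin(i := a 0)) j \<noteq> 0"
        by (rule Cons.IH[where d = d']) (use True False Cons.prems d e in auto)
      then show ?thesis using True by simp
    qed
  next
    case False
    then have e: "{j \<in> set (i # js). incident es j v \<and> pin j = 0} =
        {j \<in> set js. incident es j v \<and> pin j = 0}" by auto
    show ?thesis
    proof (cases "j = i")
      case True
      then show ?thesis using False Cons.prems by (auto simp: pin_edges_other)
    next
      case False
      have "pin_edges es v js a pin j \<noteq> 0"
        by (rule Cons.IH) (use Cons.prems e False in auto)
      then show ?thesis
        unfolding pin_edges.simps if_not_P[OF \<open>\<not> (incident es i v \<and> pin i = 0)\<close>] .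
    qed
  qed
qed simp

lemma color_counts_cong:
  assumes "\<And>j. j < length es \<Longrightarrow> incident es j v \<Longrightarrow> \<phi> j = \<psi> j"
  shows "color_counts k es \<phi> v = color_counts k es \<psi> v"
proof -
  have "color_count es \<phi> v c = color_count es \<psi> v c" for c
    unfolding color_count_def using assms by (intro sum.cong) (auto simp: incident_def)
  then show ?thesis by (simp add: color_counts_def)
qed

lemma kids_sound:
  "(u, al') \<in> set (kids al us) \<Longrightarrow> al u \<noteq> 0 \<and> al' u = 0 \<and> u \<in> set us \<and> alive al' \<subset> alive al"
proof (induction us arbitrary: al)
  case (Cons x us)
  show ?case
  proof (cases "al x \<noteq> 0")
    case True
    then have sub: "alive (al(x := 0)) \<subset> alive al" by (auto simp: alive_def)
    from Cons.prems True consider "u = x" "al' = al(x := 0)" | "(u, al') \<in> set (kids (al(x := 0)) us)"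
      by (auto simp del: fun_upd_apply)
    then show ?thesis
    proof cases
      case 1
      then show ?thesis unfolding 1 using True by (auto simp: alive_def)
    next
      case 2
      from Cons.IH[OF this] have IH: "(al(x := 0)) u \<noteq> 0" "al' u = 0" "u \<in> set us"
        "alive al' \<subset> alive (al(x := 0))"
        by blast+
      from IH(1) have "al u \<noteq> 0" by (simp split: if_splits)
      then show ?thesis using IH(2-4) sub by auto
    qed
  qed (use Cons in auto)
qed simp

text \<open>Every recorded candidate leaves the set of remaining vertices, so repetitions in
  \<open>us\<close> are not counted.\<close>

lemma length_kids: "length (kids al us) \<le> card (set us \<inter> alive al)"
proof (induction us arbitrary: al)
  case (Cons u us)
  show ?case
  proof (cases "al u \<noteq> 0")
    case True
    then have "set (u # us) \<inter> alive al = insert u (set us \<inter> alive (al(u := 0)))"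
      by (auto simp: alive_def)
    moreover have "u \<notin> set us \<inter> alive (al(u := 0))" by (simp add: alive_def)
    moreover have "length (kids (al(u := 0)) us) \<le> card (set us \<inter> alive (al(u := 0)))"
      by (rule Cons.IH)
    ultimately show ?thesis using True by simp
  next
    case False
    then have "set (u # us) \<inter> alive al = set us \<inter> alive al" by (auto simp: alive_def)
    then show ?thesis using Cons False by simp
  qed
qed simp

text \<open>Each ratio restores one removed vertex. Applied to the neighbours of a vertex in the
  recursion, and to all vertices to express the partition function.\<close>

lemma pinned_sum_telescope:
  assumes "\<And>u al'. (u, al') \<in> set (kids al us) \<Longrightarrow> pinned_sum k es h (alive al') pin \<noteq> 0"
  shows "pinned_sum k es h (alive al) pin = pinned_sum k es h (alive al - set us) pin *
    prod_list (map (\<lambda>(u, al'). vertex_ratio k es h al' pin u) (kids al us))"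
  using assms
proof (induction us arbitrary: al)
  case (Cons u us)
  show ?case
  proof (cases "al u \<noteq> 0")
    case True
    have i: "insert u (alive (al(u := 0))) = alive al" using True by (auto simp: alive_def)
    have s: "alive (al(u := 0)) - set us = alive al - set (u # us)" by (auto simp: alive_def)
    have nz: "pinned_sum k es h (alive (al(u := 0))) pin \<noteq> 0"
      using Cons.prems[of u "al(u := 0)"] True by (simp del: fun_upd_apply)
    have "pinned_sum k es h (alive (al(u := 0))) pin =
        pinned_sum k es h (alive (al(u := 0)) - set us) pin *
        prod_list (map (\<lambda>(u, al'). vertex_ratio k es h al' pin u) (kids (al(u := 0)) us))"
      
    proof (rule Cons.IH)
      fix w al' assume "(w, al') \<in> set (kids (al(u := 0)) us)"
      then show "pinned_sum k es h (alive al') pin \<noteq> 0"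
        using Cons.prems[of w al'] True by (simp del: fun_upd_apply)
    qed
    moreover have "vertex_ratio k es h (al(u := 0)) pin u * pinned_sum k es h (alive (al(u := 0))) pin =
        pinned_sum k es h (alive al) pin"
      using nz i by (simp add: vertex_ratio_def)
    ultimately show ?thesis unfolding s using True by (simp add: mult_ac)
  next
    case False
    then have "alive al - set (u # us) = alive al - set us" by (auto simp: alive_def)
    then show ?thesis using Cons False by simp
  qed
qed simp

section \<open>The recursion for vertex ratios\<close>

text \<open>The length is \<Delta> whatever the degree of the vertex, so every node of the tree has
  the same number k^\<Delta> of cells and the program can be unrolled over this list.\<close>

definition colorings :: "nat \<Rightarrow> nat \<Rightarrow> nat list list" where
  "colorings \<Delta> k = List.n_lists \<Delta> [1..<Suc k]"

definition pin_at :: "(nat \<times> nat) list \<Rightarrow> nat \<Rightarrow> nat list \<Rightarrow> (nat \<Rightarrow> nat) \<Rightarrow> nat \<Rightarrow> nat" where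
  "pin_at es v a pin = pin_edges es v [0..<length es] (pad_zero a) pin"

definition deviation ::
  "nat \<Rightarrow> (nat \<times> nat) list \<Rightarrow> edge_coloring_model \<Rightarrow> nat \<Rightarrow> (nat \<Rightarrow> nat) \<Rightarrow> nat list \<Rightarrow> complex" where
  "deviation k es h v pin a = h (color_counts k es (pin_at es v a pin) v) - 1"

definition mean_ratio ::
  "'a list \<Rightarrow> ('a \<Rightarrow> complex) \<Rightarrow> ('a \<Rightarrow> complex) \<Rightarrow> complex" where
  "mean_ratio as f w = 1 + (\<Sum>a\<leftarrow>as. f a * w a) / (\<Sum>a\<leftarrow>as. w a)"

text \<open>At depth 0 the unknown ratios of the neighbours are replaced by 1. A vertex without
  remaining neighbours has empty products and is computed exactly at every depth.\<close>

primrec approx_ratio :: "nat \<Rightarrow> nat \<Rightarrow> (nat \<times> nat) list \<Rightarrow> edge_coloring_model \<Rightarrow> nat \<Rightarrow>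
    (nat \<Rightarrow> nat) \<Rightarrow> (nat \<Rightarrow> nat) \<Rightarrow> nat \<Rightarrow> complex" where
  "approx_ratio \<Delta> k es h 0 = (\<lambda>al pin v.
     mean_ratio (colorings \<Delta> k) (deviation k es h v pin) (\<lambda>a. 1))"
| "approx_ratio \<Delta> k es h (Suc l) = (\<lambda>al pin v.
     mean_ratio (colorings \<Delta> k) (deviation k es h v pin) (\<lambda>a.
       prod_list (map (\<lambda>(u, al'). approx_ratio \<Delta> k es h l al' (pin_at es v a pin) u)
         (kids al (nbrs es v)))))"

lemma set_colorings: "set (colorings \<Delta> k) = {a. length a = \<Delta> \<and> set a \<subseteq> {1..k}}"
  by (auto simp: colorings_def set_n_lists simp del: upt_Suc)

lemma length_colorings: "length (colorings \<Delta> k) = k ^ \<Delta>"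
  by (simp add: colorings_def length_n_lists del: upt_Suc)

lemma distinct_colorings: "distinct (colorings \<Delta> k)"
  by (simp add: colorings_def distinct_n_lists del: upt_Suc)

lemma mean_ratio_colorings:
  "mean_ratio (colorings \<Delta> k) f w =
    1 + (\<Sum>a\<in>set (colorings \<Delta> k). f a * w a) / (\<Sum>a\<in>set (colorings \<Delta> k). w a)"
  unfolding mean_ratio_def by (simp add: sum_list_distinct_conv_sum_set distinct_colorings)

text \<open>Incident edges are counted here, a loop once; this is at most the degree and is all that
  the estimates need.\<close>

locale edge_model =
  fixes n k \<Delta> :: nat and es :: "(nat \<times> nat) list" and h :: edge_coloring_model
  assumes k: "k \<ge> 1"
    and ends: "\<And>j. j < length es \<Longrightarrow> fst (es ! j) < n \<and> snd (es ! j) < n"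
    and degree: "\<And>v. card {j. j < length es \<and> incident es j v} \<le> \<Delta>"
    and near_one: "\<And>a. length a = k \<Longrightarrow> cmod (h a - 1) \<le> 0.35 / (real \<Delta> + 1)"
begin

abbreviation "C \<equiv> colorings \<Delta> k"
abbreviation "Z \<equiv> pinned_sum k es h"
abbreviation "X \<equiv> vertex_ratio k es h"
abbreviation "R \<equiv> approx_ratio \<Delta> k es h"

lemma colorings_nonempty: "set C \<noteq> {}"
proof -
  have "length C > 0" using k by (simp add: length_colorings)
  then show ?thesis by auto
qed

lemma degree_pinned: "card {j \<in> set [0..<length es]. incident es j v \<and> pin j = 0} \<le> \<Delta>"
proof (rule order_trans[OF card_mono degree[of v]])
  show "{j \<in> set [0..<length es]. incident es j v \<and> pin j = 0} \<subseteq> {j. j < length es \<and> incident es j v}"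
    by auto
qed (auto intro: finite_subset[of _ "{..<length es}"])

lemma deviation_bound: "cmod (deviation k es h v pin a) \<le> 0.35 / (real \<Delta> + 1)"
  unfolding deviation_def by (rule near_one) (simp add: color_counts_def del: upt_Suc)

lemma set_nbrs:
  "set (nbrs es v) = {u. \<exists>j<length es. incident es j v \<and> (u = fst (es ! j) \<or> u = snd (es ! j))}"
  by (auto simp: nbrs_def split: if_splits)

text \<open>Since \<open>v\<close> itself is removed, every child is the other end of an edge at
  \<open>v\<close>. The bound \<Delta>, instead of the length of \<open>nbrs\<close>, is what keeps
  the products in the disc.\<close>

lemma length_kids_nbrs:
  assumes "al v = 0"
  shows "length (kids al (nbrs es v)) \<le> \<Delta>"
proof -
  let ?I = "{j. j < length es \<and> incident es j v}"
  have fin: "finite ?I" by (rule finite_subset[of _ "{..<length es}"]) auto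
  have "set (nbrs es v) \<inter> alive al \<subseteq>
      (\<lambda>j. if fst (es ! j) = v then snd (es ! j) else fst (es ! j)) ` ?I"
  proof
    fix u assume "u \<in> set (nbrs es v) \<inter> alive al"
    then obtain j where j: "j < length es" "incident es j v" "u = fst (es ! j) \<or> u = snd (es ! j)"
      and "al u \<noteq> 0"
      by (auto simp: set_nbrs alive_def)
    moreover from this assms have "u \<noteq> v" by auto
    ultimately have "u = (if fst (es ! j) = v then snd (es ! j) else fst (es ! j))"
      by (auto simp: incident_def)
    with j show "u \<in> (\<lambda>j. if fst (es ! j) = v then snd (es ! j) else fst (es ! j)) ` ?I"
      by blast
  qed
  then have "card (set (nbrs es v) \<inter> alive al) \<le> card ?I"
    using fin by (meson surj_card_le)
  then show ?thesis using length_kids[of al "nbrs es v"] degree[of v] by linarith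
qed

text \<open>A vertex outside \<open>nbrs es v\<close> sees no edge at \<open>v\<close>. The sum left
  after removing all neighbours is therefore the same for all colours at \<open>v\<close> and
  cancels in the recursion.\<close>

lemma pinned_sum_pin_at_far:
  assumes "al v = 0"
  shows "Z (alive al - set (nbrs es v)) (pin_at es v a pin) = Z (alive al - set (nbrs es v)) pin"
  unfolding pinned_sum_def
proof (intro sum.cong prod.cong refl arg_cong[of _ _ h] color_counts_cong)
  fix \<phi> u j
  assume "u \<in> alive al - set (nbrs es v)" "j < length es" "incident es j u"
  then have "\<not> incident es j v" unfolding set_nbrs incident_def by blast
  then show "override (pin_at es v a pin) \<phi> j = override pin \<phi> j"
    by (simp add: override_def pin_at_def pin_edges_other)
qed

lemma pinned_sum_insert:
  assumes "a \<in> set C" "v \<notin> S" "finite S"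
  shows "Z (insert v S) (pin_at es v a pin) =
    (1 + deviation k es h v pin a) * Z S (pin_at es v a pin)"
proof -
  have "color_counts k es (override (pin_at es v a pin) \<phi>) v = color_counts k es (pin_at es v a pin) v"
    for \<phi>
  proof (rule color_counts_cong)
    fix j assume j: "j < length es" "incident es j v"
    have "pad_zero a i \<noteq> 0" if "i < \<Delta>" for i
      using assms(1) that by (fastforce simp: set_colorings pad_zero_def dest!: nth_mem)
    then have "pin_at es v a pin j \<noteq> 0"
      unfolding pin_at_def using j by (intro pin_edges_nonzero[OF degree_pinned]) auto
    then show "override (pin_at es v a pin) \<phi> j = pin_at es v a pin j" by (simp add: override_def)
  qed
  then show ?thesis
    unfolding pinned_sum_def deviation_def using assms(2,3) by (simp add: sum_distrib_left)
qed

lemma pinned_sum_average_colorings: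
  "(\<Sum>a\<in>set C. Z S (pin_at es v a pin)) = of_nat (k ^ \<Delta>) * Z S pin"
  using pinned_sum_average_list[OF _ _ degree_pinned, where v = v and pin = pin and k = k and h = h and S = S]
  by (simp add: pin_at_def colorings_def sum_list_distinct_conv_sum_set distinct_n_lists atLeast_upt
      del: upt_Suc)

text \<open>Averaging over the colours at \<open>v\<close> makes the factor of \<open>v\<close> constant; deleting the neighbours of
  \<open>v\<close> one by one turns the remaining sums into products of ratios for smaller sets.\<close>

lemma vertex_ratio_recursion:
  assumes fin: "finite (alive al)" and v: "al v = 0"
    and nz: "\<And>al' pin. alive al' \<subseteq> alive al \<Longrightarrow> Z (alive al') pin \<noteq> 0"
  shows "X al pin v = mean_ratio C (deviation k es h v pin) (\<lambda>a.
    prod_list (map (\<lambda>(u, al'). X al' (pin_at es v a pin) u) (kids al (nbrs es v))))"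
proof -
  define w where "w a = prod_list (map (\<lambda>(u, al'). X al' (pin_at es v a pin) u) (kids al (nbrs es v)))" for a
  define Z0 where "Z0 = Z (alive al - set (nbrs es v)) pin"
  define K where "K = complex_of_nat (k ^ \<Delta>)"
  have K: "K \<noteq> 0" using k by (simp add: K_def)
  have Zw: "Z (alive al) (pin_at es v a pin) = Z0 * w a" for a
  proof -
    have "Z (alive al) (pin_at es v a pin) = Z (alive al - set (nbrs es v)) (pin_at es v a pin) * w a"
      unfolding w_def by (rule pinned_sum_telescope) (use kids_sound nz in blast)
    then show ?thesis unfolding Z0_def using pinned_sum_pin_at_far[where al = al and v = v] v by simp
  qed
  have sw: "K * Z (alive al) pin = Z0 * (\<Sum>a\<in>set C. w a)"
    unfolding K_def pinned_sum_average_colorings[of "alive al" v pin, symmetric] Zw by (simp add: sum_distrib_left)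
  have "v \<notin> alive al" using v by (simp add: alive_def)
  then have "K * Z (insert v (alive al)) pin =
      (\<Sum>a\<in>set C. (1 + deviation k es h v pin a) * (Z0 * w a))"
    unfolding K_def pinned_sum_average_colorings[of "insert v (alive al)" v pin, symmetric]
    using fin by (intro sum.cong refl) (simp add: pinned_sum_insert Zw)
  also have "\<dots> = Z0 * ((\<Sum>a\<in>set C. w a) + (\<Sum>a\<in>set C. deviation k es h v pin a * w a))"
    by (simp add: sum_distrib_left sum.distrib algebra_simps)
  finally have sv: "K * Z (insert v (alive al)) pin =
      Z0 * ((\<Sum>a\<in>set C. w a) + (\<Sum>a\<in>set C. deviation k es h v pin a * w a))" .
  \<comment> \<open>The denominator of the mean is nonzero because, up to \<open>Z0\<close> and
    \<open>K\<close>, it is the nonvanishing sum for \<open>alive al\<close>.\<close>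
  have "Z0 * (\<Sum>a\<in>set C. w a) \<noteq> 0" using sw nz[of al pin] K by auto
  moreover have "X al pin v = (K * Z (insert v (alive al)) pin) / (K * Z (alive al) pin)"
    using K by (simp add: vertex_ratio_def)
  ultimately show ?thesis
    unfolding sw sv mean_ratio_colorings w_def[symmetric] by (simp add: add_divide_distrib)
qed

lemma mean_ratio_near_one:
  assumes "\<And>a x. a \<in> set C \<Longrightarrow> x \<in> set (r a) \<Longrightarrow> cmod (x - 1) \<le> 0.42 / (real \<Delta> + 1)"
    "\<And>a. a \<in> set C \<Longrightarrow> length (r a) \<le> \<Delta>"
  shows "cmod (mean_ratio C (deviation k es h v pin) (\<lambda>a. prod_list (r a)) - 1) \<le> 0.42 / (real \<Delta> + 1)"
proof -
  have "cmod (mean_ratio C (deviation k es h v pin) (\<lambda>a. prod_list (r a)) - 1) \<le> 0.35 / (real \<Delta> + 1) / 0.835"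
    unfolding mean_ratio_colorings add_diff_cancel_left'
    by (rule weighted_mean_bound)
      (use colorings_nonempty deviation_bound assms prod_list_in_cone[where \<Delta> = \<Delta>] in auto)
  \<comment> \<open>The invariant radius reproduces itself: 0.35/0.835 < 0.42.\<close>
  also have "\<dots> \<le> 0.42 / (real \<Delta> + 1)" by (simp add: field_simps)
  finally show ?thesis .
qed

lemma near_one_nonzero: "cmod (x - 1) \<le> 0.42 / (real \<Delta> + 1) \<Longrightarrow> x \<noteq> 0 \<and> 1 - 0.42 \<le> cmod x"
proof -
  assume "cmod (x - 1) \<le> 0.42 / (real \<Delta> + 1)"
  also have "\<dots> \<le> 0.42" by (simp add: field_simps)
  finally have "1 - 0.42 \<le> cmod x"
    using norm_triangle_ineq2[of 1 "1 - x"] norm_minus_commute[of x 1] by simp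
  then show ?thesis by auto
qed

text \<open>The two claims need each other: a sum is nonzero because the ratio over the set with one
  vertex fewer is, and the ratio over a set needs nonzero sums for all its subsets. The pinning is
  generalised since the recursion changes it.\<close>

lemma pinned_sum_nonzero_and_ratio:
  assumes "finite (alive al)"
  shows "Z (alive al) pin \<noteq> 0 \<and> (\<forall>v. al v = 0 \<longrightarrow> cmod (X al pin v - 1) \<le> 0.42 / (real \<Delta> + 1))"
  using assms
proof (induction "card (alive al)" arbitrary: al pin rule: less_induct)
  case less
  have smaller: "Z (alive al') pin' \<noteq> 0 \<and> (\<forall>v. al' v = 0 \<longrightarrow> cmod (X al' pin' v - 1) \<le> 0.42 / (real \<Delta> + 1))"
    if "alive al' \<subset> alive al" for al' pin'
    using less that by (meson finite_subset psubset_card_mono psubset_imp_subset)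
  \<comment> \<open>For the empty set the sum is k^|E|. Otherwise a zero numerator would make the
    ratio of the smaller set 0, against the induction hypothesis.\<close>
  have nz: "Z (alive al) pin \<noteq> 0" for pin
  proof (cases "alive al = {}")
    case True
    then show ?thesis using k by (simp add: pinned_sum_def card_PiE)
  next
    case False
    then obtain u where u: "al u \<noteq> 0" by (auto simp: alive_def)
    have sub: "alive (al(u := 0)) \<subset> alive al" and i: "insert u (alive (al(u := 0))) = alive al"
      using u by (auto simp: alive_def)
    have "X (al(u := 0)) pin u \<noteq> 0" using smaller[OF sub, of pin] near_one_nonzero by simp
    then show ?thesis unfolding vertex_ratio_def i by auto
  qed
  have nz': "Z (alive al') pin \<noteq> 0" if "alive al' \<subseteq> alive al" for al' pin
    using nz smaller that by (metis psubsetI)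
  have "cmod (X al pin v - 1) \<le> 0.42 / (real \<Delta> + 1)" if v: "al v = 0" for v
  proof -
    have "X al pin v = mean_ratio C (deviation k es h v pin) (\<lambda>a.
        prod_list (map (\<lambda>(u, al'). X al' (pin_at es v a pin) u) (kids al (nbrs es v))))"
      by (rule vertex_ratio_recursion) (use less.prems v nz' in auto)
    moreover have "cmod (mean_ratio C (deviation k es h v pin) (\<lambda>a.
        prod_list (map (\<lambda>(u, al'). X al' (pin_at es v a pin) u) (kids al (nbrs es v)))) - 1)
      \<le> 0.42 / (real \<Delta> + 1)"
    proof (rule mean_ratio_near_one)
    fix a x assume "x \<in> set (map (\<lambda>(u, al'). X al' (pin_at es v a pin) u) (kids al (nbrs es v)))"
    then show "cmod (x - 1) \<le> 0.42 / (real \<Delta> + 1)"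
      using kids_sound smaller by fastforce
    qed (use length_kids_nbrs v in simp)
    ultimately show ?thesis by simp
  qed
  with nz show ?case by blast
qed

lemmas pinned_sum_nonzero = pinned_sum_nonzero_and_ratio[THEN conjunct1]
lemmas vertex_ratio_near_one = pinned_sum_nonzero_and_ratio[THEN conjunct2, rule_format]

text \<open>Truncated ratios stay in the disc as well, depth 0 being the case of empty products. The
  contraction needs this, since it mixes exact and truncated factors.\<close>

lemma approx_ratio_near_one:
  "al v = 0 \<Longrightarrow> cmod (R l al pin v - 1) \<le> 0.42 / (real \<Delta> + 1)"
proof (induction l arbitrary: al pin v)
  case 0
  have "cmod (mean_ratio C (deviation k es h v pin) (\<lambda>a. prod_list []) - 1) \<le> 0.42 / (real \<Delta> + 1)"
    by (rule mean_ratio_near_one) auto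
  then show ?case by simp
next
  case (Suc l)
  show ?case unfolding approx_ratio.simps
  proof (rule mean_ratio_near_one)
    fix a x assume "x \<in> set (map (\<lambda>(u, al'). R l al' (pin_at es v a pin) u) (kids al (nbrs es v)))"
    then show "cmod (x - 1) \<le> 0.42 / (real \<Delta> + 1)"
      using kids_sound Suc.IH by fastforce
  qed (use length_kids_nbrs Suc.prems in simp)
qed

lemma approx_ratio_error:
  assumes "finite (alive al)" "al v = 0"
  shows "cmod (R l al pin v - X al pin v) \<le> 0.93 ^ l"
  using assms
proof (induction l arbitrary: al pin v)
  case 0
  \<comment> \<open>Two points within 0.42 of 1 differ by at most 0.84, which is below
    0.93^0.\<close>
  have "0.42 / (real \<Delta> + 1) \<le> 0.42" by (simp add: field_simps)
  then show ?case
    using approx_ratio_near_one[where al = al and v = v and l = 0 and pin = pin]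
        vertex_ratio_near_one[where al = al and v = v and pin = pin] 0
      norm_triangle_ineq4[of "R 0 al pin v - 1" "X al pin v - 1"] by simp
next
  case (Suc l)
  let ?ks = "kids al (nbrs es v)"
  have fin: "finite (alive al')" if "(u, al') \<in> set ?ks" for u al'
    using kids_sound[OF that] Suc.prems finite_subset by blast
  have "cmod (mean_ratio C (deviation k es h v pin) (\<lambda>a. prod_list (map (\<lambda>(u, al'). R l al' (pin_at es v a pin) u) ?ks)) -
      mean_ratio C (deviation k es h v pin) (\<lambda>a. prod_list (map (\<lambda>(u, al'). X al' (pin_at es v a pin) u) ?ks)))
    \<le> 0.93 * 0.93 ^ l"
    unfolding mean_ratio_colorings add_diff_cancel_left
  proof (rule weighted_mean_contraction[where \<Delta> = \<Delta>])
    fix a i assume "i < length (map (\<lambda>(u, al'). R l al' (pin_at es v a pin) u) ?ks)"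
    then have "?ks ! i \<in> set ?ks" and i: "i < length ?ks" by simp_all
    then have "cmod (R l (snd (?ks ! i)) p (fst (?ks ! i)) - X (snd (?ks ! i)) p (fst (?ks ! i))) \<le> 0.93 ^ l" for p
      using Suc.IH[of "snd (?ks ! i)" "fst (?ks ! i)" p] kids_sound[of "fst (?ks ! i)" "snd (?ks ! i)" al "nbrs es v"]
        fin[of "fst (?ks ! i)" "snd (?ks ! i)"] by simp
    then show "cmod (map (\<lambda>(u, al'). R l al' (pin_at es v a pin) u) ?ks ! i -
        map (\<lambda>(u, al'). X al' (pin_at es v a pin) u) ?ks ! i) \<le> 0.93 ^ l"
      using i by (simp add: case_prod_unfold)
  next
    fix a x assume "x \<in> set (map (\<lambda>(u, al'). R l al' (pin_at es v a pin) u) ?ks)"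
    then show "cmod (x - 1) \<le> 0.42 / (real \<Delta> + 1)"
      using kids_sound approx_ratio_near_one by fastforce
  next
    fix a x assume "x \<in> set (map (\<lambda>(u, al'). X al' (pin_at es v a pin) u) ?ks)"
    then show "cmod (x - 1) \<le> 0.42 / (real \<Delta> + 1)"
      using kids_sound vertex_ratio_near_one fin by fastforce
  qed (use colorings_nonempty deviation_bound length_kids_nbrs Suc.prems in auto)
  moreover have "X al pin v = mean_ratio C (deviation k es h v pin) (\<lambda>a.
      prod_list (map (\<lambda>(u, al'). X al' (pin_at es v a pin) u) ?ks))"
    by (rule vertex_ratio_recursion) (use Suc.prems in simp_all, use pinned_sum_nonzero Suc.prems(1) finite_subset in blast)
  ultimately show ?case by simp
qed

end

section \<open>Approximation of the partition function\<close>

text \<open>The real part of \<open>L\<close> controls the quotient of the moduli and its imaginary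
  part the angle; the relative error is carried as an exponent so that the errors of the factors of
  a product simply add.\<close>

lemma multiplicative_approx_exp:
  assumes "\<xi> \<noteq> 0" "cmod L \<le> \<epsilon>"
  shows "multiplicative_approx \<epsilon> (\<xi> * exp L) \<xi>"
proof -
  have L: "\<bar>Re L\<bar> \<le> \<epsilon>" "\<bar>Im L\<bar> \<le> \<epsilon>"
    using assms(2) abs_Re_le_cmod[of L] abs_Im_le_cmod[of L] by linarith+
  have "inner \<xi> (\<xi> * z) = (cmod \<xi>)\<^sup>2 * Re z" for z
    unfolding cmod_power2 by (simp add: inner_complex_def power2_eq_square algebra_simps)
  then have "inner \<xi> (\<xi> * exp L) / (cmod \<xi> * cmod (\<xi> * exp L)) = cos (Im L)"
    using assms(1) by (simp add: norm_mult Re_exp power2_eq_square)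
  then have angle: "vector_angle \<xi> (\<xi> * exp L) = arccos (cos (Im L))"
    by (simp add: vector_angle_def)
  have "arccos (cos (Im L)) \<le> \<epsilon>"
  proof (cases "\<bar>Im L\<bar> \<le> pi")
    case True
    then show ?thesis using L by (simp add: arccos_cos_eq_abs)
  next
    \<comment> \<open>Here \<epsilon> exceeds pi, and \<open>arccos\<close> never does.\<close>
    case False
    then show ?thesis using L arccos_ubound[of "cos (Im L)"] by simp
  qed
  then show ?thesis
    unfolding multiplicative_approx_def angle using assms(1) L by (auto simp: norm_mult abs_le_iff)
qed

text \<open>With z = (x - r)/r, |z| <= d/0.58 < 1/2 and |Ln (1 + z)| <= 2 |z|; the constant 4 is
  2/0.58 rounded up.\<close>

lemma quotient_exp:
  fixes x r :: complex
  assumes "cmod (r - x) \<le> d" "0.58 \<le> cmod r" "d \<le> 1 / 4"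
  shows "\<exists>L. x = r * exp L \<and> cmod L \<le> 4 * d"
proof -
  define z where "z = (x - r) / r"
  have r: "r \<noteq> 0" using assms(2) by auto
  have d: "d \<ge> 0" by (rule order_trans[OF norm_ge_zero assms(1)])
  then have "cmod z \<le> d / 0.58"
    unfolding z_def norm_divide using assms by (intro frac_le) (auto simp: norm_minus_commute)
  then have z: "cmod z < 1 / 2" "2 * cmod z \<le> 4 * d" using d assms(3) by simp_all
  have "1 + z \<noteq> 0"
  proof
    assume "1 + z = 0"
    then have "z = -1" by (simp add: add_eq_0_iff)
    then show False using z by simp
  qed
  then have "x = r * exp (Ln (1 + z))" using r by (simp add: z_def field_simps)
  moreover have "cmod (Ln (1 + z)) \<le> 4 * d" using norm_Ln_le[of z] z by simp
  ultimately show ?thesis by blast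
qed

lemma prod_list_exp:
  fixes r x :: "'a \<Rightarrow> complex"
  assumes "\<And>i. i \<in> set js \<Longrightarrow> \<exists>L. x i = r i * exp L \<and> cmod L \<le> d"
  shows "\<exists>L. prod_list (map x js) = prod_list (map r js) * exp L \<and> cmod L \<le> real (length js) * d"
  using assms
proof (induction js)
  case (Cons i js)
  obtain L where L: "prod_list (map x js) = prod_list (map r js) * exp L" "cmod L \<le> real (length js) * d"
    using Cons by auto
  obtain M where M: "x i = r i * exp M" "cmod M \<le> d" using Cons.prems by auto
  have "cmod (M + L) \<le> real (length (i # js)) * d"
    using norm_triangle_ineq[of M L] L M by (simp add: algebra_simps)
  then show ?case using L M by (intro exI[of _ "M + L"]) (simp add: exp_add mult_ac)
qed (auto intro: exI[of _ 0])

context edge_model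
begin

text \<open>The power of \<open>k\<close> is the sum for the empty vertex set; the telescoping
  product over all vertices starts from it.\<close>

definition approx_output :: "nat \<Rightarrow> complex" where
  "approx_output l = of_nat k ^ length es * prod_list (map (\<lambda>(u, al). R l al (\<lambda>_. 0) u)
     (kids (\<lambda>i. if i < n then 1 else 0) [0..<n]))"

lemma approx_output_correct:
  assumes "4 * real n * 0.93 ^ l \<le> 1" "4 * real n * 0.93 ^ l \<le> \<epsilon>"
  shows "multiplicative_approx \<epsilon> (Z {..<n} (\<lambda>_. 0)) (approx_output l)"
proof -
  define al0 :: "nat \<Rightarrow> nat" where "al0 = (\<lambda>i. if i < n then 1 else 0)"
  define ks where "ks = kids al0 [0..<n]"
  define p0 :: "nat \<Rightarrow> nat" where "p0 = (\<lambda>_. 0)"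
  have alive: "alive al0 = {..<n}" by (auto simp: alive_def al0_def)
  have fin: "finite (alive al') \<and> al' u = 0" if "(u, al') \<in> set ks" for u al'
    using kids_sound[OF that[unfolded ks_def]] alive finite_subset by auto
  have len: "length ks \<le> n"
    using length_kids[of al0 "[0..<n]"] by (simp add: ks_def alive atLeast0LessThan)
  have nz: "Z (alive al') pin \<noteq> 0" if "(u, al') \<in> set ks" for u al' pin
    using pinned_sum_nonzero[where al = al'] fin[OF that] by simp
  have "Z (alive al0) p0 = Z (alive al0 - set [0..<n]) p0 * prod_list (map (\<lambda>(u, al'). X al' p0 u) ks)"
    unfolding ks_def by (rule pinned_sum_telescope) (rule nz[unfolded ks_def])
  moreover have "Z (alive al0 - set [0..<n]) p0 = of_nat k ^ length es"
    unfolding alive by (simp add: atLeast0LessThan pinned_sum_def card_PiE)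
  ultimately have Z: "Z {..<n} p0 = of_nat k ^ length es * prod_list (map (\<lambda>(u, al'). X al' p0 u) ks)"
    unfolding alive by simp
  have R: "cmod (R l al' p0 u) \<ge> 0.58 \<and> R l al' p0 u \<noteq> 0" if "(u, al') \<in> set ks" for u al'
    using near_one_nonzero[OF approx_ratio_near_one[where al = al' and v = u and l = l and pin = p0]] fin[OF that]
    by simp
  have "\<exists>L. (case p of (u, al') \<Rightarrow> X al' p0 u) = (case p of (u, al') \<Rightarrow> R l al' p0 u) * exp L \<and>
      cmod L \<le> 4 * 0.93 ^ l" if "p \<in> set ks" for p
  proof -
    obtain u al' where p: "p = (u, al')" by (cases p)
    have "n \<ge> 1" using len that by (cases ks) auto
    then have "4 * 0.93 ^ l \<le> 4 * real n * (0.93 ^ l :: real)" by simp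
    \<comment> \<open>This is the purpose of the bound by 1 on 4 n 0.93^l; the bound by \<epsilon>
      then covers the sum of at most n exponents.\<close>
    then have "0.93 ^ l \<le> (1 / 4 :: real)" using assms(1) by linarith
    then show ?thesis unfolding p prod.case
      using that fin R approx_ratio_error[where al = al' and v = u and l = l and pin = p0]
      by (intro quotient_exp) (auto simp: p)
  qed
  then obtain L where L: "prod_list (map (\<lambda>(u, al'). X al' p0 u) ks) =
      prod_list (map (\<lambda>(u, al'). R l al' p0 u) ks) * exp L"
    and "cmod L \<le> real (length ks) * (4 * 0.93 ^ l)"
    using prod_list_exp[where js = ks] by (smt (verit, best))
  note this(2)
  also have "real (length ks) * (4 * 0.93 ^ l) \<le> real n * (4 * 0.93 ^ l)"
    using len by (intro mult_right_mono) auto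
  finally have "cmod L \<le> \<epsilon>" using assms(2) by (simp add: mult_ac)
  moreover have "approx_output l \<noteq> 0"
    using R k by (auto simp: approx_output_def prod_list_zero_iff ks_def[unfolded al0_def, symmetric]
        p0_def[symmetric])
  ultimately have "multiplicative_approx \<epsilon> (approx_output l * exp L) (approx_output l)"
    by (intro multiplicative_approx_exp)
  also have "approx_output l * exp L = Z {..<n} p0"
    unfolding Z L approx_output_def by (simp add: ks_def al0_def p0_def)
  finally show ?thesis by (simp add: p0_def)
qed

end

section \<open>From multigraphs to numbered edge lists\<close>

lemma count_incident_image:
  assumes "finite (edges G)"
  shows "count (image_mset \<phi> (incident_edges G v)) c =
    (\<Sum>e\<in>edges G. if \<phi> e = c then count (ends G e) v else 0)"
proof -
  have "image_mset \<phi> (\<Sum>e\<in>E. replicate_mset (m e) e) = (\<Sum>e\<in>E. replicate_mset (m e) (\<phi> e))"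
    if "finite E" for E m
    using that by (induction rule: finite_induct) simp_all
  from this[OF assms, of "\<lambda>e. count (ends G e) v"]
  have "image_mset \<phi> (incident_edges G v) = (\<Sum>e\<in>edges G. replicate_mset (count (ends G e) v) (\<phi> e))"
    by (simp add: incident_edges_def)
  then show ?thesis by (simp add: count_sum) (rule sum.cong, auto)
qed

lemma vertex_degree_sum:
  assumes "finite (edges G)"
  shows "vertex_degree G v = (\<Sum>e\<in>edges G. count (ends G e) v)"
proof -
  have "size (\<Sum>e\<in>E. replicate_mset (m e) e) = (\<Sum>e\<in>E. m e)" if "finite E" for E m
    using that by (induction rule: finite_induct) simp_all
  then show ?thesis using assms by (simp add: vertex_degree_def incident_edges_def)
qed

lemma count_presented_ends:
  assumes "inj_on \<nu> {..<n}" "a < n" "b < n" "v < n"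
  shows "count {#\<nu> a, \<nu> b#} (\<nu> v) = (if a = v then 1 else 0) + (if b = v then 1 else 0)"
  using assms by (auto simp: inj_on_eq_iff)

text \<open>Colourings are carried along the numbering of the edges and vertex factors along that of
  the vertices; the zero pinning leaves every edge free.\<close>

lemma partition_function_presented:
  assumes "wf_multigraph G" "presents n es G"
  shows "partition_function k G h = pinned_sum k es h {..<n} (\<lambda>_. 0)"
proof -
  obtain \<nu> \<eta> where \<nu>: "bij_betw \<nu> {..<n} (verts G)" and \<eta>: "bij_betw \<eta> {..<length es} (edges G)"
    and es: "\<And>j. j < length es \<Longrightarrow> fst (es ! j) < n \<and> snd (es ! j) < n \<and>
        ends G (\<eta> j) = {#\<nu> (fst (es ! j)), \<nu> (snd (es ! j))#}"
    using assms(2) unfolding presents_def by blast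
  have fin: "finite (edges G)" using assms(1) by (simp add: wf_multigraph_def)
  define \<theta> where "\<theta> = inv_into {..<length es} \<eta>"
  have \<theta>: "\<And>e. e \<in> edges G \<Longrightarrow> \<theta> e < length es \<and> \<eta> (\<theta> e) = e" "\<And>j. j < length es \<Longrightarrow> \<theta> (\<eta> j) = j"
    using \<eta> inv_into_into[of _ \<eta> "{..<length es}"]
    by (auto simp: \<theta>_def bij_betw_def f_inv_into_f inv_into_f_f)
  have \<eta>E: "\<eta> j \<in> edges G" if "j < length es" for j using \<eta> that by (auto simp: bij_betw_def)
  have cv: "color_vector k G \<phi> (\<nu> v) = color_counts k es \<psi> v"
    if v: "v < n" and \<psi>: "\<And>j. j < length es \<Longrightarrow> \<psi> j = \<phi> (\<eta> j)" for \<phi> \<psi> v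
  proof -
    have "count (image_mset \<phi> (incident_edges G (\<nu> v))) c = color_count es \<psi> v c" for c
      unfolding count_incident_image[OF fin] color_count_def
        sum.reindex_bij_betw[OF \<eta>, symmetric]
      using es v \<nu> \<psi> count_presented_ends[of \<nu> n]
      by (intro sum.cong refl) (simp add: bij_betw_def)
    then show ?thesis by (simp add: color_vector_def color_counts_def del: upt_Suc)
  qed
  show ?thesis unfolding partition_function_def pinned_sum_def
  proof (rule sum.reindex_bij_witness[where
        i = "\<lambda>\<psi>. restrict (\<lambda>e. \<psi> (\<theta> e)) (edges G)" and j = "\<lambda>\<phi>. restrict (\<lambda>j. \<phi> (\<eta> j)) {..<length es}"])
    fix \<phi> assume \<phi>: "\<phi> \<in> edges G \<rightarrow>\<^sub>E {1..k}"
    show "restrict (\<lambda>e. restrict (\<lambda>j. \<phi> (\<eta> j)) {..<length es} (\<theta> e)) (edges G) = \<phi>"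
      using \<phi> \<theta>(1) by (auto simp: PiE_def extensional_def restrict_def fun_eq_iff)
    show "restrict (\<lambda>j. \<phi> (\<eta> j)) {..<length es} \<in> {..<length es} \<rightarrow>\<^sub>E {1..k}"
      using \<phi> \<eta>E by auto
    show "(\<Prod>v\<in>{..<n}. h (color_counts k es (override (\<lambda>_. 0) (restrict (\<lambda>j. \<phi> (\<eta> j)) {..<length es})) v)) =
        (\<Prod>v\<in>verts G. h (color_vector k G \<phi> v))"
      unfolding prod.reindex_bij_betw[OF \<nu>, symmetric]
    proof (rule prod.cong)
      fix v assume "v \<in> {..<n}"
      then show "h (color_counts k es (override (\<lambda>_. 0) (restrict (\<lambda>j. \<phi> (\<eta> j)) {..<length es})) v) =
          h (color_vector k G \<phi> (\<nu> v))"
        by (subst cv) (auto simp: override_def)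
    qed simp
  next
    fix \<psi> assume \<psi>: "\<psi> \<in> {..<length es} \<rightarrow>\<^sub>E {1..k}"
    show "restrict (\<lambda>j. restrict (\<lambda>e. \<psi> (\<theta> e)) (edges G) (\<eta> j)) {..<length es} = \<psi>"
      using \<psi> \<theta>(2) \<eta>E by (auto simp: PiE_def extensional_def restrict_def fun_eq_iff)
    show "restrict (\<lambda>e. \<psi> (\<theta> e)) (edges G) \<in> edges G \<rightarrow>\<^sub>E {1..k}"
      using \<psi> \<theta>(1) by auto
  qed
qed

lemma edge_model_presented:
  assumes "k \<ge> 1" "wf_multigraph G" "max_degree_le G \<Delta>" "presents n es G"
    and "\<And>a. length a = k \<Longrightarrow> cmod (h a - 1) \<le> 0.35 / (real \<Delta> + 1)"
  shows "edge_model n k \<Delta> es h"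
proof -
  obtain \<nu> \<eta> where \<nu>: "bij_betw \<nu> {..<n} (verts G)" and \<eta>: "bij_betw \<eta> {..<length es} (edges G)"
    and es: "\<And>j. j < length es \<Longrightarrow> fst (es ! j) < n \<and> snd (es ! j) < n \<and>
        ends G (\<eta> j) = {#\<nu> (fst (es ! j)), \<nu> (snd (es ! j))#}"
    using assms(4) unfolding presents_def by blast
  have fin: "finite (edges G)" using assms(2) by (simp add: wf_multigraph_def)
  have deg: "card {j. j < length es \<and> incident es j v} \<le> \<Delta>" for v
  proof (cases "v < n")
    case True
    have "{j. j < length es \<and> incident es j v} = {..<length es} \<inter> {j. incident es j v}" by auto
    then have "card {j. j < length es \<and> incident es j v} = (\<Sum>j<length es. if incident es j v then 1 else 0)"
      by (simp add: sum.If_cases)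
    \<comment> \<open>Strict exactly for loops, which are one incident edge but count twice in the
      degree.\<close>
    also have "\<dots> \<le> (\<Sum>j<length es. count (ends G (\<eta> j)) (\<nu> v))"
      using es True \<nu> count_presented_ends[of \<nu> n]
      by (intro sum_mono) (simp add: bij_betw_def incident_def)
    also have "\<dots> = vertex_degree G (\<nu> v)"
      unfolding vertex_degree_sum[OF fin] by (rule sum.reindex_bij_betw[OF \<eta>])
    also have "\<dots> \<le> \<Delta>" using assms(3) \<nu> True by (auto simp: max_degree_le_def bij_betw_def)
    finally show ?thesis .
  next
    case False
    then have "{j. j < length es \<and> incident es j v} = {}" using es by (auto simp: incident_def)
    then show ?thesis by (simp only: card.empty)
  qed
  show ?thesis by (unfold_locales) (use assms es deg in auto)
qed

lemma card_verts_presented: "presents n es G \<Longrightarrow> card (verts G) = n"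
  unfolding presents_def by (metis bij_betw_same_card card_lessThan)

lemma (in edge_model) length_edges: "length es \<le> n * \<Delta>"
proof -
  have "{..<length es} \<subseteq> (\<Union>v<n. {j. j < length es \<and> incident es j v})"
    using ends by (auto simp: incident_def)
  then have "length es \<le> card (\<Union>v<n. {j. j < length es \<and> incident es j v})"
    by (metis (no_types, lifting) card_lessThan card_mono finite_UN finite_lessThan finite_nat_set_iff_bounded mem_Collect_eq)
  also have "\<dots> \<le> (\<Sum>v<n. card {j. j < length es \<and> incident es j v})" by (rule card_UN_le) simp
  also have "\<dots> \<le> (\<Sum>v<n. \<Delta>)" by (rule sum_mono) (rule degree)
  finally show ?thesis by simp
qed

section \<open>Total correctness with time bounds\<close>

definition runs ::
  "edge_coloring_model \<Rightarrow> com \<Rightarrow> memory \<Rightarrow> nat \<Rightarrow> (memory \<Rightarrow> bool) \<Rightarrow> bool" where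
  "runs h c s T Q \<longleftrightarrow> (\<exists>s' t. exec h c s s' t \<and> t \<le> T \<and> Q s')"

lemma runs_mono:
  assumes "runs h c s T Q" "T \<le> T'" "\<And>s'. Q s' \<Longrightarrow> Q' s'"
  shows "runs h c s T' Q'"
  using assms unfolding runs_def by (meson order_trans)

lemma runs_Skip: "Q s \<Longrightarrow> 1 \<le> T \<Longrightarrow> runs h Skip s T Q"
  unfolding runs_def using exec.Skip by blast

lemma runs_NAssign:
  "Q (write_nat A (nval i s) (nval e s) s) \<Longrightarrow> 1 + ncost i + ncost e \<le> T \<Longrightarrow> runs h (NAssign A i e) s T Q"
  unfolding runs_def using exec.NAssign by blast

lemma runs_CAssign:
  "Q (write_num A (nval i s) (cval h e s) s) \<Longrightarrow> 1 + ncost i + ccost e \<le> T \<Longrightarrow> runs h (CAssign A i e) s T Q"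
  unfolding runs_def using exec.CAssign by blast

lemma runs_Seq:
  assumes "runs h c1 s T1 (\<lambda>s'. runs h c2 s' T2 Q)" "T1 + T2 \<le> T"
  shows "runs h (Seq c1 c2) s T Q"
proof -
  obtain s' t1 where 1: "exec h c1 s s' t1" "t1 \<le> T1" "runs h c2 s' T2 Q"
    using assms(1) unfolding runs_def by blast
  then obtain s'' t2 where 2: "exec h c2 s' s'' t2" "t2 \<le> T2" "Q s''" unfolding runs_def by blast
  have "exec h (Seq c1 c2) s s'' (t1 + t2)" using 1 2 exec.Seq by blast
  moreover have "t1 + t2 \<le> T" using 1 2 assms(2) by linarith
  ultimately show ?thesis unfolding runs_def using 2(3) by blast
qed

lemma runs_seq:
  assumes "runs h c1 s T1 P" "\<And>s'. P s' \<Longrightarrow> runs h c2 s' T2 Q"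
  shows "runs h (Seq c1 c2) s (T1 + T2) Q"
  by (rule runs_Seq[OF runs_mono[OF assms(1) order_refl assms(2)] order_refl])

lemma runs_Cond:
  assumes "bval h b s \<Longrightarrow> runs h c1 s T' Q" "\<not> bval h b s \<Longrightarrow> runs h c2 s T' Q" "1 + bcost b + T' \<le> T"
  shows "runs h (Cond b c1 c2) s T Q"
proof (cases "bval h b s")
  case True
  then obtain s' t where "exec h c1 s s' t" "t \<le> T'" "Q s'" using assms(1) unfolding runs_def by blast
  then show ?thesis unfolding runs_def
    using True exec.CondTrue[of h b s c1 s' t c2] assms(3) by (meson add_left_mono order_trans)
next
  case False
  then obtain s' t where "exec h c2 s s' t" "t \<le> T'" "Q s'" using assms(2) unfolding runs_def by blast
  then show ?thesis unfolding runs_def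
    using False exec.CondFalse[of h b s c2 s' t c1] assms(3) by (meson add_left_mono order_trans)
qed

text \<open>The potential bounds the number of rounds; the additional unit pays for the final
  failing test.\<close>

lemma runs_while:
  assumes inv: "I s" and step: "\<And>s. I s \<Longrightarrow> bval h b s \<Longrightarrow> runs h c s T (\<lambda>s'. I s' \<and> \<Phi> s' < (\<Phi> s :: nat))"
    and post: "\<And>s. I s \<Longrightarrow> \<not> bval h b s \<Longrightarrow> Q s"
    and T: "(\<Phi> s + 1) * (T + bcost b + 1) \<le> T'"
  shows "runs h (While b c) s T' Q"
proof -
  have "runs h (While b c) s ((\<Phi> s + 1) * (T + bcost b + 1)) Q"
    using inv
  proof (induction "\<Phi> s" arbitrary: s rule: less_induct)
    case less
    show ?case
    proof (cases "bval h b s")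
      case True
      obtain s' t where 1: "exec h c s s' t" "t \<le> T" "I s'" "\<Phi> s' < \<Phi> s"
        using step[OF less.prems True] unfolding runs_def by blast
      obtain s'' t' where 2: "exec h (While b c) s' s'' t'" "t' \<le> (\<Phi> s' + 1) * (T + bcost b + 1)" "Q s''"
        using less.hyps[OF 1(4,3)] unfolding runs_def by blast
      have "exec h (While b c) s s'' (1 + bcost b + t + t')" using True 1 2 exec.WhileTrue by blast
      moreover have "(\<Phi> s' + 1) * (T + bcost b + 1) \<le> \<Phi> s * (T + bcost b + 1)"
        using 1(4) by (intro mult_right_mono) auto
      then have "1 + bcost b + t + t' \<le> (\<Phi> s + 1) * (T + bcost b + 1)"
        using 1(2) 2(2) by (simp add: algebra_simps)
      ultimately show ?thesis unfolding runs_def using 2(3) by blast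
    next
      case False
      then show ?thesis unfolding runs_def
        using exec.WhileFalse[of h b s c] post[OF less.prems False]
        by (intro exI[of _ s] exI[of _ "1 + bcost b"]) simp
    qed
  qed
  then show ?thesis using T by (rule runs_mono) auto
qed

primrec straight :: "com \<Rightarrow> bool" where
  "straight Skip \<longleftrightarrow> True"
| "straight (NAssign A i e) \<longleftrightarrow> True"
| "straight (CAssign A i e) \<longleftrightarrow> True"
| "straight (Seq c1 c2) \<longleftrightarrow> straight c1 \<and> straight c2"
| "straight (Cond b c1 c2) \<longleftrightarrow> straight c1 \<and> straight c2"
| "straight (While b c) \<longleftrightarrow> False"

primrec run_straight :: "edge_coloring_model \<Rightarrow> com \<Rightarrow> memory \<Rightarrow> memory" where
  "run_straight h Skip s = s"
| "run_straight h (NAssign A i e) s = write_nat A (nval i s) (nval e s) s"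
| "run_straight h (CAssign A i e) s = write_num A (nval i s) (cval h e s) s"
| "run_straight h (Seq c1 c2) s = run_straight h c2 (run_straight h c1 s)"
| "run_straight h (Cond b c1 c2) s = (if bval h b s then run_straight h c1 s else run_straight h c2 s)"
| "run_straight h (While b c) s = s"

text \<open>Both branches of a conditional are charged, so the bound does not depend on the memory.
  The value at \<open>While\<close> is arbitrary, as \<open>straight\<close> excludes loops.\<close>

primrec cost_straight :: "com \<Rightarrow> nat" where
  "cost_straight Skip = 1"
| "cost_straight (NAssign A i e) = 1 + ncost i + ncost e"
| "cost_straight (CAssign A i e) = 1 + ncost i + ccost e"
| "cost_straight (Seq c1 c2) = cost_straight c1 + cost_straight c2"
| "cost_straight (Cond b c1 c2) = 1 + bcost b + (cost_straight c1 + cost_straight c2)"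
| "cost_straight (While b c) = 0"

text \<open>Loop-free code is verified by symbolic execution: \<open>run_straight\<close> computes
  the final memory by simplification.\<close>

lemma runs_straight:
  assumes "straight c" "Q (run_straight h c s)" "cost_straight c \<le> T"
  shows "runs h c s T Q"
proof -
  have "runs h c s (cost_straight c) (\<lambda>s'. s' = run_straight h c s)"
    using assms(1)
  proof (induction c arbitrary: s)
    case (Seq c1 c2)
    have "runs h c1 s (cost_straight c1)
        (\<lambda>s'. runs h c2 s' (cost_straight c2) (\<lambda>s''. s'' = run_straight h (Seq c1 c2) s))"
      by (rule runs_mono[OF Seq.IH(1)]) (use Seq in auto)
    then show ?case by (rule runs_Seq) simp
  next
    case (Cond b c1 c2)
    show ?case
    proof (rule runs_Cond)
      show "runs h c1 s (cost_straight c1 + cost_straight c2) (\<lambda>s'. s' = run_straight h (Cond b c1 c2) s)"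
        if "bval h b s" using that Cond by (intro runs_mono[OF Cond.IH(1)]) auto
      show "runs h c2 s (cost_straight c1 + cost_straight c2) (\<lambda>s'. s' = run_straight h (Cond b c1 c2) s)"
        if "\<not> bval h b s" using that Cond by (intro runs_mono[OF Cond.IH(2)]) auto
    qed simp
  qed (auto intro!: runs_Skip runs_NAssign runs_CAssign)
  then show ?thesis by (rule runs_mono) (use assms in auto)
qed

lemma write_simps [simp]:
  "nats (write_nat A i x s) = (nats s)(A := (nats s A)(i := x))" "nums (write_nat A i x s) = nums s"
  "nums (write_num A i z s) = (nums s)(A := (nums s A)(i := z))" "nats (write_num A i z s) = nats s"
  by (simp_all add: write_nat_def write_num_def)

abbreviation "NVar A \<equiv> NGet A (NConst 0)"
abbreviation "NSet A \<equiv> NAssign A (NConst 0)"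

definition for_loop :: "nat \<Rightarrow> nexp \<Rightarrow> com \<Rightarrow> com" where
  "for_loop i N c = Seq (NSet i (NConst 0))
     (While (NLess (NVar i) N) (Seq c (NSet i (NAdd (NVar i) (NConst 1)))))"

text \<open>\<open>I j\<close> is the state at the test with counter \<open>j\<close>. The body must
  leave the counter alone, and the invariant is restored only after the increment; the invariant
  also has to fix the value of the limit \<open>N\<close>.\<close>

lemma runs_for:
  assumes init: "I 0 (write_nat i 0 0 s)"
    and inv: "\<And>j s. I j s \<Longrightarrow> nats s i 0 = j \<and> nval N s = m"
    and step: "\<And>j s. j < m \<Longrightarrow> I j s \<Longrightarrow>
      runs h c s T (\<lambda>s'. nats s' i 0 = j \<and> I (Suc j) (write_nat i 0 (Suc j) s'))"
    and post: "\<And>s. I m s \<Longrightarrow> Q s"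
    and T: "(m + 1) * (T + ncost N + 12) \<le> T'"
  shows "runs h (for_loop i N c) s T' Q"
  unfolding for_loop_def
proof (rule runs_Seq[OF runs_NAssign])
  let ?s = "write_nat i (nval (NConst 0) s) (nval (NConst 0) s) s"
  let ?b = "NLess (NVar i) N" and ?c = "Seq c (NSet i (NAdd (NVar i) (NConst 1)))"
  let ?I = "\<lambda>s. nats s i 0 \<le> m \<and> I (nats s i 0) s"
  show "runs h (While ?b ?c) ?s (m * (T + ncost N + 12) + ncost N + 9) Q"
  proof -
    have "runs h (While ?b ?c) s ((m - nats s i 0) * (T + ncost N + 12) + ncost N + 9) Q" if "?I s" for s
      using that
    proof (induction "m - nats s i 0" arbitrary: s)
      case 0
      then have "nats s i 0 = m" by simp
      then show ?case using 0 inv[of m s] post[of s] exec.WhileFalse[of h ?b s ?c]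
        unfolding runs_def by (intro exI[of _ s] exI[of _ "1 + bcost ?b"]) auto
    next
      case (Suc d)
      define j where "j = nats s i 0"
      have j: "j < m" "I j s" using Suc by (auto simp: j_def)
      obtain s1 t1 where 1: "exec h c s s1 t1" "t1 \<le> T" "nats s1 i 0 = j"
        "I (Suc j) (write_nat i 0 (Suc j) s1)"
        using step[OF j] unfolding runs_def by blast
      define s2 where "s2 = write_nat i 0 (Suc j) s1"
      have e2: "exec h ?c s s2 (t1 + 6)"
        using exec.Seq[OF 1(1) exec.NAssign[of h i "NConst 0" "NAdd (NVar i) (NConst 1)" s1]] 1(3)
        by (simp add: s2_def numeral_eq_Suc)
      have "runs h (While ?b ?c) s2 ((m - nats s2 i 0) * (T + ncost N + 12) + ncost N + 9) Q"
        using Suc(2) 1(4) j by (intro Suc(1)) (auto simp: s2_def j_def)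
      then obtain s3 t3 where 3: "exec h (While ?b ?c) s2 s3 t3"
        "t3 \<le> (m - nats s2 i 0) * (T + ncost N + 12) + ncost N + 9" "Q s3"
        unfolding runs_def by blast
      have "bval h ?b s" using j inv[OF j(2)] by simp
      then have "exec h (While ?b ?c) s s3 (1 + bcost ?b + (t1 + 6) + t3)"
        using e2 3(1) by (rule exec.WhileTrue)
      moreover have "m - nats s i 0 = Suc (m - nats s2 i 0)" using j by (simp add: s2_def j_def)
      then have "1 + bcost ?b + (t1 + 6) + t3 \<le> (m - nats s i 0) * (T + ncost N + 12) + ncost N + 9"
        using 1(2) 3(2) by simp
      ultimately show ?case unfolding runs_def using 3(3) by blast
    qed
    from this[of ?s] show ?thesis using init by simp
  qed
  show "1 + ncost (NConst 0) + ncost (NConst 0) \<le> 3" by simp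
  show "3 + (m * (T + ncost N + 12) + ncost N + 9) \<le> T'" using T by simp
qed

text \<open>The list is program text, not data: with \<Delta> and \<open>k\<close> fixed, the
  colourings are written out in the program.\<close>

primrec store_list :: "nat \<Rightarrow> nat \<Rightarrow> nat list \<Rightarrow> com" where
  "store_list A i [] = Skip"
| "store_list A i (x # xs) = Seq (NAssign A (NConst i) (NConst x)) (store_list A (Suc i) xs)"

lemma runs_store_list:
  "runs h (store_list A i xs) s (3 * length xs + 1) (\<lambda>s'. nums s' = nums s \<and>
     nats s' = (nats s)(A := (\<lambda>j. if i \<le> j \<and> j < i + length xs then xs ! (j - i) else nats s A j)))"
proof (induction xs arbitrary: i s)
  case Nil
  show ?case by (auto intro!: runs_Skip simp: fun_eq_iff)
next
  case (Cons x xs)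
  show ?case unfolding store_list.simps
  proof (rule runs_Seq[OF runs_NAssign], rule runs_mono[OF Cons.IH order_refl])
    fix s'
    assume *: "nums s' = nums (write_nat A (nval (NConst i) s) (nval (NConst x) s) s) \<and>
       nats s' = (nats (write_nat A (nval (NConst i) s) (nval (NConst x) s) s))(A := (\<lambda>j.
         if Suc i \<le> j \<and> j < Suc i + length xs then xs ! (j - Suc i)
         else nats (write_nat A (nval (NConst i) s) (nval (NConst x) s) s) A j))"
    show "nums s' = nums s \<and> nats s' = (nats s)(A := (\<lambda>j.
         if i \<le> j \<and> j < i + length (x # xs) then (x # xs) ! (j - i) else nats s A j))"
      using * by (auto simp: fun_eq_iff nth_Cons split: nat.split intro!: arg_cong[of _ _ "(!) xs"])
  qed auto
qed

primrec seq_list :: "com list \<Rightarrow> com" where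
  "seq_list [] = Skip"
| "seq_list (c # cs) = Seq c (seq_list cs)"

text \<open>Numerals are assembled from 1, the only real constant of the machine.\<close>

primrec cnum :: "nat \<Rightarrow> cexp" where
  "cnum 0 = CSub COne COne"
| "cnum (Suc j) = CAdd (cnum j) COne"

lemma cval_cnum [simp]: "cval h (cnum j) s = of_nat j"
  by (induction j) auto

lemma ccost_cnum [simp]: "ccost (cnum j) = 2 * j + 3"
  by (induction j) auto

section \<open>Building the computation tree\<close>

text \<open>The arrays of natural numbers. \<open>ALV\<close> and \<open>PIN\<close> hold the working copies of the remaining
  vertices and of the pinning; \<open>BAL\<close> and \<open>BPI\<close> hold one block of length \<open>LEN\<close> (vertices plus edges)
  per node, \<open>BP\<close> and \<open>XB\<close> being the offsets of the next free block and of the block of the current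
  node \<open>XI\<close>. \<open>NDV\<close>, \<open>NDL\<close>, \<open>NDW\<close> hold the vertex, the remaining depth and the cell of a node.
  Among the arrays of complex numbers, array 1 holds the cells and array 2 the deviations: cell 0
  collects the product of the roots (and so becomes the result), and cell \<open>1 + x K + i\<close> the product of
  the children of node \<open>x\<close> for the \<open>i\<close>-th of the \<open>K\<close> colourings.\<close>

abbreviation (input) "LEN \<equiv> 3 :: nat"
abbreviation (input) "DEP \<equiv> 4 :: nat"
abbreviation (input) "CI \<equiv> 5 :: nat"
abbreviation (input) "EJ \<equiv> 6 :: nat"
abbreviation (input) "XI \<equiv> 7 :: nat"
abbreviation (input) "QN \<equiv> 8 :: nat"
abbreviation (input) "BP \<equiv> 9 :: nat"
abbreviation (input) "XB \<equiv> 10 :: nat"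
abbreviation (input) "CP \<equiv> 11 :: nat"
abbreviation (input) "VX \<equiv> 12 :: nat"
abbreviation (input) "LV \<equiv> 13 :: nat"
abbreviation (input) "AI \<equiv> 14 :: nat"
abbreviation (input) "AC \<equiv> 15 :: nat"
abbreviation (input) "ALV \<equiv> 16 :: nat"
abbreviation (input) "PIN \<equiv> 17 :: nat"
abbreviation (input) "BAL \<equiv> 18 :: nat"
abbreviation (input) "BPI \<equiv> 19 :: nat"
abbreviation (input) "NDV \<equiv> 20 :: nat"
abbreviation (input) "NDL \<equiv> 21 :: nat"
abbreviation (input) "NDW \<equiv> 22 :: nat"
abbreviation (input) "CNT \<equiv> 23 :: nat"

definition copy_out :: com where
  "copy_out = for_loop CI (NVar LEN) (Seq
     (NAssign BAL (NAdd (NVar BP) (NVar CI)) (NGet ALV (NVar CI)))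
     (NAssign BPI (NAdd (NVar BP) (NVar CI)) (NGet PIN (NVar CI))))"

definition copy_in :: com where
  "copy_in = for_loop CI (NVar LEN) (Seq
     (NAssign ALV (NVar CI) (NGet BAL (NAdd (NVar XB) (NVar CI))))
     (NAssign PIN (NVar CI) (NGet BPI (NAdd (NVar XB) (NVar CI)))))"

text \<open>One step of \<open>kids\<close>: the removal in \<open>ALV\<close> persists, so the next
  candidate finds the smaller set.\<close>

definition spawn :: "nexp \<Rightarrow> com" where
  "spawn u = Cond (NLess (NConst 0) (NGet ALV u))
     (Seq (Seq (NAssign ALV u (NConst 0)) (Seq (NAssign NDV (NVar QN) u)
       (Seq (NAssign NDL (NVar QN) (NVar LV)) (NAssign NDW (NVar QN) (NVar CP)))))
     (Seq copy_out
       (Seq (NSet BP (NAdd (NVar BP) (NVar LEN))) (NSet QN (NAdd (NVar QN) (NConst 1))))))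
     Skip"

definition neq :: "nexp \<Rightarrow> nexp \<Rightarrow> bexp" where
  "neq x y = Neg (Conj (Neg (NLess x y)) (Neg (NLess y x)))"

definition at_vertex :: bexp where
  "at_vertex = Neg (Conj (neq (NGet 1 (NVar EJ)) (NVar VX)) (neq (NGet 2 (NVar EJ)) (NVar VX)))"

definition spawn_nbrs :: com where
  "spawn_nbrs = for_loop EJ (NGet 0 (NConst 1))
     (Cond at_vertex (Seq (spawn (NGet 1 (NVar EJ))) (spawn (NGet 2 (NVar EJ)))) Skip)"

definition pin_loop :: com where
  "pin_loop = Seq (NSet AI (NConst 0)) (for_loop EJ (NGet 0 (NConst 1))
     (Cond (Conj at_vertex (NLess (NGet PIN (NVar EJ)) (NConst 1)))
       (Seq (NAssign PIN (NVar EJ) (NGet AC (NVar AI))) (NSet AI (NAdd (NVar AI) (NConst 1)))) Skip))"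

text \<open>The two ends are tested separately, so a loop counts twice. A free edge is counted in
  cell 0, which the oracle query never reads.\<close>

definition count_step :: "nat \<Rightarrow> com" where
  "count_step E = Cond (neq (NGet E (NVar EJ)) (NVar VX)) Skip
     (NAssign CNT (NGet PIN (NVar EJ)) (NAdd (NGet CNT (NGet PIN (NVar EJ))) (NConst 1)))"

definition count_loop :: com where
  "count_loop = for_loop EJ (NGet 0 (NConst 1)) (Seq (count_step 1) (count_step 2))"

lemma runs_copy_out:
  assumes L: "nats s LEN 0 = L"
  shows "runs h copy_out s ((L + 1) * 40) (\<lambda>s'. nums s' = nums s \<and> nats s' = (nats s)
    (CI := (nats s CI)(0 := L),
     BAL := (\<lambda>x. if nats s BP 0 \<le> x \<and> x < nats s BP 0 + L then nats s ALV (x - nats s BP 0) else nats s BAL x),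
     BPI := (\<lambda>x. if nats s BP 0 \<le> x \<and> x < nats s BP 0 + L then nats s PIN (x - nats s BP 0) else nats s BPI x)))"
proof -
  define I where "I j s' \<longleftrightarrow> nums s' = nums s \<and> nats s' = (nats s)
    (CI := (nats s CI)(0 := j),
     BAL := (\<lambda>x. if nats s BP 0 \<le> x \<and> x < nats s BP 0 + j then nats s ALV (x - nats s BP 0) else nats s BAL x),
     BPI := (\<lambda>x. if nats s BP 0 \<le> x \<and> x < nats s BP 0 + j then nats s PIN (x - nats s BP 0) else nats s BPI x))" for j and s' :: memory
  show ?thesis unfolding copy_out_def
  proof (rule runs_for[where m = L and T = 18 and I = I])
    fix j s' assume "j < L" "I j s'"
    then have s': "nums s' = nums s" "nats s' = (nats s)
      (CI := (nats s CI)(0 := j),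
       BAL := (\<lambda>x. if nats s BP 0 \<le> x \<and> x < nats s BP 0 + j then nats s ALV (x - nats s BP 0) else nats s BAL x),
     BPI := (\<lambda>x. if nats s BP 0 \<le> x \<and> x < nats s BP 0 + j then nats s PIN (x - nats s BP 0) else nats s BPI x))"
      by (simp_all add: I_def)
    show "runs h (Seq (NAssign BAL (NAdd (NVar BP) (NVar CI)) (NGet ALV (NVar CI)))
        (NAssign BPI (NAdd (NVar BP) (NVar CI)) (NGet PIN (NVar CI)))) s' 18
      (\<lambda>s'. nats s' CI 0 = j \<and> I (Suc j) (write_nat CI 0 (Suc j) s'))"
      by (rule runs_straight) (simp_all add: I_def s', auto simp: fun_eq_iff less_Suc_eq)
  qed (auto simp: I_def L fun_eq_iff)
qed

lemma runs_copy_in: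
  assumes L: "nats s LEN 0 = L"
  shows "runs h copy_in s ((L + 1) * 40) (\<lambda>s'. nums s' = nums s \<and> nats s' = (nats s)
    (CI := (nats s CI)(0 := L),
     ALV := (\<lambda>i. if i < L then nats s BAL (nats s XB 0 + i) else nats s ALV i),
     PIN := (\<lambda>i. if i < L then nats s BPI (nats s XB 0 + i) else nats s PIN i)))"
proof -
  define I where "I j s' \<longleftrightarrow> nums s' = nums s \<and> nats s' = (nats s)
    (CI := (nats s CI)(0 := j),
     ALV := (\<lambda>i. if i < j then nats s BAL (nats s XB 0 + i) else nats s ALV i),
     PIN := (\<lambda>i. if i < j then nats s BPI (nats s XB 0 + i) else nats s PIN i))" for j and s' :: memory
  show ?thesis unfolding copy_in_def
  proof (rule runs_for[where m = L and T = 18 and I = I])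
    fix j s' assume "j < L" "I j s'"
    then have s': "nums s' = nums s" "nats s' = (nats s)
      (CI := (nats s CI)(0 := j),
       ALV := (\<lambda>i. if i < j then nats s BAL (nats s XB 0 + i) else nats s ALV i),
     PIN := (\<lambda>i. if i < j then nats s BPI (nats s XB 0 + i) else nats s PIN i))"
      by (simp_all add: I_def)
    show "runs h (Seq (NAssign ALV (NVar CI) (NGet BAL (NAdd (NVar XB) (NVar CI))))
        (NAssign PIN (NVar CI) (NGet BPI (NAdd (NVar XB) (NVar CI))))) s' 18
      (\<lambda>s'. nats s' CI 0 = j \<and> I (Suc j) (write_nat CI 0 (Suc j) s'))"
      by (rule runs_straight) (simp_all add: I_def s', auto simp: fun_eq_iff less_Suc_eq)
  qed (auto simp: I_def L fun_eq_iff)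
qed

section \<open>Nodes, the queue and frame conditions\<close>

text \<open>A node consists of its remaining depth, the remaining vertices, the pinning, the vertex and the
  cell.\<close>

type_synonym node = "nat \<times> (nat \<Rightarrow> nat) \<times> (nat \<Rightarrow> nat) \<times> nat \<times> nat"

text \<open>Beyond \<open>L\<close> the value is 0, so that a stored block equals the working copy
  as a function; by \<open>work_ok\<close> that copy vanishes there too.\<close>

definition block :: "nat \<Rightarrow> nat \<Rightarrow> memory \<Rightarrow> nat \<Rightarrow> nat \<Rightarrow> nat" where
  "block L A s z = (\<lambda>i. if i < L then nats s A (z * L + i) else 0)"

definition node_at :: "nat \<Rightarrow> memory \<Rightarrow> nat \<Rightarrow> node" where
  "node_at L s z = (nats s NDL z, block L BAL s z, block L BPI s z, nats s NDV z, nats s NDW z)"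

definition queue :: "nat \<Rightarrow> memory \<Rightarrow> node list" where
  "queue L s = map (node_at L s) [0..<nats s QN 0]"

text \<open>The queue as it will be once the candidates \<open>us\<close> have been spawned: a loop invariant of every
  spawning loop.\<close>

definition pending :: "nat \<Rightarrow> memory \<Rightarrow> nat list \<Rightarrow> node list" where
  "pending L s us = queue L s @
     map (\<lambda>(u, al). (nats s LV 0, al, nats s PIN, u, nats s CP 0)) (kids (nats s ALV) us)"

lemma length_queue [simp]: "length (queue L s) = nats s QN 0"
  by (simp add: queue_def)

definition input_ok :: "nat \<Rightarrow> (nat \<times> nat) list \<Rightarrow> memory \<Rightarrow> bool" where
  "input_ok n es s \<longleftrightarrow> nats s 0 0 = n \<and> nats s 0 1 = length es \<and>
     (\<forall>j<length es. nats s 1 j = fst (es ! j) \<and> nats s 2 j = snd (es ! j)) \<and>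
     nats s LEN 0 = n + length es"

text \<open>The offset \<open>BP\<close> is carried along because the machine cannot multiply
  \<open>QN\<close> by \<open>L\<close>.\<close>

definition work_ok :: "nat \<Rightarrow> memory \<Rightarrow> bool" where
  "work_ok L s \<longleftrightarrow> nats s BP 0 = nats s QN 0 * L \<and> (\<forall>i\<ge>L. nats s ALV i = 0 \<and> nats s PIN i = 0)"

definition same_except :: "nat set \<Rightarrow> memory \<Rightarrow> memory \<Rightarrow> bool" where
  "same_except S s s' \<longleftrightarrow> (\<forall>A. A \<notin> S \<longrightarrow> nats s' A = nats s A)"

lemma same_exceptD: "same_except S s s' \<Longrightarrow> A \<notin> S \<Longrightarrow> nats s' A = nats s A"
  by (simp add: same_except_def)

lemma same_except_trans:
  "same_except S s s' \<Longrightarrow> same_except S' s' s'' \<Longrightarrow> S \<union> S' \<subseteq> S'' \<Longrightarrow> same_except S'' s s''"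
  unfolding same_except_def by (metis UnI1 UnI2 subsetD)

lemma same_except_refl: "same_except S s s" by (simp add: same_except_def)

lemma input_ok_same:
  "same_except S s s' \<Longrightarrow> S \<inter> {0, 1, 2, LEN} = {} \<Longrightarrow> input_ok n es s \<Longrightarrow> input_ok n es s'"
  unfolding input_ok_def same_except_def by (metis IntI empty_iff insertI1 insertI2)

abbreviation (input) "spawn_vars \<equiv> {CI, ALV, BAL, BPI, NDV, NDL, NDW, BP, QN}"

text \<open>One equation for \<open>pending\<close> covers a present and an absent candidate, as it
  is the recursion of \<open>kids\<close>. The expression \<open>u\<close> is evaluated again after
  the write to \<open>ALV\<close>, hence the requirement that its value is stable.\<close>

lemma runs_spawn:
  assumes L: "nats s LEN 0 = L" and ok: "work_ok L s"
    and u: "\<And>s'. same_except spawn_vars s s' \<Longrightarrow> nval u s' = nval u s" "ncost u \<le> 4"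
  shows "runs h (spawn u) s ((L + 1) * 40 + 50) (\<lambda>s'. nums s' = nums s \<and> same_except spawn_vars s s' \<and>
    work_ok L s' \<and> (\<forall>us. pending L s' us = pending L s (nval u s # us)))"
  unfolding spawn_def
proof (rule runs_Cond[where T' = "(L + 1) * 40 + 42"])
  assume "\<not> bval h (NLess (NConst 0) (NGet ALV u)) s"
  then show "runs h Skip s ((L + 1) * 40 + 42) (\<lambda>s'. nums s' = nums s \<and> same_except spawn_vars s s' \<and>
      work_ok L s' \<and> (\<forall>us. pending L s' us = pending L s (nval u s # us)))"
    using ok by (intro runs_Skip) (auto simp: same_except_refl pending_def)
next
  define x where "x = nval u s"
  define q where "q = nats s QN 0"
  assume "bval h (NLess (NConst 0) (NGet ALV u)) s"
  then have alive: "nats s ALV x > 0" by (simp add: x_def)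
  then have xL: "x < L" using ok by (metis less_numeral_extra(3) linorder_not_less work_ok_def)
  have BP: "nats s BP 0 = q * L" using ok by (simp add: work_ok_def q_def)
  define s1 where "s1 = write_nat NDW q (nats s CP 0) (write_nat NDL q (nats s LV 0)
     (write_nat NDV q x (write_nat ALV x 0 s)))"
  show "runs h (Seq (Seq (NAssign ALV u (NConst 0)) (Seq (NAssign NDV (NVar QN) u)
       (Seq (NAssign NDL (NVar QN) (NVar LV)) (NAssign NDW (NVar QN) (NVar CP)))))
     (Seq copy_out
       (Seq (NSet BP (NAdd (NVar BP) (NVar LEN))) (NSet QN (NAdd (NVar QN) (NConst 1)))))) s
     ((L + 1) * 40 + 42) (\<lambda>s'. nums s' = nums s \<and> same_except spawn_vars s s' \<and>
      work_ok L s' \<and> (\<forall>us. pending L s' us = pending L s (nval u s # us)))" (is "runs h _ s _ ?Q")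
  proof -
    have A: "runs h (Seq copy_out (Seq (NSet BP (NAdd (NVar BP) (NVar LEN))) (NSet QN (NAdd (NVar QN) (NConst 1))))) s1
        ((L + 1) * 40 + 14) ?Q"
    proof (rule runs_Seq[OF runs_mono[OF runs_copy_out order_refl]])
      fix s2 :: memory
      assume "nums s2 = nums s1 \<and> nats s2 = (nats s1)
        (CI := (nats s1 CI)(0 := L),
         BAL := (\<lambda>x. if nats s1 BP 0 \<le> x \<and> x < nats s1 BP 0 + L then nats s1 ALV (x - nats s1 BP 0) else nats s1 BAL x),
         BPI := (\<lambda>x. if nats s1 BP 0 \<le> x \<and> x < nats s1 BP 0 + L then nats s1 PIN (x - nats s1 BP 0) else nats s1 BPI x))"
      then have n2: "nums s2 = nums s" and s2: "nats s2 = (nats s)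
        (ALV := (nats s ALV)(x := 0), NDV := (nats s NDV)(q := x), NDL := (nats s NDL)(q := nats s LV 0),
         NDW := (nats s NDW)(q := nats s CP 0), CI := (nats s CI)(0 := L),
         BAL := (\<lambda>y. if q * L \<le> y \<and> y < q * L + L then ((nats s ALV)(x := 0)) (y - q * L) else nats s BAL y),
         BPI := (\<lambda>y. if q * L \<le> y \<and> y < q * L + L then nats s PIN (y - q * L) else nats s BPI y))"
        by (auto simp: s1_def BP fun_eq_iff)
      define s3 where "s3 = write_nat QN 0 (q + 1) (write_nat BP 0 (q * L + L) s2)"
      \<comment> \<open>The new block starts behind all older blocks, so older nodes stay
        intact.\<close>
      have lt: "\<not> q * L \<le> z * L + i" if "z < q" "i < L" for z i
      proof -
        have "z * L + i < (z + 1) * L" using that by simp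
        also have "\<dots> \<le> q * L" using that by (intro mult_right_mono) auto
        finally show ?thesis by simp
      qed
      have old: "node_at L s3 z = node_at L s z" if "z < q" for z
        using that lt[OF that] by (auto simp: node_at_def block_def s3_def s2 fun_eq_iff)
      have new: "node_at L s3 q = (nats s LV 0, (nats s ALV)(x := 0), nats s PIN, x, nats s CP 0)"
        using ok xL by (auto simp: node_at_def block_def s3_def s2 fun_eq_iff work_ok_def)
      have "queue L s3 = queue L s @ [(nats s LV 0, (nats s ALV)(x := 0), nats s PIN, x, nats s CP 0)]"
        using old new by (simp add: queue_def s3_def q_def[symmetric])
      then have "pending L s3 us = pending L s (x # us)" for us
        using alive by (simp add: pending_def s3_def s2 del: fun_upd_apply) (simp add: fun_upd_apply)
      moreover have "same_except spawn_vars s s3" by (auto simp: same_except_def s3_def s2)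
      moreover have "work_ok L s3" using ok by (auto simp: work_ok_def s3_def s2 q_def)
      ultimately have "?Q s3" using n2 by (simp add: s3_def x_def)
      then show "runs h (Seq (NSet BP (NAdd (NVar BP) (NVar LEN))) (NSet QN (NAdd (NVar QN) (NConst 1)))) s2 14 ?Q"
        by (intro runs_straight) (simp_all add: s3_def s2 BP q_def L)
    qed (simp_all add: s1_def L)
    show ?thesis
    proof (rule runs_Seq[OF runs_straight[where T = 28]])
      show "runs h (Seq copy_out (Seq (NSet BP (NAdd (NVar BP) (NVar LEN))) (NSet QN (NAdd (NVar QN) (NConst 1)))))
        (run_straight h (Seq (NAssign ALV u (NConst 0)) (Seq (NAssign NDV (NVar QN) u)
          (Seq (NAssign NDL (NVar QN) (NVar LV)) (NAssign NDW (NVar QN) (NVar CP))))) s)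
        ((L + 1) * 40 + 14) ?Q"
        using A u(1)[of "write_nat ALV x 0 s"]
        by (simp add: s1_def x_def[symmetric] q_def[symmetric] same_except_def)
    qed (use u in simp_all)
  qed
qed (use u in simp)

lemma queue_same:
  assumes "same_except S s s'" "S \<inter> {BAL, BPI, NDV, NDL, NDW, QN} = {}"
  shows "queue L s' = queue L s"
proof -
  have "nats s' BAL = nats s BAL" "nats s' BPI = nats s BPI" "nats s' NDV = nats s NDV"
    "nats s' NDL = nats s NDL" "nats s' NDW = nats s NDW" "nats s' QN = nats s QN"
    using assms by (auto simp: same_except_def)
  then show ?thesis by (simp add: queue_def node_at_def block_def cong: if_cong)
qed

lemma pending_same:
  assumes "same_except S s s'" "S \<inter> {ALV, PIN, BAL, BPI, NDV, NDL, NDW, QN, LV, CP} = {}"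
  shows "pending L s' us = pending L s us"
proof -
  have "nats s' ALV = nats s ALV" "nats s' PIN = nats s PIN" "nats s' LV = nats s LV" "nats s' CP = nats s CP"
    using assms by (auto simp: same_except_def)
  then show ?thesis using queue_same[OF assms(1)] assms(2) by (simp add: pending_def)
qed

lemma work_ok_same:
  assumes "same_except S s s'" "S \<inter> {ALV, PIN, BP, QN} = {}" "work_ok L s"
  shows "work_ok L s'"
proof -
  have "nats s' ALV = nats s ALV" "nats s' PIN = nats s PIN" "nats s' BP = nats s BP" "nats s' QN = nats s QN"
    using assms(1,2) by (auto simp: same_except_def)
  then show ?thesis using assms(3) by (simp add: work_ok_def)
qed

lemma bval_neq [simp]: "bval h (neq x y) s \<longleftrightarrow> nval x s \<noteq> nval y s"
  by (auto simp: neq_def)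

lemma bcost_neq [simp]: "bcost (neq x y) = 6 + 2 * ncost x + 2 * ncost y"
  by (simp add: neq_def)

lemma bval_at_vertex:
  "input_ok n es s \<Longrightarrow> nats s EJ 0 < length es \<Longrightarrow> bval h at_vertex s \<longleftrightarrow> incident es (nats s EJ 0) (nats s VX 0)"
  by (auto simp: at_vertex_def input_ok_def incident_def)

lemma bcost_at_vertex [simp]: "bcost at_vertex = 34"
  by (simp add: at_vertex_def)

lemma same_except_write: "A \<in> S \<Longrightarrow> same_except S s (write_nat A i x s)"
  by (auto simp: same_except_def)

text \<open>The invariant says that \<open>pending\<close> with the candidates of the remaining
  edges never changes; with none left it is the queue. The square comes from copying up to two
  blocks per edge.\<close>

lemma runs_spawn_nbrs:
  assumes inp: "input_ok n es s" and ok: "work_ok L s" and L: "L = n + length es"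
  shows "runs h spawn_nbrs s (300 * ((L + 1) * (L + 1))) (\<lambda>s'. nums s' = nums s \<and>
    same_except (insert EJ spawn_vars) s s' \<and> work_ok L s' \<and>
    queue L s' = pending L s (nbrs es (nats s VX 0)))"
proof -
  define m where "m = length es"
  define v where "v = nats s VX 0"
  define cand where "cand j = (if incident es j v then [fst (es ! j), snd (es ! j)] else [])" for j
  define I where "I j s' \<longleftrightarrow> nums s' = nums s \<and> same_except (insert EJ spawn_vars) s s' \<and> work_ok L s' \<and>
     nats s' EJ 0 = j \<and> pending L s' (concat (map cand [j..<m])) = pending L s (nbrs es v)" for j s'
  define T where "T = (L + 1) * 40 + 50"
  show ?thesis unfolding spawn_nbrs_def
  proof (rule runs_for[where m = m and T = "2 * T + 36" and I = I])
    show "I 0 (write_nat EJ 0 0 s)"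
      using work_ok_same[OF same_except_write[of EJ "{EJ}"] _ ok] pending_same[OF same_except_write[of EJ "{EJ}"]]
      by (simp add: I_def same_except_write nbrs_def cand_def[abs_def] m_def)
  next
    fix j s' assume "I j s'"
    then have "input_ok n es s'" unfolding I_def by (intro input_ok_same[OF _ _ inp]) auto
    then show "nats s' EJ 0 = j \<and> nval (NGet 0 (NConst 1)) s' = m"
      using \<open>I j s'\<close> by (simp add: I_def input_ok_def m_def)
  next
    fix s' assume "I m s'"
    then show "nums s' = nums s \<and> same_except (insert EJ spawn_vars) s s' \<and> work_ok L s' \<and>
        queue L s' = pending L s (nbrs es (nats s VX 0))"
      by (simp add: I_def pending_def v_def)
  next
    fix j s' assume j: "j < m" and I: "I j s'"
    have inp': "input_ok n es s'" using I unfolding I_def by (intro input_ok_same[OF _ _ inp]) auto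
    have vx: "nats s' VX 0 = v" using I by (simp_all add: I_def v_def same_except_def)
    have up: "[j..<m] = j # [Suc j..<m]" using j by (simp add: upt_conv_Cons)
    have fin: "nats s2 EJ 0 = j \<and> I (Suc j) (write_nat EJ 0 (Suc j) s2)"
      if "nums s2 = nums s'" "same_except spawn_vars s' s2" "work_ok L s2"
        "pending L s2 (concat (map cand [Suc j..<m])) = pending L s (nbrs es v)" for s2
    proof -
      have "same_except (insert EJ spawn_vars) s s2"
        using I that(2) unfolding I_def by (auto intro: same_except_trans)
      then have "same_except (insert EJ spawn_vars) s (write_nat EJ 0 (Suc j) s2)"
        by (rule same_except_trans[OF _ same_except_write[of EJ "{EJ}"]]) auto
      moreover have "nats s2 EJ 0 = j" using same_exceptD[OF that(2), of EJ] I by (simp add: I_def)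
      ultimately show ?thesis
        using that I work_ok_same[OF same_except_write[of EJ "{EJ}"] _ that(3)]
          pending_same[OF same_except_write[of EJ "{EJ}" s2]]
        by (simp add: I_def)
    qed
    show "runs h (Cond at_vertex (Seq (spawn (NGet 1 (NVar EJ))) (spawn (NGet 2 (NVar EJ)))) Skip) s' (2 * T + 36)
       (\<lambda>s'. nats s' EJ 0 = j \<and> I (Suc j) (write_nat EJ 0 (Suc j) s'))"
    proof (rule runs_Cond[where T' = "2 * T + 1"])
      assume "\<not> bval h at_vertex s'"
      then have "cand j = []"
        using bval_at_vertex[OF inp'] I j vx by (simp add: I_def m_def cand_def)
      then show "runs h Skip s' (2 * T + 1) (\<lambda>s'. nats s' EJ 0 = j \<and> I (Suc j) (write_nat EJ 0 (Suc j) s'))"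
        using I up by (intro runs_Skip fin) (auto simp: I_def same_except_refl)
    next
      assume "bval h at_vertex s'"
      then have c: "cand j = [nats s' 1 j, nats s' 2 j]"
        using bval_at_vertex[OF inp'] I j vx inp' by (simp add: I_def m_def cand_def input_ok_def)
      have EJ: "nats s' EJ 0 = j" using I by (simp add: I_def)
      have LEN: "nats s'' LEN 0 = L" if "same_except spawn_vars s' s''" for s''
        using that inp' L by (simp add: input_ok_def same_except_def)
      show "runs h (Seq (spawn (NGet 1 (NVar EJ))) (spawn (NGet 2 (NVar EJ)))) s' (2 * T + 1)
          (\<lambda>s'. nats s' EJ 0 = j \<and> I (Suc j) (write_nat EJ 0 (Suc j) s'))"
      proof (rule runs_Seq)
        show "runs h (spawn (NGet 1 (NVar EJ))) s' T (\<lambda>s1. runs h (spawn (NGet 2 (NVar EJ))) s1 T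
            (\<lambda>s'. nats s' EJ 0 = j \<and> I (Suc j) (write_nat EJ 0 (Suc j) s')))"
          unfolding T_def
        proof (rule runs_mono[OF runs_spawn order_refl], goal_cases)
          case (5 s1)
          note s1 = 5
          have e1: "nats s1 EJ = nats s' EJ" "nats s1 2 = nats s' 2"
            using same_exceptD[of spawn_vars s' s1] s1 by auto
          show ?case
          proof (rule runs_mono[OF runs_spawn order_refl], goal_cases)
            case (5 s2)
            show ?case
            proof (rule fin)
              show "same_except spawn_vars s' s2" using 5 s1 by (auto intro: same_except_trans)
              have "pending L s2 (concat (map cand [Suc j..<m])) =
                  pending L s' (concat (map cand [j..<m]))"
                using 5 s1 up c e1 EJ by simp
              then show "pending L s2 (concat (map cand [Suc j..<m])) = pending L s (nbrs es v)"
                using I by (simp add: I_def)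
            qed (use 5 s1 in auto)
          next
            case (3 s2)
            then show ?case using same_exceptD[OF 3, of EJ] same_exceptD[OF 3, of 2] by simp
          qed (use s1 LEN in auto)
        next
          case (3 s1)
          then show ?case using same_exceptD[OF 3, of EJ] same_exceptD[OF 3, of 1] by simp
        qed (use I LEN[OF same_except_refl] in \<open>auto simp: I_def\<close>)
      qed simp
    qed simp
  next
    have "(m + 1) * (2 * T + 36 + ncost (NGet 0 (NConst 1)) + 12) \<le> (L + 1) * (300 * (L + 1))"
      by (rule mult_mono) (auto simp: m_def L T_def)
    then show "(m + 1) * (2 * T + 36 + ncost (NGet 0 (NConst 1)) + 12) \<le> 300 * ((L + 1) * (L + 1))"
      by (simp only: mult_ac)
  qed
qed

lemma runs_pin_loop:
  assumes inp: "input_ok n es s"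
  shows "runs h pin_loop s (100 * (length es + 1)) (\<lambda>s'. nums s' = nums s \<and>
    same_except {AI, EJ, PIN} s s' \<and>
    nats s' PIN = pin_edges es (nats s VX 0) [0..<length es] (nats s AC) (nats s PIN))"
proof -
  define m where "m = length es"
  define v where "v = nats s VX 0"
  \<comment> \<open>Continuing from here with the rest of the edges and of the colour stream gives
    the same final pinning; \<open>AI\<close> counts the colours consumed.\<close>
  define I where "I j s' \<longleftrightarrow> nums s' = nums s \<and> same_except {AI, EJ, PIN} s s' \<and> nats s' EJ 0 = j \<and>
     pin_edges es v [j..<m] (\<lambda>i. nats s AC (nats s' AI 0 + i)) (nats s' PIN) =
     pin_edges es v [0..<m] (nats s AC) (nats s PIN)" for j s'
  have "runs h (for_loop EJ (NGet 0 (NConst 1))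
     (Cond (Conj at_vertex (NLess (NGet PIN (NVar EJ)) (NConst 1)))
       (Seq (NAssign PIN (NVar EJ) (NGet AC (NVar AI))) (NSet AI (NAdd (NVar AI) (NConst 1)))) Skip))
     (write_nat AI 0 0 s) (90 * (m + 1)) (\<lambda>s'. nums s' = nums s \<and> same_except {AI, EJ, PIN} s s' \<and>
      nats s' PIN = pin_edges es v [0..<m] (nats s AC) (nats s PIN))"
  proof (rule runs_for[where m = m and T = 61 and I = I])
    show "I 0 (write_nat EJ 0 0 (write_nat AI 0 0 s))"
      by (simp add: I_def same_except_def)
  next
    fix j s' assume "I j s'"
    then have "input_ok n es s'" unfolding I_def by (intro input_ok_same[OF _ _ inp]) auto
    then show "nats s' EJ 0 = j \<and> nval (NGet 0 (NConst 1)) s' = m"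
      using \<open>I j s'\<close> by (simp add: I_def input_ok_def m_def)
  next
    fix j s' assume j: "j < m" and I: "I j s'"
    have inp': "input_ok n es s'" using I unfolding I_def by (intro input_ok_same[OF _ _ inp]) auto
    have vx: "nats s' VX 0 = v" "nats s' AC = nats s AC"
      using I by (simp_all add: I_def v_def same_except_def)
    have up: "[j..<m] = j # [Suc j..<m]" using j by (simp add: upt_conv_Cons)
    have b: "bval h at_vertex s' \<longleftrightarrow> incident es j v"
      using bval_at_vertex[OF inp'] I j vx by (simp add: I_def m_def)
    show "runs h (Cond (Conj at_vertex (NLess (NGet PIN (NVar EJ)) (NConst 1)))
       (Seq (NAssign PIN (NVar EJ) (NGet AC (NVar AI))) (NSet AI (NAdd (NVar AI) (NConst 1)))) Skip) s' 61
       (\<lambda>s'. nats s' EJ 0 = j \<and> I (Suc j) (write_nat EJ 0 (Suc j) s'))"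
      using I b vx by (intro runs_straight) (auto simp: I_def up same_except_def)
  qed (auto simp: I_def)
  then show ?thesis unfolding pin_loop_def
    by (intro runs_Seq[OF runs_NAssign[where T = 10]]) (auto simp: m_def v_def)
qed

lemma runs_count_loop:
  assumes inp: "input_ok n es s"
  shows "runs h count_loop s (100 * (length es + 1)) (\<lambda>s'. nums s' = nums s \<and>
    same_except {EJ, CNT} s s' \<and>
    (\<forall>c. nats s' CNT c = nats s CNT c + color_count es (nats s PIN) (nats s VX 0) c))"
proof -
  define m where "m = length es"
  define v where "v = nats s VX 0"
  define P where "P = nats s PIN"
  define I where "I j s' \<longleftrightarrow> nums s' = nums s \<and> same_except {EJ, CNT} s s' \<and> nats s' EJ 0 = j \<and>
     (\<forall>c. nats s' CNT c = nats s CNT c + (\<Sum>i<j. if P i = c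
     then (if fst (es ! i) = v then 1 else 0) + (if snd (es ! i) = v then 1 else 0) else 0))" for j s'
  show ?thesis unfolding count_loop_def
  proof (rule runs_for[where m = m and T = 70 and I = I])
    show "I 0 (write_nat EJ 0 0 s)"
      by (simp add: I_def same_except_def)
  next
    fix j s' assume "I j s'"
    then have "input_ok n es s'" unfolding I_def by (intro input_ok_same[OF _ _ inp]) auto
    then show "nats s' EJ 0 = j \<and> nval (NGet 0 (NConst 1)) s' = m"
      using \<open>I j s'\<close> by (simp add: I_def input_ok_def m_def)
  next
    fix j s' assume j: "j < m" and I: "I j s'"
    have "input_ok n es s'" using I unfolding I_def by (intro input_ok_same[OF _ _ inp]) auto
    then have e: "nats s' 1 j = fst (es ! j)" "nats s' 2 j = snd (es ! j)"
      using j by (simp_all add: input_ok_def m_def)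
    have vx: "nats s' VX 0 = v" "nats s' PIN = P"
      using I by (simp_all add: I_def v_def P_def same_except_def)
    show "runs h (Seq (count_step 1) (count_step 2)) s' 70
       (\<lambda>s'. nats s' EJ 0 = j \<and> I (Suc j) (write_nat EJ 0 (Suc j) s'))"
      unfolding count_step_def
      using I e vx by (intro runs_straight) (auto simp: I_def same_except_def)
  qed (auto simp: I_def color_count_def m_def v_def P_def cong: if_cong)
qed

section \<open>Expanding a node over all colourings\<close>

definition evaluate_model :: "nat \<Rightarrow> com" where
  "evaluate_model k = Seq
     (CAssign 2 (NVar CP) (CSub (COracle (map (\<lambda>c. NGet CNT (NConst c)) [1..<Suc k])) COne))
     (CAssign 1 (NVar CP) COne)"

definition spawn_children :: com where
  "spawn_children = Cond (NLess (NConst 0) (NGet NDL (NVar XI)))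
     (Seq (NSet LV (NSub (NGet NDL (NVar XI)) (NConst 1))) spawn_nbrs) Skip"

text \<open>The working copies are reloaded for every colouring, since pinning and spawning destroy
  them. The cell of the colouring starts as the empty product 1; its children multiply into it
  during the evaluation.\<close>

definition expand_color :: "nat \<Rightarrow> nat list \<Rightarrow> com" where
  "expand_color k a = Seq (store_list AC 0 a) (Seq copy_in (Seq pin_loop
     (Seq (store_list CNT 0 (replicate (Suc k) 0)) (Seq count_loop (Seq (evaluate_model k)
     (Seq spawn_children (NSet CP (NAdd (NVar CP) (NConst 1)))))))))"

fun children :: "(nat \<times> nat) list \<Rightarrow> nat list \<Rightarrow> nat \<Rightarrow> node \<Rightarrow> node list" where
  "children es a c (l, al, pin, v, w) = (if l = 0 then []
     else map (\<lambda>(u, al'). (l - 1, al', pin_at es v a pin, u, c)) (kids al (nbrs es v)))"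

abbreviation "expand_vars \<equiv> {AC, PIN, AI, EJ, CNT, LV, CP} \<union> spawn_vars"

lemma runs_spawn_children:
  assumes inp: "input_ok n es s" and ok: "work_ok L s" and L: "L = n + length es"
    and x: "nats s XI 0 = x" and nd: "node_at L s x = (l, al, pin, v, w)"
    and v: "nats s VX 0 = v" and al: "nats s ALV = al" and pin: "nats s PIN = pin_at es v a pin"
  shows "runs h spawn_children s (320 * ((L + 1) * (L + 1))) (\<lambda>s'. nums s' = nums s \<and>
    same_except ({EJ, LV} \<union> spawn_vars) s s' \<and> work_ok L s' \<and>
    queue L s' = queue L s @ children es a (nats s CP 0) (l, al, pin, v, w))"
  unfolding spawn_children_def
proof (rule runs_Cond[where T' = "300 * ((L + 1) * (L + 1)) + 8"])
  have l: "nats s NDL x = l" using nd by (simp add: node_at_def)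
  {
    assume "\<not> bval h (NLess (NConst 0) (NGet NDL (NVar XI))) s"
    then have "l = 0" using l x by simp
    then show "runs h Skip s (300 * ((L + 1) * (L + 1)) + 8) (\<lambda>s'. nums s' = nums s \<and>
      same_except ({EJ, LV} \<union> spawn_vars) s s' \<and> work_ok L s' \<and>
      queue L s' = queue L s @ children es a (nats s CP 0) (l, al, pin, v, w))"
      using ok by (intro runs_Skip) (auto simp: same_except_refl)
  next
    assume "bval h (NLess (NConst 0) (NGet NDL (NVar XI))) s"
    then have l0: "l \<noteq> 0" using l x by simp
    define s1 where "s1 = write_nat LV 0 (l - 1) s"
    have se: "same_except {LV} s s1" by (simp add: s1_def same_except_write)
    show "runs h (Seq (NSet LV (NSub (NGet NDL (NVar XI)) (NConst 1))) spawn_nbrs) s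
       (300 * ((L + 1) * (L + 1)) + 8) (\<lambda>s'. nums s' = nums s \<and>
      same_except ({EJ, LV} \<union> spawn_vars) s s' \<and> work_ok L s' \<and>
      queue L s' = queue L s @ children es a (nats s CP 0) (l, al, pin, v, w))"
    proof (rule runs_Seq[OF runs_NAssign])
      have "runs h spawn_nbrs s1 (300 * ((L + 1) * (L + 1))) (\<lambda>s'. nums s' = nums s1 \<and>
          same_except (insert EJ spawn_vars) s1 s' \<and> work_ok L s' \<and>
          queue L s' = pending L s1 (nbrs es (nats s1 VX 0)))"
        by (rule runs_spawn_nbrs[OF input_ok_same[OF se _ inp] work_ok_same[OF se _ ok] L]) simp_all
      moreover have "pending L s1 (nbrs es (nats s1 VX 0)) =
          queue L s @ children es a (nats s CP 0) (l, al, pin, v, w)"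
        using queue_same[OF se, of L] l0 v al pin
        by (simp add: pending_def s1_def)
      ultimately have "runs h spawn_nbrs s1 (300 * ((L + 1) * (L + 1))) (\<lambda>s'. nums s' = nums s \<and>
        same_except ({EJ, LV} \<union> spawn_vars) s s' \<and> work_ok L s' \<and>
        queue L s' = queue L s @ children es a (nats s CP 0) (l, al, pin, v, w))"
        using same_except_trans[OF se, of "insert EJ spawn_vars" _ "{EJ, LV} \<union> spawn_vars"]
        by (elim runs_mono) (auto simp: s1_def)
      moreover have "s1 = write_nat LV (nval (NConst 0) s) (nval (NSub (NGet NDL (NVar XI)) (NConst 1)) s) s"
        using l x by (simp add: s1_def)
      ultimately show "runs h spawn_nbrs (write_nat LV (nval (NConst 0) s) (nval (NSub (NGet NDL (NVar XI)) (NConst 1)) s) s)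
        (300 * ((L + 1) * (L + 1))) (\<lambda>s'. nums s' = nums s \<and>
        same_except ({EJ, LV} \<union> spawn_vars) s s' \<and> work_ok L s' \<and>
        queue L s' = queue L s @ children es a (nats s CP 0) (l, al, pin, v, w))"
        by simp
    qed (rule order_refl, simp)
  }
qed simp

lemma runs_expand_color:
  assumes inp: "input_ok n es s" and ok: "work_ok L s" and L: "L = n + length es"
    and x: "nats s XI 0 = x" "nats s XB 0 = x * L" and nd: "node_at L s x = (l, al, pin, v, w)"
    and v: "nats s VX 0 = v" and ac: "\<And>i. i \<ge> length a \<Longrightarrow> nats s AC i = 0"
    and xq: "x < nats s QN 0"
  shows "runs h (expand_color k a) s ((3 * length a + 5 * k + 800) * ((L + 1) * (L + 1))) (\<lambda>s'.
    nums s' = (nums s)(2 := (nums s 2)(nats s CP 0 := deviation k es h v pin a),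
      1 := (nums s 1)(nats s CP 0 := 1)) \<and>
    same_except expand_vars s s' \<and> work_ok L s' \<and> (\<forall>i\<ge>length a. nats s' AC i = 0) \<and>
    nats s' CP 0 = Suc (nats s CP 0) \<and>
    queue L s' = queue L s @ children es a (nats s CP 0) (l, al, pin, v, w))"
proof -
  define c where "c = nats s CP 0"
  have bl: "block L BAL s x = al" "block L BPI s x = pin" using nd by (simp_all add: node_at_def)
  let ?Q = "\<lambda>s'. nums s' = (nums s)(2 := (nums s 2)(c := deviation k es h v pin a), 1 := (nums s 1)(c := 1)) \<and>
    same_except expand_vars s s' \<and> work_ok L s' \<and> (\<forall>i\<ge>length a. nats s' AC i = 0) \<and>
    nats s' CP 0 = Suc c \<and> queue L s' = queue L s @ children es a c (l, al, pin, v, w)"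
  have "runs h (expand_color k a) s ((3 * length a + 1) + ((L + 1) * 40 + (100 * (length es + 1) +
     ((3 * length (replicate (Suc k) (0::nat)) + 1) + (100 * (length es + 1) + ((2 * k + 11) + (320 * ((L + 1) * (L + 1)) + 6))))))) ?Q"
    unfolding expand_color_def
  proof (rule runs_seq[OF runs_store_list], goal_cases)
    case (1 s1)
    have ac1: "nats s1 AC = pad_zero a" using 1 ac by (auto simp: pad_zero_def fun_eq_iff)
    have se1: "same_except {AC} s s1" using 1 by (auto simp: same_except_def)
    have n1: "nums s1 = nums s" using 1 by simp
    have len1: "nats s1 LEN 0 = L" using input_ok_same[OF se1 _ inp] by (simp add: input_ok_def L)
    show ?case
    proof (rule runs_seq[OF runs_copy_in[OF len1]], goal_cases)
      case (1 s2)
      note 2 = this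
      have old1: "nats s1 A = nats s A" if "A \<noteq> AC" for A using se1 that by (simp add: same_except_def)
      have "nats s2 ALV = block L BAL s x" "nats s2 PIN = block L BPI s x"
        using 2 ok by (auto simp: old1 block_def x work_ok_def fun_eq_iff)
      then have cur2: "nats s2 ALV = al" "nats s2 PIN = pin" using bl by simp_all
      have "same_except {CI, ALV, PIN} s1 s2" using 2 by (auto simp: same_except_def)
      with se1 have se2: "same_except {AC, CI, ALV, PIN} s s2" by (rule same_except_trans) auto
      have inp2: "input_ok n es s2" by (rule input_ok_same[OF se2 _ inp]) simp
      have ac2: "nats s2 AC = pad_zero a" using 2 ac1 by simp
      have n2: "nums s2 = nums s" using n1 2 by simp
      have zero: "al i = 0" "pin i = 0" if "i \<ge> L" for i using that by (auto simp: bl[symmetric] block_def)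
      show ?case
      proof (rule runs_seq[OF runs_pin_loop[OF inp2]], goal_cases)
        case (1 s3)
        note 3 = this
        have vx2: "nats s2 VX 0 = v" using se2 v by (simp add: same_except_def)
        have pin3: "nats s3 PIN = pin_at es v a pin" using 3 vx2 ac2 cur2 by (simp add: pin_at_def)
        have se3: "same_except {AC, CI, ALV, PIN, AI, EJ} s s3"
          by (rule same_except_trans[OF se2]) (use 3 in auto)
        have al3: "nats s3 ALV = al" "nats s3 AC = pad_zero a"
          using 3 cur2 ac2 by (auto simp: same_except_def)
        show ?case
        proof (rule runs_seq[OF runs_store_list], goal_cases)
          case (1 s4)
          have "same_except {CNT} s3 s4" using 1 by (auto simp: same_except_def)
          with se3 have se4: "same_except {AC, CI, ALV, PIN, AI, EJ, CNT} s s4"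
            by (rule same_except_trans) auto
          have cnt4: "nats s4 CNT i = 0" if "i \<le> k" for i using 1 that by (simp del: replicate.simps)
          have pin4: "nats s4 PIN = pin_at es v a pin" "nats s4 ALV = al" "nats s4 AC = pad_zero a"
            using 1 pin3 al3 by simp_all
          have n4: "nums s4 = nums s" using 1 3 n2 by simp
          have inp4: "input_ok n es s4" by (rule input_ok_same[OF se4 _ inp]) simp
          show ?case
          proof (rule runs_seq[OF runs_count_loop[OF inp4]], goal_cases)
            case (1 s5)
            note 3 = this
            have se5: "same_except {AC, CI, ALV, PIN, AI, EJ, CNT} s s5"
              by (rule same_except_trans[OF se4]) (use 3 in auto)
            have pin5: "nats s5 PIN = pin_at es v a pin" "nats s5 ALV = al" "nats s5 AC = pad_zero a"
              using 3 pin4 by (auto simp: same_except_def)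
            have vx4: "nats s4 VX 0 = v" using se4 v by (simp add: same_except_def)
            have "map (nats s5 CNT) [1..<Suc k] = color_counts k es (pin_at es v a pin) v"
              using 3 cnt4 vx4 pin4 by (simp add: color_counts_def del: upt_Suc)
            moreover have "map (\<lambda>e. nval e s5) (map (\<lambda>c. NGet CNT (NConst c)) [1..<Suc k]) =
                map (nats s5 CNT) [1..<Suc k]" by (simp add: comp_def del: upt_Suc)
            ultimately have dev: "cval h (CSub (COracle (map (\<lambda>c. NGet CNT (NConst c)) [1..<Suc k])) COne) s5 =
                deviation k es h v pin a"
              unfolding deviation_def by (simp del: upt_Suc map_map)
            have c5: "nats s5 CP 0 = c" using se5 by (simp add: same_except_def c_def)
            define s6 where "s6 = write_num 1 c 1 (write_num 2 c (deviation k es h v pin a) s5)"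
            have se6: "same_except {AC, CI, ALV, PIN, AI, EJ, CNT} s s6"
              using se5 by (simp add: same_except_def s6_def)
            have n6: "nums s6 = (nums s)(2 := (nums s 2)(c := deviation k es h v pin a), 1 := (nums s 1)(c := 1))"
              using 3 n4 by (simp add: s6_def)
            \<comment> \<open>Only indices of edges get pinned, and these lie below
              \<open>L\<close>.\<close>
            have ok6: "work_ok L s6"
              using ok se6 pin5 zero L
              by (auto simp: work_ok_def same_except_def s6_def pin_at_def pin_edges_other)
            have nd6: "node_at L s6 x = (l, al, pin, v, w)"
              using nd se6 by (simp add: node_at_def block_def same_except_def cong: if_cong)
            show ?case
            proof (rule runs_seq[OF runs_straight[where Q = "\<lambda>s'. s' = s6"]], goal_cases)
              case (4 s6')
              have inp6: "input_ok n es s6" by (rule input_ok_same[OF se6 _ inp]) simp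
              have at6: "nats s6 XI 0 = x" "nats s6 VX 0 = v" "nats s6 ALV = al" "nats s6 PIN = pin_at es v a pin"
                using se6 v pin5 x by (simp_all add: same_except_def s6_def)
              have "runs h (Seq spawn_children (NSet CP (NAdd (NVar CP) (NConst 1)))) s6
                  (320 * ((L + 1) * (L + 1)) + 6) ?Q"
              proof (rule runs_seq[OF runs_spawn_children[OF inp6 ok6 L at6(1) nd6 at6(2-4)]], goal_cases)
                case (1 s7)
                have c6: "nats s6 CP 0 = c" using c5 by (simp add: s6_def)
                have se67: "same_except ({EJ, LV} \<union> spawn_vars) s6 s7" using 1 by blast
                have c7: "nats s7 CP 0 = c" using se67 c6 by (simp add: same_except_def)
                define s8 where "s8 = write_nat CP 0 (Suc c) s7"
                have se78: "same_except {CP} s7 s8" by (simp add: s8_def same_except_write)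
                have "same_except expand_vars s s8"
                  using se6 se67 se78 by (auto simp: same_except_def)
                moreover have "work_ok L s8" by (rule work_ok_same[OF se78]) (use 1 in auto)
                moreover have "queue L s8 = queue L s7" by (rule queue_same[OF se78]) auto
                moreover have "queue L s6 = queue L s" by (rule queue_same[OF se6]) auto
                moreover have "nats s8 AC = pad_zero a"
                  using se67 pin5 by (simp add: s8_def s6_def same_except_def)
                ultimately have "?Q s8" using 1 n6 c6 by (simp add: s8_def pad_zero_def)
                then show ?case using c7 by (intro runs_NAssign) (simp_all add: s8_def)
              qed
              then show ?case using 4 by simp
            next
              case 2
              show ?case using dev c5 by (simp add: evaluate_model_def s6_def del: upt_Suc)
            qed (simp_all add: evaluate_model_def comp_def sum_list_triv del: upt_Suc)
          qed
        qed
      qed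
    qed
  qed
  then show ?thesis unfolding c_def
  proof (rule runs_mono)
    define M where "M = (L + 1) * (L + 1)"
    have "L + 1 \<le> M" "1 \<le> M" "length es \<le> L" by (auto simp: M_def L)
    define p q where "p = 3 * length a * M" and "q = 5 * k * M"
    have pq: "3 * length a \<le> p" "5 * k \<le> q" using \<open>1 \<le> M\<close> by (simp_all add: p_def q_def)
    have "(3 * length a + 1) + ((L + 1) * 40 + (100 * (length es + 1) + ((3 * length (replicate (Suc k) (0::nat)) + 1) +
        (100 * (length es + 1) + ((2 * k + 11) + (320 * M + 6)))))) \<le> p + q + 800 * M"
      using \<open>L + 1 \<le> M\<close> \<open>length es \<le> L\<close> pq by simp
    then have "(3 * length a + 1) + ((L + 1) * 40 + (100 * (length es + 1) + ((3 * length (replicate (Suc k) (0::nat)) + 1) +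
        (100 * (length es + 1) + ((2 * k + 11) + (320 * M + 6)))))) \<le> 3 * length a * M + 5 * k * M + 800 * M"
      by (simp only: p_def q_def)
    then show "(3 * length a + 1) + ((L + 1) * 40 + (100 * (length es + 1) + ((3 * length (replicate (Suc k) (0::nat)) + 1) +
        (100 * (length es + 1) + ((2 * k + 11) + (320 * ((L + 1) * (L + 1)) + 6)))))) \<le>
        (3 * length a + 5 * k + 800) * ((L + 1) * (L + 1))"
      unfolding M_def by (simp add: algebra_simps)
  qed simp
qed

primrec children_list :: "(nat \<times> nat) list \<Rightarrow> nat list list \<Rightarrow> nat \<Rightarrow> node \<Rightarrow> node list" where
  "children_list es [] c nd = []"
| "children_list es (a # as) c nd = children es a c nd @ children_list es as (Suc c) nd"

fun node_deviation ::
  "nat \<Rightarrow> (nat \<times> nat) list \<Rightarrow> edge_coloring_model \<Rightarrow> node \<Rightarrow> nat list \<Rightarrow> complex" where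
  "node_deviation k es h (l, al, pin, v, w) a = deviation k es h v pin a"

fun cell :: "node \<Rightarrow> nat" where
  "cell (l, al, pin, v, w) = w"

lemma queue_nth: "x < nats s QN 0 \<Longrightarrow> queue L s ! x = node_at L s x"
  by (simp add: queue_def)

lemma runs_expand_colors:
  assumes "input_ok n es s" "work_ok L s" "L = n + length es"
    and "nats s XI 0 = x" "nats s XB 0 = x * L" "x < nats s QN 0"
    and "queue L s ! x = nd" "nats s VX 0 = nats s NDV x"
    and "\<And>i. i \<ge> \<Delta> \<Longrightarrow> nats s AC i = 0" "\<And>a. a \<in> set as \<Longrightarrow> length a = \<Delta>"
  shows "runs h (seq_list (map (expand_color k) as)) s
    (length as * ((3 * \<Delta> + 5 * k + 800) * ((L + 1) * (L + 1))) + 1) (\<lambda>s'.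
    nums s' = (nums s)
      (2 := (\<lambda>c. if nats s CP 0 \<le> c \<and> c < nats s CP 0 + length as
         then node_deviation k es h nd (as ! (c - nats s CP 0)) else nums s 2 c),
       1 := (\<lambda>c. if nats s CP 0 \<le> c \<and> c < nats s CP 0 + length as then 1 else nums s 1 c)) \<and>
    same_except expand_vars s s' \<and> work_ok L s' \<and> (\<forall>i\<ge>\<Delta>. nats s' AC i = 0) \<and>
    nats s' CP 0 = nats s CP 0 + length as \<and>
    queue L s' = queue L s @ children_list es as (nats s CP 0) nd)"
  using assms
proof (induction as arbitrary: s)
  case Nil
  then show ?case by (auto intro!: runs_Skip simp: same_except_refl fun_eq_iff)
next
  case (Cons a as)
  define c where "c = nats s CP 0"
  obtain l al pin v w where nd: "nd = (l, al, pin, v, w)" by (cases nd) auto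
  have at: "node_at L s x = (l, al, pin, v, w)" using Cons.prems nd by (simp add: queue_nth)
  have vx: "nats s VX 0 = v" using at Cons.prems by (simp add: node_at_def)
  have la: "length a = \<Delta>" using Cons.prems by simp
  let ?T = "(3 * \<Delta> + 5 * k + 800) * ((L + 1) * (L + 1))"
  have T: "length (a # as) * ?T + 1 = ?T + (length as * ?T + 1)" by simp
  have 1: "runs h (expand_color k a) s ?T (\<lambda>s'.
    nums s' = (nums s)(2 := (nums s 2)(c := node_deviation k es h nd a), 1 := (nums s 1)(c := 1)) \<and>
    same_except expand_vars s s' \<and> work_ok L s' \<and> (\<forall>i\<ge>\<Delta>. nats s' AC i = 0) \<and>
    nats s' CP 0 = Suc c \<and> queue L s' = queue L s @ children es a c nd)"
    using runs_expand_color[OF Cons.prems(1-5) at vx, of a h k] Cons.prems(6,9)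
    unfolding la nd c_def by simp
  show ?case unfolding T list.map seq_list.simps
  proof (rule runs_seq[OF 1])
    fix s1
    assume s1: "nums s1 = (nums s)(2 := (nums s 2)(c := node_deviation k es h nd a), 1 := (nums s 1)(c := 1)) \<and>
      same_except expand_vars s s1 \<and> work_ok L s1 \<and> (\<forall>i\<ge>\<Delta>. nats s1 AC i = 0) \<and>
      nats s1 CP 0 = Suc c \<and> queue L s1 = queue L s @ children es a c nd"
    have inp1: "input_ok n es s1" using s1 by (intro input_ok_same[OF _ _ Cons.prems(1)]) auto
    have qn: "nats s1 QN 0 = length (queue L s1)" by simp
    also have "\<dots> \<ge> nats s QN 0" using s1 by simp
    finally have x1: "x < nats s1 QN 0" using Cons.prems(6) by simp
    have q1: "queue L s1 ! x = nd" using s1 Cons.prems(6,7) by (simp add: nth_append)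
    have v1: "nats s1 VX 0 = nats s1 NDV x"
    proof -
      have "node_at L s1 x = node_at L s x" using q1 x1 at nd by (simp add: queue_nth)
      then have "nats s1 NDV x = nats s NDV x" by (simp add: node_at_def)
      moreover have "nats s1 VX = nats s VX" using s1 by (simp add: same_except_def)
      ultimately show ?thesis using Cons.prems by simp
    qed
    have "nats s1 XI 0 = x" "nats s1 XB 0 = x * L"
      using s1 Cons.prems by (simp_all add: same_except_def)
    then have "runs h (seq_list (map (expand_color k) as)) s1 (length as * ?T + 1) (\<lambda>s'.
      nums s' = (nums s1)
        (2 := (\<lambda>d. if nats s1 CP 0 \<le> d \<and> d < nats s1 CP 0 + length as
           then node_deviation k es h nd (as ! (d - nats s1 CP 0)) else nums s1 2 d),
         1 := (\<lambda>d. if nats s1 CP 0 \<le> d \<and> d < nats s1 CP 0 + length as then 1 else nums s1 1 d)) \<and>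
      same_except expand_vars s1 s' \<and> work_ok L s' \<and> (\<forall>i\<ge>\<Delta>. nats s' AC i = 0) \<and>
      nats s' CP 0 = nats s1 CP 0 + length as \<and>
      queue L s' = queue L s1 @ children_list es as (nats s1 CP 0) nd)"
      using s1 inp1 x1 q1 v1 Cons.prems by (intro Cons.IH) auto
    then show "runs h (seq_list (map (expand_color k) as)) s1 (length as * ?T + 1) (\<lambda>s'.
      nums s' = (nums s)
        (2 := (\<lambda>d. if nats s CP 0 \<le> d \<and> d < nats s CP 0 + length (a # as)
           then node_deviation k es h nd ((a # as) ! (d - nats s CP 0)) else nums s 2 d),
         1 := (\<lambda>d. if nats s CP 0 \<le> d \<and> d < nats s CP 0 + length (a # as) then 1 else nums s 1 d)) \<and>
      same_except expand_vars s s' \<and> work_ok L s' \<and> (\<forall>i\<ge>\<Delta>. nats s' AC i = 0) \<and>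
      nats s' CP 0 = nats s CP 0 + length (a # as) \<and>
      queue L s' = queue L s @ children_list es (a # as) (nats s CP 0) nd)"
    proof (rule runs_mono[OF _ order_refl], goal_cases)
      case (1 s2)
      have "nums s2 = (nums s)
        (2 := (\<lambda>d. if c \<le> d \<and> d < c + length (a # as)
           then node_deviation k es h nd ((a # as) ! (d - c)) else nums s 2 d),
         1 := (\<lambda>d. if c \<le> d \<and> d < c + length (a # as) then 1 else nums s 1 d))"
      proof (intro ext, goal_cases)
        case (1 A d)
        have "(a # as) ! (d - c) = as ! (d - Suc c)" if "Suc c \<le> d"
          using that by (cases "d - c") (auto simp: Suc_diff_le intro: arg_cong[of _ _ "(!) as"])
        then show ?case using s1 \<open>nums s2 = _ \<and> _\<close> by auto
      qed
      moreover have "same_except expand_vars s s2"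
        using s1 1 by (intro same_except_trans[of expand_vars s s1 expand_vars s2]) auto
      ultimately show ?case using 1 s1 unfolding c_def by simp
    qed
  qed
qed

definition expand_node :: "nat \<Rightarrow> nat \<Rightarrow> com" where
  "expand_node \<Delta> k = Seq (NSet VX (NGet NDV (NVar XI)))
     (Seq (seq_list (map (expand_color k) (colorings \<Delta> k)))
     (Seq (NSet XB (NAdd (NVar XB) (NVar LEN))) (NSet XI (NAdd (NVar XI) (NConst 1)))))"

definition build :: "nat \<Rightarrow> nat \<Rightarrow> com" where
  "build \<Delta> k = While (NLess (NVar XI) (NVar QN)) (expand_node \<Delta> k)"

section \<open>Cells, weights and the size of the tree\<close>

context edge_model
begin

abbreviation "K \<equiv> k ^ \<Delta>"
abbreviation "L \<equiv> n + length es"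

fun node_value :: "node \<Rightarrow> complex" where
  "node_value (l, al, pin, v, w) = R l al pin v"

fun node_weight :: "node \<Rightarrow> nat list \<Rightarrow> complex" where
  "node_weight (l, al, pin, v, w) a = (if l = 0 then 1 else
     prod_list (map (\<lambda>(u, al'). R (l - 1) al' (pin_at es v a pin) u) (kids al (nbrs es v))))"

text \<open>Bounds the subtree of a node of depth \<open>l\<close>. The branching uses the length 2
  \<Delta> of \<open>nbrs\<close>, which bounds the children without reference to removed
  vertices.\<close>

primrec tree_size :: "nat \<Rightarrow> nat" where
  "tree_size 0 = 1"
| "tree_size (Suc l) = 1 + K * (2 * \<Delta>) * tree_size l"

fun node_size :: "node \<Rightarrow> nat" where
  "node_size (l, al, pin, v, w) = tree_size l"

text \<open>What the nodes of \<open>Q\<close> are to contribute to cell \<open>c\<close> once all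
  of them have been evaluated.\<close>

definition cell_product :: "node list \<Rightarrow> nat \<Rightarrow> complex" where
  "cell_product Q c = prod_list (map node_value (filter (\<lambda>nd. cell nd = c) Q))"

lemma node_value_mean: "node_value nd = mean_ratio C (node_deviation k es h nd) (node_weight nd)"
proof (cases nd)
  case (fields l al pin v w)
  have "node_deviation k es h nd = deviation k es h v pin" by (simp add: fields fun_eq_iff)
  then show ?thesis
    by (cases l) (simp_all add: fields node_weight.simps[abs_def] mean_ratio_def)
qed

lemma cell_product_append: "cell_product (P @ Q) c = cell_product P c * cell_product Q c"
  by (simp add: cell_product_def)

lemma cell_product_Cons:
  "cell_product (nd # Q) c = (if cell nd = c then node_value nd else 1) * cell_product Q c"
  by (simp add: cell_product_def)

lemma cell_product_none: "(\<And>nd. nd \<in> set Q \<Longrightarrow> cell nd \<noteq> c) \<Longrightarrow> cell_product Q c = 1"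
  by (simp add: cell_product_def filter_False)

lemma cell_children: "nd' \<in> set (children es a c nd) \<Longrightarrow> cell nd' = c"
  by (cases nd) (auto split: if_splits)

lemma cell_product_children: "cell_product (children es a c nd) c = node_weight nd a"
proof (cases nd)
  case (fields l al pin v w)
  have "filter (\<lambda>nd'. cell nd' = c) (children es a c nd) = children es a c nd"
    using cell_children by (simp add: filter_id_conv)
  then show ?thesis
    by (auto simp: cell_product_def fields comp_def case_prod_unfold)
qed

lemma cell_children_list:
  "nd' \<in> set (children_list es as c nd) \<Longrightarrow> c \<le> cell nd' \<and> cell nd' < c + length as"
proof (induction as arbitrary: c)
  case (Cons a as)
  then show ?case using cell_children[of nd' a c nd] Cons.IH[of "Suc c"] by fastforce
qed simp

lemma cell_product_children_list:
  "c \<le> d \<Longrightarrow> d < c + length as \<Longrightarrow>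
    cell_product (children_list es as c nd) d = node_weight nd (as ! (d - c))"
proof (induction as arbitrary: c)
  case (Cons a as)
  show ?case
  proof (cases "d = c")
    case True
    have "cell_product (children_list es as (Suc c) nd) d = 1"
      using True cell_children_list[of _ as "Suc c" nd] by (intro cell_product_none) fastforce
    then show ?thesis using True by (simp add: cell_product_append cell_product_children)
  next
    case False
    have "cell_product (children es a c nd) d = 1"
      using False cell_children by (intro cell_product_none) blast
    then show ?thesis using False Cons
      by (simp add: cell_product_append Cons.IH[of "Suc c"] nth_Cons')
  qed
qed simp

lemma length_nbrs: "length (nbrs es v) \<le> 2 * \<Delta>"
proof -
  have "length (nbrs es v) = (\<Sum>j\<leftarrow>[0..<length es]. if incident es j v then 2 else 0)"
    by (simp add: nbrs_def length_concat comp_def if_distrib numeral_2_eq_2 cong: if_cong)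
  also have "\<dots> = (\<Sum>j<length es. if incident es j v then 2 else 0)"
    by (subst sum_list_distinct_conv_sum_set) (simp_all add: atLeast0LessThan)
  also have "\<dots> = 2 * card ({..<length es} \<inter> {j. incident es j v})" by (simp add: sum.If_cases)
  also have "{..<length es} \<inter> {j. incident es j v} = {j. j < length es \<and> incident es j v}" by auto
  finally show ?thesis using degree[of v] by simp
qed

lemma length_kids_le: "length (kids al us) \<le> length us"
  by (induction us arbitrary: al) (auto simp del: fun_upd_apply intro: le_SucI)

lemma size_children_list:
  "sum_list (map node_size (children_list es as c (l, al, pin, v, w))) \<le>
    (if l = 0 then 0 else length as * (2 * \<Delta>) * tree_size (l - 1))"
proof (induction as arbitrary: c)
  case (Cons a as)
  show ?case
  proof (cases "l = 0")
    case False
    have "sum_list (map node_size (children es a c (l, al, pin, v, w))) =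
        length (kids al (nbrs es v)) * tree_size (l - 1)"
      using False by (simp add: comp_def case_prod_unfold sum_list_triv)
    also have "\<dots> \<le> 2 * \<Delta> * tree_size (l - 1)"
      using order_trans[OF length_kids_le length_nbrs] by (intro mult_right_mono) auto
    finally show ?thesis using False Cons.IH[of "Suc c"]
      by (simp del: children.simps add: algebra_simps)
  qed (use Cons.IH[of "Suc c"] in simp)
qed simp

text \<open>The last conjunct bounds the final number of nodes; its second summand decreases strictly with
  each expansion.\<close>

definition build_inv :: "complex \<Rightarrow> nat \<Rightarrow> memory \<Rightarrow> bool" where
  "build_inv P B s \<longleftrightarrow> input_ok n es s \<and> work_ok L s \<and> (\<forall>i\<ge>\<Delta>. nats s AC i = 0) \<and>
     nats s XI 0 \<le> nats s QN 0 \<and> nats s XB 0 = nats s XI 0 * L \<and> nats s CP 0 = 1 + nats s XI 0 * K \<and>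
     cell_product (queue L s) 0 = P \<and> nums s 1 0 = of_nat k ^ length es \<and>
     (\<forall>c. 1 \<le> c \<and> c < nats s CP 0 \<longrightarrow> nums s 1 c = 1) \<and>
     (\<forall>y<nats s XI 0. \<forall>i<K. nums s 2 (1 + y * K + i) = node_deviation k es h (queue L s ! y) (C ! i) \<and>
        cell_product (queue L s) (1 + y * K + i) = node_weight (queue L s ! y) (C ! i)) \<and>
     (\<forall>z<nats s QN 0. cell (queue L s ! z) \<le> z * K \<and> cell (queue L s ! z) < nats s CP 0) \<and>
     nats s XI 0 + sum_list (map node_size (drop (nats s XI 0) (queue L s))) \<le> B"

text \<open>Breadth-first order gives the ordering needed later: the node at position
  \<open>z\<close> feeds a cell of index at most z K, below its own cells, which start at 1 + z K.
  The fresh cells of the expanded node are fed only by its new children.\<close>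

lemma runs_expand_node:
  assumes inv: "build_inv P B s" and more: "nats s XI 0 < nats s QN 0"
  shows "runs h (expand_node \<Delta> k) s (K * ((3 * \<Delta> + 5 * k + 800) * ((L + 1) * (L + 1))) + 50) (\<lambda>s'.
    build_inv P B s' \<and> sum_list (map node_size (drop (nats s' XI 0) (queue L s'))) <
      sum_list (map node_size (drop (nats s XI 0) (queue L s))))"
proof -
  define x where "x = nats s XI 0"
  define c0 where "c0 = 1 + x * K"
  define Q where "Q = queue L s"
  define nd where "nd = Q ! x"
  define Q' where "Q' = Q @ children_list es C c0 nd"
  define s1 where "s1 = write_nat VX 0 (nats s NDV x) s"
  have se1: "same_except {VX} s s1" by (simp add: s1_def same_except_write)
  have q1: "queue L s1 = Q" using queue_same[OF se1] by (simp add: Q_def)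
  have lenQ: "length Q = nats s QN 0" by (simp add: Q_def)
  note I = inv[unfolded build_inv_def, folded x_def Q_def]
  let ?T = "K * ((3 * \<Delta> + 5 * k + 800) * ((L + 1) * (L + 1)))"
  have cp1: "nats s1 CP 0 = c0" using I by (simp add: s1_def c0_def)
  have "runs h (seq_list (map (expand_color k) C)) s1
    (length C * ((3 * \<Delta> + 5 * k + 800) * ((L + 1) * (L + 1))) + 1) (\<lambda>s'.
    nums s' = (nums s1)
      (2 := (\<lambda>c. if nats s1 CP 0 \<le> c \<and> c < nats s1 CP 0 + length C
         then node_deviation k es h nd (C ! (c - nats s1 CP 0)) else nums s1 2 c),
       1 := (\<lambda>c. if nats s1 CP 0 \<le> c \<and> c < nats s1 CP 0 + length C then 1 else nums s1 1 c)) \<and>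
    same_except expand_vars s1 s' \<and> work_ok L s' \<and> (\<forall>i\<ge>\<Delta>. nats s' AC i = 0) \<and>
    nats s' CP 0 = nats s1 CP 0 + length C \<and>
    queue L s' = queue L s1 @ children_list es C (nats s1 CP 0) nd)"
  proof (rule runs_expand_colors)
    show "input_ok n es s1" by (rule input_ok_same[OF se1]) (use I in auto)
    show "work_ok L s1" by (rule work_ok_same[OF se1]) (use I in auto)
    show "queue L s1 ! x = nd" by (simp add: q1 nd_def)
  qed (use I more in \<open>auto simp: s1_def x_def[symmetric] set_colorings\<close>)
  then have colors: "runs h (seq_list (map (expand_color k) C)) s1 (?T + 1) (\<lambda>s'.
    nums s' = (nums s)
      (2 := (\<lambda>c. if c0 \<le> c \<and> c < c0 + K then node_deviation k es h nd (C ! (c - c0)) else nums s 2 c),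
       1 := (\<lambda>c. if c0 \<le> c \<and> c < c0 + K then 1 else nums s 1 c)) \<and>
    same_except (insert VX expand_vars) s s' \<and> work_ok L s' \<and> (\<forall>i\<ge>\<Delta>. nats s' AC i = 0) \<and>
    nats s' CP 0 = c0 + K \<and> queue L s' = Q')"
  proof (rule runs_mono)
    fix s'
    assume *: "nums s' = (nums s1)
      (2 := (\<lambda>c. if nats s1 CP 0 \<le> c \<and> c < nats s1 CP 0 + length C
         then node_deviation k es h nd (C ! (c - nats s1 CP 0)) else nums s1 2 c),
       1 := (\<lambda>c. if nats s1 CP 0 \<le> c \<and> c < nats s1 CP 0 + length C then 1 else nums s1 1 c)) \<and>
      same_except expand_vars s1 s' \<and> work_ok L s' \<and> (\<forall>i\<ge>\<Delta>. nats s' AC i = 0) \<and>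
      nats s' CP 0 = nats s1 CP 0 + length C \<and>
      queue L s' = queue L s1 @ children_list es C (nats s1 CP 0) nd"
    have "same_except (insert VX expand_vars) s s'" by (rule same_except_trans[OF se1]) (use * in auto)
    moreover have "nums s1 = nums s" by (simp add: s1_def)
    ultimately show "nums s' = (nums s)
      (2 := (\<lambda>c. if c0 \<le> c \<and> c < c0 + K then node_deviation k es h nd (C ! (c - c0)) else nums s 2 c),
       1 := (\<lambda>c. if c0 \<le> c \<and> c < c0 + K then 1 else nums s 1 c)) \<and>
      same_except (insert VX expand_vars) s s' \<and> work_ok L s' \<and> (\<forall>i\<ge>\<Delta>. nats s' AC i = 0) \<and>
      nats s' CP 0 = c0 + K \<and> queue L s' = Q'"
      using * by (simp add: cp1 q1 length_colorings Q'_def cong: if_cong)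
  qed (simp add: length_colorings)
  have "runs h (Seq (seq_list (map (expand_color k) C))
      (Seq (NSet XB (NAdd (NVar XB) (NVar LEN))) (NSet XI (NAdd (NVar XI) (NConst 1))))) s1 ((?T + 1) + 20)
    (\<lambda>s'. build_inv P B s' \<and> sum_list (map node_size (drop (nats s' XI 0) (queue L s'))) <
      sum_list (map node_size (drop (nats s XI 0) (queue L s))))"
  proof (rule runs_seq[OF colors], goal_cases)
    case (1 s2)
    note 3 = this
    define s3 where "s3 = write_nat XI 0 (Suc x) (write_nat XB 0 (x * L + L) s2)"
    have eqs: "nats s2 XI = nats s XI" "nats s2 XB = nats s XB" "nats s2 0 = nats s 0" "nats s2 LEN = nats s LEN"
      using 3 by (simp_all add: same_except_def)
    have len2: "nats s2 LEN 0 = L" using eqs I by (simp add: input_ok_def)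
    have s3: "run_straight h (Seq (NSet XB (NAdd (NVar XB) (NVar LEN))) (NSet XI (NAdd (NVar XI) (NConst 1)))) s2 = s3"
      using I len2 by (simp add: s3_def eqs x_def)
    have x3: "nats s3 XI 0 = Suc x" by (simp add: s3_def)
    have se23: "same_except {XI, XB} s2 s3" by (simp add: s3_def same_except_def)
    have Q3: "queue L s3 = Q'" using queue_same[OF se23, of L] 3 by simp
    have xQ: "x < length Q" using more by (simp add: lenQ x_def)
    have nthQ: "Q' ! z = Q ! z" if "z < length Q" for z using that by (simp add: Q'_def nth_append)
    have qn3: "nats s3 QN 0 = length Q'" using Q3 length_queue[of L s3] by simp
    have cellQ: "cell nd' < c0" if "nd' \<in> set Q" for nd'
      using that I lenQ by (auto simp: in_set_conv_nth c0_def)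
    have cellC: "c0 \<le> cell nd' \<and> cell nd' < c0 + K" if "nd' \<in> set (children_list es C c0 nd)" for nd'
      using cell_children_list[OF that] by (simp add: length_colorings)
    have prod_old: "cell_product Q' c = cell_product Q c" if "c < c0" for c
    proof -
      have "cell_product (children_list es C c0 nd) c = 1"
        using cellC that by (intro cell_product_none) fastforce
      then show ?thesis by (simp add: Q'_def cell_product_append)
    qed
    have prod_new: "cell_product Q' (c0 + i) = node_weight nd (C ! i)" if "i < K" for i
    proof -
      have "cell_product Q (c0 + i) = 1" using cellQ by (intro cell_product_none) fastforce
      then show ?thesis
        using that cell_product_children_list[of c0 "c0 + i" C nd]
        by (simp add: Q'_def cell_product_append length_colorings)
    qed
    have old_lt: "1 + y * K + i < c0" if "y < x" "i < K" for y i
    proof -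
      have "y * K + i < (y + 1) * K" using that by simp
      also have "\<dots> \<le> x * K" using that by (intro mult_right_mono) auto
      finally show ?thesis by (simp add: c0_def)
    qed
    have entries: "nums s2 2 (1 + y * K + i) = node_deviation k es h (Q' ! y) (C ! i) \<and>
        cell_product Q' (1 + y * K + i) = node_weight (Q' ! y) (C ! i)" if "y < Suc x" "i < K" for y i
    proof (cases "y = x")
      case True
      then show ?thesis
        using 3 prod_new[OF that(2)] that nthQ[OF xQ] by (simp add: nd_def c0_def)
    next
      case False
      then have y: "y < x" using that by simp
      then show ?thesis
        using 3 I old_lt[OF y that(2)] that xQ prod_old nthQ[of y] by simp
    qed
    have cells: "cell (Q' ! z) \<le> z * K \<and> cell (Q' ! z) < c0 + K" if "z < length Q'" for z
    proof (cases "z < length Q")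
      case True
      then show ?thesis using I cellQ[of "Q ! z"] lenQ by (auto simp: nthQ)
    next
      case False
      then have "Q' ! z \<in> set (children_list es C c0 nd)"
        using that by (simp add: Q'_def nth_append)
      note c = cellC[OF this]
      \<comment> \<open>A new child stands behind position \<open>x\<close>, while its cell is below
        1 + (x + 1) K.\<close>
      have "(x + 1) * K \<le> z * K" using False xQ by (intro mult_right_mono) auto
      then show ?thesis using c by (simp add: c0_def)
    qed
    have dQ: "drop x Q = nd # drop (Suc x) Q" using xQ by (simp add: nd_def Cons_nth_drop_Suc)
    obtain l al pin v w where ndf: "nd = (l, al, pin, v, w)" by (cases nd) auto
    \<comment> \<open>The summand 1 in \<open>tree_size\<close> pays for the node itself, so the
      potential drops by at least 1.\<close>
    have "Suc (sum_list (map node_size (children_list es C c0 nd))) \<le> node_size nd"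
      using size_children_list[of C c0 l al pin v w]
      by (cases l) (simp_all add: ndf length_colorings)
    moreover have "drop (Suc x) Q' = drop (Suc x) Q @ children_list es C c0 nd"
      using xQ by (simp add: Q'_def)
    ultimately have pot: "Suc (sum_list (map node_size (drop (Suc x) Q'))) \<le>
        sum_list (map node_size (drop x Q))"
      by (simp add: dQ)
    have inp3: "input_ok n es s3"
      by (rule input_ok_same[OF same_except_trans[OF _ se23 subset_refl]]) (use 3 I in auto)
    have ok3: "work_ok L s3" by (rule work_ok_same[OF se23]) (use 3 in auto)
    have "build_inv P B s3"
      unfolding build_inv_def Q3 qn3
    proof (intro conjI allI impI, goal_cases)
      case 1 show ?case by (rule inp3)
    next
      case 2 show ?case by (rule ok3)
    next
      case (3 i) then show ?case using \<open>nums s2 = _ \<and> _\<close> by (simp add: s3_def)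
    next
      case 4 show ?case using xQ by (simp add: s3_def Q'_def)
    next
      case 5 show ?case by (simp add: s3_def)
    next
      case 6 show ?case using \<open>nums s2 = _ \<and> _\<close> by (simp add: s3_def c0_def)
    next
      case 7 show ?case using prod_old[of 0] I by (simp add: c0_def)
    next
      case 8 show ?case using \<open>nums s2 = _ \<and> _\<close> I by (simp add: s3_def c0_def)
    next
      case (9 c) then show ?case using \<open>nums s2 = _ \<and> _\<close> I by (simp add: s3_def c0_def)
    next
      case (10 y i) then show ?case using entries[of y i] by (simp add: s3_def)
    next
      case (11 y i) then show ?case using entries[of y i] by (simp add: s3_def)
    next
      case (12 z) then show ?case using cells by blast
    next
      case (13 z) then show ?case using cells[of z] \<open>nums s2 = _ \<and> _\<close> by (simp add: s3_def)
    next
      case 14 show ?case using pot I by (simp add: s3_def)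
    qed
    moreover have "sum_list (map node_size (drop (nats s3 XI 0) (queue L s3))) <
        sum_list (map node_size (drop (nats s XI 0) (queue L s)))"
      unfolding Q3 x3 Q_def[symmetric] x_def[symmetric] using pot by simp
    ultimately show ?case by (intro runs_straight) (simp_all only: s3, simp_all)
  qed
  then have "runs h (expand_node \<Delta> k) s (10 + ((?T + 1) + 20))
    (\<lambda>s'. build_inv P B s' \<and> sum_list (map node_size (drop (nats s' XI 0) (queue L s'))) <
      sum_list (map node_size (drop (nats s XI 0) (queue L s))))"
    unfolding expand_node_def
    by (intro runs_seq[OF runs_NAssign[where Q = "\<lambda>s'. s' = s1"]]) (simp_all add: s1_def x_def)
  then show ?thesis by (rule runs_mono) (linarith, blast)
qed

lemma runs_build:
  assumes "build_inv P B s" "nats s XI 0 = 0"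
  shows "runs h (build \<Delta> k) s ((B + 1) * (K * ((3 * \<Delta> + 5 * k + 800) * ((L + 1) * (L + 1))) + 60))
    (\<lambda>s'. build_inv P B s' \<and> nats s' XI 0 = nats s' QN 0)"
  unfolding build_def
proof (rule runs_while[where I = "build_inv P B" and \<Phi> = "\<lambda>s. sum_list (map node_size (drop (nats s XI 0) (queue L s)))"
    and T = "K * ((3 * \<Delta> + 5 * k + 800) * ((L + 1) * (L + 1))) + 50"])
  show "build_inv P B s" by fact
  have "sum_list (map node_size (drop (nats s XI 0) (queue L s))) \<le> B"
    using assms by (simp add: build_inv_def)
  then show "(sum_list (map node_size (drop (nats s XI 0) (queue L s))) + 1) *
      (K * ((3 * \<Delta> + 5 * k + 800) * ((L + 1) * (L + 1))) + 50 + bcost (NLess (NVar XI) (NVar QN)) + 1) \<le>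
      (B + 1) * (K * ((3 * \<Delta> + 5 * k + 800) * ((L + 1) * (L + 1))) + 60)"
    by (intro mult_mono) auto
next
  fix s assume "build_inv P B s" "\<not> bval h (NLess (NVar XI) (NVar QN)) s"
  then show "build_inv P B s \<and> nats s XI 0 = nats s QN 0" by (auto simp: build_inv_def)
next
  fix s assume "build_inv P B s" "bval h (NLess (NVar XI) (NVar QN)) s"
  then show "runs h (expand_node \<Delta> k) s (K * ((3 * \<Delta> + 5 * k + 800) * ((L + 1) * (L + 1))) + 50)
     (\<lambda>s'. build_inv P B s' \<and>
       sum_list (map node_size (drop (nats s' XI 0) (queue L s'))) <
       sum_list (map node_size (drop (nats s XI 0) (queue L s))))"
    by (intro runs_expand_node) auto
qed

end

section \<open>Evaluating the computation tree\<close>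

abbreviation (input) "CVar A \<equiv> CGet A (NConst 0)"
abbreviation (input) "CSet A \<equiv> CAssign A (NConst 0)"
abbreviation (input) "NUM \<equiv> 4 :: nat"
abbreviation (input) "DEN \<equiv> 5 :: nat"

text \<open>\<open>CP\<close> runs downwards through the cells and passes from the block of one node
  to that of its predecessor, so no cell index needs a multiplication.\<close>

definition accumulate :: com where
  "accumulate = Seq (NSet CP (NSub (NVar CP) (NConst 1)))
     (Seq (CSet NUM (CAdd (CVar NUM) (CMul (CGet 2 (NVar CP)) (CGet 1 (NVar CP)))))
       (CSet DEN (CAdd (CVar DEN) (CGet 1 (NVar CP)))))"

definition update_cell :: com where
  "update_cell = CAssign 1 (NGet NDW (NVar XI))
     (CMul (CGet 1 (NGet NDW (NVar XI))) (CAdd COne (CDiv (CVar NUM) (CVar DEN))))"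

definition evaluate_node :: "nat \<Rightarrow> com" where
  "evaluate_node K = Seq (Seq (NSet XI (NSub (NVar XI) (NConst 1)))
       (Seq (CSet NUM (CSub COne COne)) (CSet DEN (CSub COne COne))))
     (Seq (seq_list (replicate K accumulate)) update_cell)"

definition evaluate :: "nat \<Rightarrow> com" where
  "evaluate K = While (NLess (NConst 0) (NVar XI)) (evaluate_node K)"

lemma runs_accumulate:
  assumes "nats s CP 0 = c + j"
  shows "runs h (seq_list (replicate j accumulate)) s (40 * j + 1) (\<lambda>s'.
    nats s' = (nats s)(CP := (nats s CP)(0 := c)) \<and> nums s' 1 = nums s 1 \<and> nums s' 2 = nums s 2 \<and>
    nums s' NUM 0 = nums s NUM 0 + (\<Sum>i<j. nums s 2 (c + i) * nums s 1 (c + i)) \<and>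
    nums s' DEN 0 = nums s DEN 0 + (\<Sum>i<j. nums s 1 (c + i)))"
  using assms
proof (induction j arbitrary: s)
  case 0
  then show ?case by (auto intro!: runs_Skip simp: fun_eq_iff)
next
  case (Suc j)
  have T: "40 * Suc j + 1 = 40 + (40 * j + 1)" by simp
  define s1 where "s1 = run_straight h accumulate s"
  have s1: "nats s1 = (nats s)(CP := (nats s CP)(0 := c + j))" "nums s1 1 = nums s 1" "nums s1 2 = nums s 2"
    "nums s1 NUM 0 = nums s NUM 0 + nums s 2 (c + j) * nums s 1 (c + j)"
    "nums s1 DEN 0 = nums s DEN 0 + nums s 1 (c + j)"
    using Suc.prems by (simp_all add: s1_def accumulate_def)
  have "runs h accumulate s 40 (\<lambda>s'. s' = s1)"
    by (rule runs_straight) (simp_all add: s1_def, simp_all add: accumulate_def)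
  then show ?case unfolding T replicate_Suc seq_list.simps
  proof (rule runs_seq)
    fix s' assume "s' = s1"
    have "nats s1 CP 0 = c + j" by (simp add: s1)
    from Suc.IH[OF this] show "runs h (seq_list (replicate j accumulate)) s' (40 * j + 1) (\<lambda>s'.
      nats s' = (nats s)(CP := (nats s CP)(0 := c)) \<and> nums s' 1 = nums s 1 \<and> nums s' 2 = nums s 2 \<and>
      nums s' NUM 0 = nums s NUM 0 + (\<Sum>i<Suc j. nums s 2 (c + i) * nums s 1 (c + i)) \<and>
      nums s' DEN 0 = nums s DEN 0 + (\<Sum>i<Suc j. nums s 1 (c + i)))"
      unfolding \<open>s' = s1\<close> by (rule runs_mono) (simp_all add: s1 del: One_nat_def, simp add: fun_eq_iff)
  qed
qed

context edge_model
begin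

text \<open>The nodes from position \<open>XI\<close> on are evaluated, and each cell below 1 + XI K
  holds exactly their contributions. Here \<open>P\<close> is the initial content of cell 0; in
  \<open>build_inv\<close> the same letter stands for the product over the roots.\<close>

definition eval_inv :: "complex \<Rightarrow> node list \<Rightarrow> memory \<Rightarrow> bool" where
  "eval_inv P Q s \<longleftrightarrow> nats s XI 0 \<le> length Q \<and> queue L s = Q \<and>
     nats s CP 0 = 1 + nats s XI 0 * K \<and>
     (\<forall>y<nats s XI 0. \<forall>i<K. nums s 2 (1 + y * K + i) = node_deviation k es h (Q ! y) (C ! i)) \<and>
     (\<forall>c<1 + nats s XI 0 * K. nums s 1 c =
        (if c = 0 then P else 1) * cell_product (drop (nats s XI 0) Q) c)"

lemma sum_colorings: "(\<Sum>i<K. F (C ! i)) = (\<Sum>a\<leftarrow>C. F a)"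
  by (simp add: sum_list_sum_nth length_colorings atLeast0LessThan)

lemma runs_evaluate_node:
  assumes inv: "eval_inv P Q s" and pos: "0 < nats s XI 0"
    and cells: "\<And>z. z < length Q \<Longrightarrow> cell (Q ! z) \<le> z * K"
    and prods: "\<And>y i. y < length Q \<Longrightarrow> i < K \<Longrightarrow> cell_product Q (1 + y * K + i) = node_weight (Q ! y) (C ! i)"
  shows "runs h (evaluate_node K) s (40 * K + 60) (\<lambda>s'. eval_inv P Q s' \<and> nats s' XI 0 < nats s XI 0)"
proof -
  obtain x where x: "nats s XI 0 = Suc x" using pos gr0_implies_Suc by blast
  define c where "c = 1 + x * K"
  note I = inv[unfolded eval_inv_def x]
  have xQ: "x < length Q" using I by simp
  define s1 where "s1 = write_num DEN 0 0 (write_num NUM 0 0 (write_nat XI 0 x s))"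
  have cp1: "nats s1 CP 0 = c + K" using I by (simp add: s1_def c_def)
  have w: "nums s 1 (c + i) = node_weight (Q ! x) (C ! i)" if "i < K" for i
  proof -
    \<comment> \<open>Nodes up to position \<open>x\<close> feed cells of index at most x K, so the
      cells of \<open>x\<close> are already complete.\<close>
    have "cell_product (take (Suc x) Q) (c + i) = 1"
    proof (rule cell_product_none)
      fix nd assume "nd \<in> set (take (Suc x) Q)"
      then obtain z where z: "z < Suc x" "z < length Q" "nd = Q ! z"
        by (auto simp: in_set_conv_nth)
      have "z * K \<le> x * K" using z by (intro mult_right_mono) auto
      then show "cell nd \<noteq> c + i" using cells[OF z(2)] unfolding z(3) c_def by linarith
    qed
    then have "cell_product (drop (Suc x) Q) (c + i) = cell_product Q (c + i)"
      using cell_product_append[of "take (Suc x) Q" "drop (Suc x) Q" "c + i"] by simp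
    then show ?thesis using I prods[OF xQ that] that by (simp add: c_def)
  qed
  have f: "nums s 2 (c + i) = node_deviation k es h (Q ! x) (C ! i)" if "i < K" for i
    using I that by (simp add: c_def)
  have val: "1 + (\<Sum>i<K. nums s 2 (c + i) * nums s 1 (c + i)) / (\<Sum>i<K. nums s 1 (c + i)) =
      node_value (Q ! x)"
  proof -
    have "(\<Sum>i<K. nums s 2 (c + i) * nums s 1 (c + i)) =
        (\<Sum>i<K. node_deviation k es h (Q ! x) (C ! i) * node_weight (Q ! x) (C ! i))"
      by (intro sum.cong refl arg_cong2[where f = times]) (simp_all add: w f del: One_nat_def)
    moreover have "(\<Sum>i<K. nums s 1 (c + i)) = (\<Sum>i<K. node_weight (Q ! x) (C ! i))"
      by (intro sum.cong) (simp_all add: w del: One_nat_def)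
    ultimately show ?thesis
      unfolding node_value_mean mean_ratio_def
      using sum_colorings[of "\<lambda>a. node_deviation k es h (Q ! x) a * node_weight (Q ! x) a"]
        sum_colorings[of "node_weight (Q ! x)"] by simp
  qed
  have main: "runs h (Seq (seq_list (replicate K accumulate)) update_cell) s1 ((40 * K + 1) + 30)
    (\<lambda>s'. eval_inv P Q s' \<and> nats s' XI 0 < nats s XI 0)"
  proof (rule runs_seq[OF runs_accumulate[OF cp1]], goal_cases)
    case (1 s2)
    define u where "u = cell (Q ! x)"
    have u: "u < c" using cells[OF xQ] by (simp add: u_def c_def)
    define s3 where "s3 = write_num 1 u (nums s 1 u * node_value (Q ! x)) s2"
    have se: "same_except {XI, CP} s s3" using 1 by (simp add: same_except_def s3_def s1_def)
    have q3: "queue L s3 = Q" using queue_same[OF se, of L] I by simp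
    have "node_at L s x = Q ! x" using I xQ queue_nth[of x s L] length_queue[of L s] by simp
    then have "nats s NDW x = u" by (simp add: u_def node_at_def flip: \<open>node_at L s x = Q ! x\<close>)
    then have "run_straight h update_cell s2 = s3"
      using 1 val by (simp add: update_cell_def s3_def s1_def)
    moreover have "eval_inv P Q s3"
      unfolding eval_inv_def q3
    proof (intro conjI allI impI, goal_cases)
      case 1 show ?case using se xQ \<open>nats s2 = _ \<and> _\<close> by (simp add: s3_def s1_def)
    next
      case 2 show ?case by simp
    next
      case 3 show ?case using \<open>nats s2 = _ \<and> _\<close> by (simp add: s3_def s1_def c_def)
    next
      case (4 y i)
      then show ?case using \<open>nats s2 = _ \<and> _\<close> I by (simp add: s3_def s1_def)
    next
      case (5 d)
      then have d: "d < c" using \<open>nats s2 = _ \<and> _\<close> by (simp add: s3_def s1_def c_def)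
      then have old: "nums s 1 d = (if d = 0 then P else 1) * cell_product (drop (Suc x) Q) d"
        using I by (simp add: c_def)
      have "cell_product (drop x Q) d = (if u = d then node_value (Q ! x) else 1) * cell_product (drop (Suc x) Q) d"
        using xQ by (simp add: u_def cell_product_Cons Cons_nth_drop_Suc[symmetric])
      then show ?case using \<open>nats s2 = _ \<and> _\<close> old by (cases "u = d") (auto simp: s3_def s1_def)
    qed
    moreover have "nats s3 XI 0 < nats s XI 0" using 1 x by (simp add: s3_def s1_def)
    ultimately show ?case by (intro runs_straight) (simp_all, simp_all add: update_cell_def)
  qed
  have "runs h (evaluate_node K) s (20 + ((40 * K + 1) + 30)) (\<lambda>s'. eval_inv P Q s' \<and> nats s' XI 0 < nats s XI 0)"
    unfolding evaluate_node_def
    by (rule runs_seq[OF runs_straight[where Q = "\<lambda>s'. s' = s1"]])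
      (use main x in \<open>simp_all add: s1_def\<close>)
  then show ?thesis by (rule runs_mono) (linarith, blast)
qed

lemma runs_evaluate:
  assumes "eval_inv P Q s"
    and "\<And>z. z < length Q \<Longrightarrow> cell (Q ! z) \<le> z * K"
    and "\<And>y i. y < length Q \<Longrightarrow> i < K \<Longrightarrow> cell_product Q (1 + y * K + i) = node_weight (Q ! y) (C ! i)"
  shows "runs h (evaluate K) s ((length Q + 1) * (40 * K + 70)) (\<lambda>s'. result s' = P * cell_product Q 0)"
  unfolding evaluate_def
proof (rule runs_while[where I = "eval_inv P Q" and \<Phi> = "\<lambda>s. nats s XI 0" and T = "40 * K + 60"])
  show "(nats s XI 0 + 1) * (40 * K + 60 + bcost (NLess (NConst 0) (NVar XI)) + 1) \<le>
      (length Q + 1) * (40 * K + 70)"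
    using assms(1) unfolding eval_inv_def by (intro mult_mono) auto
next
  fix s assume "eval_inv P Q s" "\<not> bval h (NLess (NConst 0) (NVar XI)) s"
  then show "result s = P * cell_product Q 0" by (simp add: eval_inv_def result_def)
qed (use assms in \<open>auto intro: runs_evaluate_node\<close>)

lemma build_inv_evaluate:
  assumes "build_inv P B s" "nats s XI 0 = nats s QN 0"
  shows "runs h (evaluate K) s ((B + 1) * (40 * K + 70))
    (\<lambda>s'. result s' = of_nat k ^ length es * P)"
proof -
  note I = assms(1)[unfolded build_inv_def assms(2)]
  define Q where "Q = queue L s"
  have len: "length Q = nats s QN 0" by (simp add: Q_def)
  have "eval_inv (of_nat k ^ length es) Q s"
    unfolding eval_inv_def assms(2) using I by (simp add: Q_def cell_product_def)
  then have "runs h (evaluate K) s ((length Q + 1) * (40 * K + 70))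
      (\<lambda>s'. result s' = of_nat k ^ length es * cell_product Q 0)"
    by (rule runs_evaluate) (use I len in \<open>simp_all add: Q_def\<close>)
  moreover have "length Q \<le> B" using I len by simp
  ultimately show ?thesis
    using I by (elim runs_mono) (auto simp: Q_def intro: mult_right_mono)
qed

end

section \<open>Correctness and running time\<close>

abbreviation (input) "ERR \<equiv> 3 :: nat"

text \<open>Natural numbers cannot be converted, so k^|E| and the error bound 4 n are produced as
  complex numbers by counting over edges and vertices.\<close>

definition init_vars :: "nat \<Rightarrow> com" where
  "init_vars k = Seq (Seq (NSet LEN (NAdd (NGet 0 (NConst 0)) (NGet 0 (NConst 1)))) (CSet 1 COne))
     (Seq (for_loop EJ (NGet 0 (NConst 1)) (CSet 1 (CMul (CVar 1) (cnum k))))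
       (for_loop EJ (NGet 0 (NConst 0))
         (Seq (CSet ERR (CAdd (CVar ERR) (cnum 4))) (NAssign ALV (NVar EJ) (NConst 1)))))"

definition choose_depth :: com where
  "choose_depth = While (Neg (Conj (ReLe (CVar ERR) (CVar 0)) (ReLe (CVar ERR) COne)))
     (Seq (CSet ERR (CMul (CVar ERR) (CDiv (cnum 93) (cnum 100)))) (NSet DEP (NAdd (NVar DEP) (NConst 1))))"

text \<open>\<open>CP\<close> is still 0 while the roots are spawned, so they feed cell 0, the
  result; then it moves to the first free cell.\<close>

definition spawn_roots :: com where
  "spawn_roots = Seq (NSet LV (NVar DEP)) (Seq
     (for_loop EJ (NGet 0 (NConst 0)) (spawn (NVar EJ))) (NSet CP (NConst 1)))"

lemma runs_init_vars:
  assumes "nats s 0 0 = n" "nats s 0 1 = m" "\<And>i. nats s ALV i = 0" "nums s ERR 0 = 0"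
  shows "runs h (init_vars k) s ((n + m + 1) * (2 * k + 100)) (\<lambda>s'.
    same_except {LEN, EJ, ALV} s s' \<and> nats s' LEN 0 = n + m \<and>
    nats s' ALV = (\<lambda>i. if i < n then 1 else 0) \<and>
    nums s' 1 0 = of_nat k ^ m \<and> nums s' ERR 0 = of_real (4 * real n) \<and> nums s' 0 = nums s 0)"
proof -
  define s1 where "s1 = write_num 1 0 1 (write_nat LEN 0 (n + m) s)"
  define I where "I j s' \<longleftrightarrow> same_except {LEN, EJ} s s' \<and> nats s' LEN 0 = n + m \<and> nats s' EJ 0 = j \<and>
    nums s' 1 0 = of_nat k ^ j \<and> nums s' ERR 0 = 0 \<and> nums s' 0 = nums s 0" for j s'
  define J where "J j s' \<longleftrightarrow> same_except {LEN, EJ, ALV} s s' \<and> nats s' LEN 0 = n + m \<and> nats s' EJ 0 = j \<and>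
    nats s' ALV = (\<lambda>i. if i < j then 1 else 0) \<and>
    nums s' 1 0 = of_nat k ^ m \<and> nums s' ERR 0 = of_real (4 * real j) \<and> nums s' 0 = nums s 0" for j s'
  have 1: "runs h (for_loop EJ (NGet 0 (NConst 1)) (CSet 1 (CMul (CVar 1) (cnum k)))) s1
      ((m + 1) * (2 * k + 24)) (\<lambda>s'. same_except {LEN, EJ} s s' \<and> nats s' LEN 0 = n + m \<and>
      nums s' 1 0 = of_nat k ^ m \<and> nums s' ERR 0 = 0 \<and> nums s' 0 = nums s 0)"
  proof (rule runs_for[where m = m and T = "2 * k + 10" and I = I])
    fix j s' assume "I j s'"
    then show "runs h (CSet 1 (CMul (CVar 1) (cnum k))) s' (2 * k + 10)
        (\<lambda>s'. nats s' EJ 0 = j \<and> I (Suc j) (write_nat EJ 0 (Suc j) s'))"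
      by (intro runs_CAssign) (auto simp: I_def same_except_def)
  qed (use assms in \<open>auto simp: I_def s1_def same_except_def\<close>)
  have 2: "runs h (for_loop EJ (NGet 0 (NConst 0))
         (Seq (CSet ERR (CAdd (CVar ERR) (cnum 4))) (NAssign ALV (NVar EJ) (NConst 1)))) s2
      ((n + 1) * 44) (\<lambda>s'. same_except {LEN, EJ, ALV} s s' \<and> nats s' LEN 0 = n + m \<and>
    nats s' ALV = (\<lambda>i. if i < n then 1 else 0) \<and>
    nums s' 1 0 = of_nat k ^ m \<and> nums s' ERR 0 = of_real (4 * real n) \<and> nums s' 0 = nums s 0)"
    if "same_except {LEN, EJ} s s2 \<and> nats s2 LEN 0 = n + m \<and>
      nums s2 1 0 = of_nat k ^ m \<and> nums s2 ERR 0 = 0 \<and> nums s2 0 = nums s 0" for s2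
  proof (rule runs_for[where m = n and T = 30 and I = J])
    fix j s' assume "J j s'"
    then show "runs h (Seq (CSet ERR (CAdd (CVar ERR) (cnum 4))) (NAssign ALV (NVar EJ) (NConst 1))) s' 30
        (\<lambda>s'. nats s' EJ 0 = j \<and> J (Suc j) (write_nat EJ 0 (Suc j) s'))"
      by (intro runs_straight) (auto simp: J_def same_except_def fun_eq_iff)
  qed (use assms that in \<open>auto simp: J_def same_except_def fun_eq_iff\<close>)
  have "runs h (init_vars k) s (20 + ((m + 1) * (2 * k + 24) + (n + 1) * 44)) (\<lambda>s'.
    same_except {LEN, EJ, ALV} s s' \<and> nats s' LEN 0 = n + m \<and>
    nats s' ALV = (\<lambda>i. if i < n then 1 else 0) \<and>
    nums s' 1 0 = of_nat k ^ m \<and> nums s' ERR 0 = of_real (4 * real n) \<and> nums s' 0 = nums s 0)"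
    unfolding init_vars_def
  proof (rule runs_seq[OF runs_straight[where Q = "\<lambda>s'. s' = s1"]])
    show "run_straight h (Seq (NSet LEN (NAdd (NGet 0 (NConst 0)) (NGet 0 (NConst 1)))) (CSet 1 COne)) s = s1"
      using assms by (simp add: s1_def)
  next
    fix s' assume "s' = s1"
    then show "runs h (Seq (for_loop EJ (NGet 0 (NConst 1)) (CSet 1 (CMul (CVar 1) (cnum k))))
       (for_loop EJ (NGet 0 (NConst 0))
         (Seq (CSet ERR (CAdd (CVar ERR) (cnum 4))) (NAssign ALV (NVar EJ) (NConst 1))))) s'
      ((m + 1) * (2 * k + 24) + (n + 1) * 44) (\<lambda>s'.
      same_except {LEN, EJ, ALV} s s' \<and> nats s' LEN 0 = n + m \<and>
      nats s' ALV = (\<lambda>i. if i < n then 1 else 0) \<and>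
      nums s' 1 0 = of_nat k ^ m \<and> nums s' ERR 0 = of_real (4 * real n) \<and> nums s' 0 = nums s 0)"
      by (simp only:) (rule runs_seq[OF 1 2])
  qed simp_all
  then show ?thesis by (rule runs_mono) (auto simp: algebra_simps)
qed

text \<open>The loop stops at the first sufficient depth, hence no later than any given sufficient
  \<open>D\<close>.\<close>

lemma runs_choose_depth:
  fixes e \<epsilon> :: real
  assumes "nums s ERR 0 = of_real e" "nums s 0 0 = of_real \<epsilon>" "nats s DEP 0 = 0"
    and D: "e * 0.93 ^ D \<le> min 1 \<epsilon>"
  shows "runs h choose_depth s ((D + 1) * 500) (\<lambda>s'. \<exists>d\<le>D. e * 0.93 ^ d \<le> min 1 \<epsilon> \<and>
    nats s' = (nats s)(DEP := (nats s DEP)(0 := d)) \<and> nums s' 1 = nums s 1)"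
  unfolding choose_depth_def
proof (rule runs_while[where \<Phi> = "\<lambda>s. D - nats s DEP 0" and T = 450 and I = "\<lambda>s'. nats s' DEP 0 \<le> D \<and>
    nats s' = (nats s)(DEP := (nats s DEP)(0 := nats s' DEP 0)) \<and> nums s' 1 = nums s 1 \<and>
    nums s' 0 = nums s 0 \<and> nums s' ERR 0 = of_real (e * 0.93 ^ nats s' DEP 0)"])
  show "nats s DEP 0 \<le> D \<and> nats s = (nats s)(DEP := (nats s DEP)(0 := nats s DEP 0)) \<and> nums s 1 = nums s 1 \<and>
    nums s 0 = nums s 0 \<and> nums s ERR 0 = of_real (e * 0.93 ^ nats s DEP 0)"
    using assms by (simp add: fun_eq_iff)
next
  fix s' :: memory assume I: "nats s' DEP 0 \<le> D \<and>
    nats s' = (nats s)(DEP := (nats s DEP)(0 := nats s' DEP 0)) \<and> nums s' 1 = nums s 1 \<and>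
    nums s' 0 = nums s 0 \<and> nums s' ERR 0 = of_real (e * 0.93 ^ nats s' DEP 0)"
  define d where "d = nats s' DEP 0"
  have err: "nums s' ERR 0 = of_real (e * 0.93 ^ d)" "nums s' 0 0 = of_real \<epsilon>"
    using I assms by (simp_all add: d_def)
  have nI: "nats s' = (nats s)(DEP := (nats s DEP)(0 := d))" using I unfolding d_def by blast
  {
    assume "\<not> bval h (Neg (Conj (ReLe (CVar ERR) (CVar 0)) (ReLe (CVar ERR) COne))) s'"
    then have "e * 0.93 ^ d \<le> min 1 \<epsilon>" using err by simp
    then show "\<exists>d\<le>D. e * 0.93 ^ d \<le> min 1 \<epsilon> \<and>
      nats s' = (nats s)(DEP := (nats s DEP)(0 := d)) \<and> nums s' 1 = nums s 1"
      using I unfolding d_def by blast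
  next
    assume "bval h (Neg (Conj (ReLe (CVar ERR) (CVar 0)) (ReLe (CVar ERR) COne))) s'"
    then have "\<not> e * 0.93 ^ d \<le> min 1 \<epsilon>" using err by auto
    then have "d \<noteq> D" using D by auto
    then have dD: "d < D" using I by (simp add: d_def)
    define s2 where "s2 = write_nat DEP 0 (Suc d) (write_num ERR 0 (of_real (e * 0.93 ^ Suc d)) s')"
    have step: "complex_of_real (e * 0.93 ^ Suc d) = of_real (e * 0.93 ^ d) * (93 / 100)" by simp
    have "run_straight h (Seq (CSet ERR (CMul (CVar ERR) (CDiv (cnum 93) (cnum 100))))
        (NSet DEP (NAdd (NVar DEP) (NConst 1)))) s' = s2"
      unfolding s2_def step by (simp add: err(1) d_def)
    moreover have "nats s2 = (nats s)(DEP := (nats s DEP)(0 := Suc d))"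
      unfolding s2_def write_simps nI by (simp add: fun_eq_iff)
    moreover have "nums s2 1 = nums s 1" "nums s2 0 = nums s 0" "nums s2 ERR 0 = of_real (e * 0.93 ^ Suc d)"
      using I by (simp_all add: s2_def)
    ultimately show "runs h (Seq (CSet ERR (CMul (CVar ERR) (CDiv (cnum 93) (cnum 100))))
        (NSet DEP (NAdd (NVar DEP) (NConst 1)))) s' 450
      (\<lambda>s''. (nats s'' DEP 0 \<le> D \<and>
        nats s'' = (nats s)(DEP := (nats s DEP)(0 := nats s'' DEP 0)) \<and> nums s'' 1 = nums s 1 \<and>
        nums s'' 0 = nums s 0 \<and> nums s'' ERR 0 = of_real (e * 0.93 ^ nats s'' DEP 0)) \<and>
        D - nats s'' DEP 0 < D - nats s' DEP 0)"
      using dD by (intro runs_straight) (simp_all only:, simp_all add: d_def[symmetric])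
  }
qed (use assms in simp)

lemma initial_memory_arrays:
  "A > 2 \<Longrightarrow> nats (initial_memory n es \<epsilon>) A = (\<lambda>_. 0)"
  "A \<noteq> 0 \<Longrightarrow> nums (initial_memory n es \<epsilon>) A = (\<lambda>_. 0)"
  "nats (initial_memory n es \<epsilon>) 0 0 = n" "nats (initial_memory n es \<epsilon>) 0 1 = length es"
  "nums (initial_memory n es \<epsilon>) 0 0 = of_real \<epsilon>"
  "j < length es \<Longrightarrow> nats (initial_memory n es \<epsilon>) 1 j = fst (es ! j)"
  "j < length es \<Longrightarrow> nats (initial_memory n es \<epsilon>) 2 j = snd (es ! j)"
  by (auto simp: initial_memory_def fun_eq_iff)

definition algorithm :: "nat \<Rightarrow> nat \<Rightarrow> com" where
  "algorithm \<Delta> k = Seq (init_vars k) (Seq choose_depth (Seq spawn_roots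
     (Seq (build \<Delta> k) (evaluate (k ^ \<Delta>)))))"

context edge_model
begin

definition roots :: "nat \<Rightarrow> node list" where
  "roots D = map (\<lambda>(u, al). (D, al, \<lambda>_. 0, u, 0)) (kids (\<lambda>i. if i < n then 1 else 0) [0..<n])"

lemma runs_spawn_roots:
  assumes inp: "input_ok n es s" and ok: "work_ok L s" and zero: "nats s QN 0 = 0" "nats s CP 0 = 0"
    "nats s PIN = (\<lambda>_. 0)" and al: "nats s ALV = (\<lambda>i. if i < n then 1 else 0)"
  shows "runs h spawn_roots s (120 * ((L + 1) * (L + 1))) (\<lambda>s'. nums s' = nums s \<and>
    same_except ({LV, CP, EJ} \<union> spawn_vars) s s' \<and> work_ok L s' \<and> nats s' CP 0 = 1 \<and>
    queue L s' = roots (nats s DEP 0))"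
proof -
  define D where "D = nats s DEP 0"
  define s1 where "s1 = write_nat LV 0 D s"
  define T where "T = (L + 1) * 40 + 50"
  define I where "I j s' \<longleftrightarrow> nums s' = nums s \<and> same_except ({LV, EJ} \<union> spawn_vars) s s' \<and>
    work_ok L s' \<and> nats s' EJ 0 = j \<and> pending L s' [j..<n] = roots D" for j s'
  have inpI: "input_ok n es s'" if "I j s'" for j s'
    by (rule input_ok_same[OF _ _ inp]) (use that in \<open>auto simp: I_def\<close>)
  have loop: "runs h (for_loop EJ (NGet 0 (NConst 0)) (spawn (NVar EJ))) s1 ((n + 1) * (T + 14)) (I n)"
  proof (rule runs_for[where m = n and T = T and I = I])
    have se: "same_except {LV, EJ} s (write_nat EJ 0 0 s1)" by (simp add: s1_def same_except_def)
    have "queue L (write_nat EJ 0 0 s1) = []" using queue_same[OF se, of L] zero by (simp add: queue_def)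
    then have "pending L (write_nat EJ 0 0 s1) [0..<n] = roots D"
      using zero al by (simp add: pending_def roots_def s1_def)
    moreover have "work_ok L (write_nat EJ 0 0 s1)" by (rule work_ok_same[OF se _ ok]) simp
    ultimately show "I 0 (write_nat EJ 0 0 s1)" by (simp add: I_def s1_def same_except_def)
  next
    fix j s' assume "I j s'"
    then show "nats s' EJ 0 = j \<and> nval (NGet 0 (NConst 0)) s' = n"
      using inpI[of j s'] by (simp add: I_def input_ok_def)
  next
    fix j s' assume j: "j < n" and I: "I j s'"
    have up: "[j..<n] = j # [Suc j..<n]" using j by (simp add: upt_conv_Cons)
    have ej: "nval (NVar EJ) s' = j" using I by (simp add: I_def)
    have len: "nats s' LEN 0 = L" using inpI[OF I] by (simp add: input_ok_def)
    have "runs h (spawn (NVar EJ)) s' T (\<lambda>s''. nums s'' = nums s' \<and> same_except spawn_vars s' s'' \<and>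
        work_ok L s'' \<and> (\<forall>us. pending L s'' us = pending L s' (nval (NVar EJ) s' # us)))"
      unfolding T_def
    proof (rule runs_spawn[OF len])
      show "nval (NVar EJ) s'' = nval (NVar EJ) s'" if "same_except spawn_vars s' s''" for s''
        using same_exceptD[OF that, of EJ] by simp
    qed (use I in \<open>auto simp: I_def\<close>)
    then show "runs h (spawn (NVar EJ)) s' T (\<lambda>s'. nats s' EJ 0 = j \<and> I (Suc j) (write_nat EJ 0 (Suc j) s'))"
    proof (rule runs_mono[OF _ order_refl], goal_cases)
      case (1 s2)
      have se: "same_except {EJ} s2 (write_nat EJ 0 (Suc j) s2)" by (simp add: same_except_def)
      have "same_except ({LV, EJ} \<union> spawn_vars) s (write_nat EJ 0 (Suc j) s2)"
        using I 1 by (simp add: I_def same_except_def)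
      moreover have "work_ok L (write_nat EJ 0 (Suc j) s2)" by (rule work_ok_same[OF se]) (use 1 in auto)
      moreover have "pending L (write_nat EJ 0 (Suc j) s2) [Suc j..<n] = roots D"
        using pending_same[OF se, of L "[Suc j..<n]"] 1 I up ej by (simp add: I_def)
      moreover have "nats s2 EJ 0 = j" using 1 I by (simp add: I_def same_except_def)
      ultimately show ?case using 1 I by (simp add: I_def)
    qed
  qed simp_all
  have "runs h spawn_roots s (4 + ((n + 1) * (T + 14) + 3)) (\<lambda>s'. nums s' = nums s \<and>
    same_except ({LV, CP, EJ} \<union> spawn_vars) s s' \<and> work_ok L s' \<and> nats s' CP 0 = 1 \<and> queue L s' = roots D)"
    unfolding spawn_roots_def
  proof (rule runs_seq[OF runs_NAssign[where Q = "\<lambda>s'. s' = s1"]])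
    fix s' assume "s' = s1"
    with loop have "runs h (for_loop EJ (NGet 0 (NConst 0)) (spawn (NVar EJ))) s' ((n + 1) * (T + 14)) (I n)" by simp
    then show "runs h (Seq (for_loop EJ (NGet 0 (NConst 0)) (spawn (NVar EJ))) (NSet CP (NConst 1))) s'
      ((n + 1) * (T + 14) + 3) (\<lambda>s'. nums s' = nums s \<and>
      same_except ({LV, CP, EJ} \<union> spawn_vars) s s' \<and> work_ok L s' \<and> nats s' CP 0 = 1 \<and> queue L s' = roots D)"
    proof (rule runs_seq, goal_cases)
      case (1 s2)
      have se: "same_except {CP} s2 (write_nat CP 0 1 s2)" by (simp add: same_except_def)
      have "same_except ({LV, CP, EJ} \<union> spawn_vars) s (write_nat CP 0 1 s2)"
        using 1 by (simp add: I_def same_except_def)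
      moreover have "work_ok L (write_nat CP 0 1 s2)" by (rule work_ok_same[OF se]) (use 1 in \<open>auto simp: I_def\<close>)
      moreover have "queue L (write_nat CP 0 1 s2) = roots D"
        using queue_same[OF se, of L] 1 by (simp add: I_def pending_def)
      ultimately show ?case using 1 by (intro runs_NAssign) (simp_all add: I_def)
    qed
  qed (simp_all add: s1_def D_def)
  then show ?thesis unfolding D_def
  proof (rule runs_mono)
    have "(n + 1) * (T + 14) \<le> (L + 1) * (110 * (L + 1))"
      by (rule mult_mono) (auto simp: T_def)
    moreover have "7 \<le> 10 * ((L + 1) * (L + 1))" by simp
    ultimately show "4 + ((n + 1) * (T + 14) + 3) \<le> 120 * ((L + 1) * (L + 1))"
      by (simp only: mult.left_commute[of _ 110])
  qed
qed

text \<open>The base has summand 2 instead of 1 to absorb the node itself.\<close>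

lemma tree_size_le: "tree_size l \<le> (2 + K * (2 * \<Delta>)) ^ l"
proof (induction l)
  case (Suc l)
  let ?G = "2 + K * (2 * \<Delta>)"
  have "tree_size (Suc l) \<le> ?G ^ l + K * (2 * \<Delta>) * ?G ^ l"
    unfolding tree_size.simps by (intro add_mono mult_le_mono2 Suc one_le_power) simp
  also have "\<dots> \<le> ?G ^ Suc l" by (simp add: algebra_simps)
  finally show ?case .
qed simp

lemma build_inv_roots:
  assumes inp: "input_ok n es s" and ok: "work_ok L s" and q: "queue L s = roots d"
    and zero: "nats s XI 0 = 0" "nats s XB 0 = 0" "nats s CP 0 = 1" "nats s AC = (\<lambda>_. 0)"
    and num: "nums s 1 0 = of_nat k ^ length es"
  shows "build_inv (cell_product (roots d) 0) (n * tree_size d) s"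
proof -
  have "cell (roots d ! z) = 0" if "z < length (roots d)" for z
    using that by (simp add: roots_def case_prod_unfold)
  moreover have "length (roots d) = nats s QN 0" using q length_queue[of L s] by simp
  moreover have "sum_list (map node_size (roots d)) = length (roots d) * tree_size d"
    by (simp add: roots_def comp_def case_prod_unfold sum_list_triv)
  moreover have "length (roots d) \<le> n"
    using length_kids_le[of "\<lambda>i. if i < n then 1 else 0" "[0..<n]"] by (simp add: roots_def)
  ultimately show ?thesis
    using assms by (simp add: build_inv_def)
qed

lemma cell_product_roots:
  "of_nat k ^ length es * cell_product (roots d) 0 = approx_output d"
  by (simp add: cell_product_def roots_def approx_output_def filter_map comp_def case_prod_unfold)

lemma runs_algorithm:
  assumes D: "4 * real n * 0.93 ^ D \<le> min 1 \<epsilon>" and B: "B = n * (2 + K * (2 * \<Delta>)) ^ D"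
  shows "runs h (algorithm \<Delta> k) (initial_memory n es \<epsilon>)
    ((L + 1) * (2 * k + 100) + ((D + 1) * 500 + (120 * ((L + 1) * (L + 1)) +
      ((B + 1) * (K * ((3 * \<Delta> + 5 * k + 800) * ((L + 1) * (L + 1))) + 60) + (B + 1) * (40 * K + 70)))))
    (\<lambda>s'. multiplicative_approx \<epsilon> (Z {..<n} (\<lambda>_. 0)) (result s'))"
  unfolding algorithm_def
proof (rule runs_seq[OF runs_init_vars[where n = n and m = "length es"]])
  define s0 where "s0 = initial_memory n es \<epsilon>"
  note init = initial_memory_arrays[where n = n and es = es and \<epsilon> = \<epsilon>, folded s0_def]
  fix s1 :: memory
  assume "same_except {LEN, EJ, ALV} (initial_memory n es \<epsilon>) s1 \<and> nats s1 LEN 0 = L \<and>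
    nats s1 ALV = (\<lambda>i. if i < n then 1 else 0) \<and>
    nums s1 1 0 = of_nat k ^ length es \<and> nums s1 ERR 0 = of_real (4 * real n) \<and>
    nums s1 0 = nums (initial_memory n es \<epsilon>) 0"
  then have s1: "same_except {LEN, EJ, ALV} s0 s1" "nats s1 LEN 0 = L"
    "nats s1 ALV = (\<lambda>i. if i < n then 1 else 0)" "nums s1 1 0 = of_nat k ^ length es"
    "nums s1 ERR 0 = of_real (4 * real n)" "nums s1 0 0 = of_real \<epsilon>"
    using init(5) by (simp_all add: s0_def)
  have zero1: "nats s1 A = (\<lambda>_. 0)" if "A > 2" "A \<notin> {LEN, EJ, ALV}" for A
    using same_exceptD[OF s1(1) that(2)] init(1)[OF that(1)] by simp
  show "runs h (Seq choose_depth (Seq spawn_roots (Seq (build \<Delta> k) (evaluate K)))) s1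
    ((D + 1) * 500 + (120 * ((L + 1) * (L + 1)) +
      ((B + 1) * (K * ((3 * \<Delta> + 5 * k + 800) * ((L + 1) * (L + 1))) + 60) + (B + 1) * (40 * K + 70))))
    (\<lambda>s'. multiplicative_approx \<epsilon> (Z {..<n} (\<lambda>_. 0)) (result s'))"
  proof (rule runs_seq[OF runs_choose_depth[OF s1(5,6) _ D]])
    show "nats s1 DEP 0 = 0" by (simp add: zero1)
    fix s2 :: memory
    assume "\<exists>d\<le>D. 4 * real n * 0.93 ^ d \<le> min 1 \<epsilon> \<and>
      nats s2 = (nats s1)(DEP := (nats s1 DEP)(0 := d)) \<and> nums s2 1 = nums s1 1"
    then obtain d where d: "d \<le> D" "4 * real n * 0.93 ^ d \<le> min 1 \<epsilon>"
      and s2: "nats s2 = (nats s1)(DEP := (nats s1 DEP)(0 := d))" "nums s2 1 = nums s1 1"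
      by blast
    have inp1: "nats s1 0 = nats s0 0" "nats s1 1 = nats s0 1" "nats s1 2 = nats s0 2"
      using s1(1) by (simp_all add: same_except_def)
    have inp2: "input_ok n es s2"
      unfolding input_ok_def using inp1 init(3,4,6,7) s1(2) by (simp add: s2)
    have ok2: "work_ok L s2" unfolding work_ok_def using zero1 s1(3) by (simp add: s2)
    show "runs h (Seq spawn_roots (Seq (build \<Delta> k) (evaluate K))) s2
      (120 * ((L + 1) * (L + 1)) +
      ((B + 1) * (K * ((3 * \<Delta> + 5 * k + 800) * ((L + 1) * (L + 1))) + 60) + (B + 1) * (40 * K + 70)))
      (\<lambda>s'. multiplicative_approx \<epsilon> (Z {..<n} (\<lambda>_. 0)) (result s'))"
    proof (rule runs_seq[OF runs_spawn_roots[OF inp2 ok2]])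
      show "nats s2 QN 0 = 0" "nats s2 CP 0 = 0" "nats s2 PIN = (\<lambda>_. 0)"
        "nats s2 ALV = (\<lambda>i. if i < n then 1 else 0)"
        using zero1 s1(3) by (simp_all add: s2)
      fix s3 :: memory
      assume s3: "nums s3 = nums s2 \<and> same_except ({LV, CP, EJ} \<union> spawn_vars) s2 s3 \<and>
        work_ok L s3 \<and> nats s3 CP 0 = 1 \<and> queue L s3 = roots (nats s2 DEP 0)"
      have zero3: "nats s3 XI 0 = 0" "nats s3 XB 0 = 0" "nats s3 AC = (\<lambda>_. 0)"
        using s3 zero1 by (simp_all add: same_except_def s2)
      have inp3: "input_ok n es s3" by (rule input_ok_same[OF _ _ inp2]) (use s3 in auto)
      define P where "P = cell_product (roots d) 0"
      have "build_inv P (n * tree_size d) s3"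
        unfolding P_def using s3 inp3 zero3 s1(4) by (intro build_inv_roots) (simp_all add: s2 del: One_nat_def)
      moreover have "n * tree_size d \<le> B"
      proof -
        have "tree_size d \<le> (2 + K * (2 * \<Delta>)) ^ d" by (rule tree_size_le)
        also have "\<dots> \<le> (2 + K * (2 * \<Delta>)) ^ D" using d by (intro power_increasing) auto
        finally show ?thesis unfolding B by (rule mult_left_mono) simp
      qed
      ultimately have inv3: "build_inv P B s3" unfolding build_inv_def by (auto intro: order_trans)
      show "runs h (Seq (build \<Delta> k) (evaluate K)) s3
        ((B + 1) * (K * ((3 * \<Delta> + 5 * k + 800) * ((L + 1) * (L + 1))) + 60) + (B + 1) * (40 * K + 70))
        (\<lambda>s'. multiplicative_approx \<epsilon> (Z {..<n} (\<lambda>_. 0)) (result s'))"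
      proof (rule runs_seq[OF runs_build[OF inv3 zero3(1)]])
        fix s4 :: memory assume s4: "build_inv P B s4 \<and> nats s4 XI 0 = nats s4 QN 0"
        have "runs h (evaluate K) s4 ((B + 1) * (40 * K + 70)) (\<lambda>s'. result s' = of_nat k ^ length es * P)"
          using s4 by (intro build_inv_evaluate) auto
        then show "runs h (evaluate K) s4 ((B + 1) * (40 * K + 70))
          (\<lambda>s'. multiplicative_approx \<epsilon> (Z {..<n} (\<lambda>_. 0)) (result s'))"
        proof (rule runs_mono[OF _ order_refl])
          fix s' assume "result s' = of_nat k ^ length es * P"
          then have "result s' = approx_output d" by (simp add: P_def cell_product_roots)
          then show "multiplicative_approx \<epsilon> (Z {..<n} (\<lambda>_. 0)) (result s')"
            using approx_output_correct d(2) by simp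
        qed
      qed
    qed
  qed
qed (simp_all add: initial_memory_arrays del: One_nat_def)

end

text \<open>Minimality of \<open>D\<close> bounds (1/0.93)^(D-1) by 4 n / min 1 \<epsilon>. The
  branching base is at most a fixed power of 1/0.93, so the exponential size of the tree is
  polynomial in that quantity. As the base of the bound is at least 2, constant factors go into the
  exponent.\<close>

lemma time_polynomial:
  fixes \<Delta> k :: nat
  defines "K \<equiv> k ^ \<Delta>"
  shows "\<exists>E. \<forall>n L D B :: nat. \<forall>\<epsilon> > 0 :: real. L \<le> n * (1 + \<Delta>) \<longrightarrow>
    D = 0 \<or> min 1 \<epsilon> < 4 * real n * 0.93 ^ (D - 1) \<longrightarrow> B = n * (2 + K * (2 * \<Delta>)) ^ D \<longrightarrow>
    real ((L + 1) * (2 * k + 100) + ((D + 1) * 500 + (120 * ((L + 1) * (L + 1)) +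
      ((B + 1) * (K * ((3 * \<Delta> + 5 * k + 800) * ((L + 1) * (L + 1))) + 60) + (B + 1) * (40 * K + 70)))))
    \<le> (2 + real n / min 1 \<epsilon>) ^ E"
proof -
  define G where "G = 2 + K * (2 * \<Delta>)"
  define A where "A = K * (3 * \<Delta> + 5 * k + 800)"
  \<comment> \<open>Collects the coefficients of the time bound; 850 = 100 + 500 + 120 + 60 +
    70.\<close>
  define A2 where "A2 = 2 * k + 850 + A + 40 * K"
  obtain c where c: "real G < (1 / 0.93) ^ c" using real_arch_pow[of "1 / 0.93" "real G"] by auto
  obtain e where e: "real (A2 * (2 + \<Delta>)\<^sup>2 * G) < 2 ^ e" using real_arch_pow[of 2] by force
  show ?thesis
  proof (intro exI[of _ "e + (3 + 3 * c)"] allI impI)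
    fix n L D B :: nat and \<epsilon> :: real
    assume \<epsilon>: "\<epsilon> > 0" and L: "L \<le> n * (1 + \<Delta>)" and D: "D = 0 \<or> min 1 \<epsilon> < 4 * real n * 0.93 ^ (D - 1)"
      and B: "B = n * (2 + K * (2 * \<Delta>)) ^ D"
    define y where "y = real n / min 1 \<epsilon>"
    define Y where "Y = 2 + y"
    have ny: "real n \<le> y" using \<epsilon> by (simp add: y_def pos_le_divide_eq min_def mult_left_le)
    have Y2: "Y \<ge> 2" using ny by (simp add: Y_def)
    \<comment> \<open>One factor \<open>G\<close> is split off because minimality only controls D -
      1.\<close>
    have GD: "real G ^ D \<le> real G * Y ^ (3 * c)"
    proof (cases D)
      case 0
      have "1 \<le> real G" by (simp add: G_def)
      moreover have "1 \<le> Y ^ (3 * c)" using Y2 by (intro one_le_power) simp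
      ultimately have "1 * 1 \<le> real G * Y ^ (3 * c)" by (intro mult_mono) auto
      then show ?thesis using 0 by simp
    next
      case (Suc d)
      then have "min 1 \<epsilon> < 4 * real n * 0.93 ^ d" using D by simp
      then have "(1 / 0.93) ^ d < 4 * y" using \<epsilon> by (simp add: y_def field_simps power_divide)
      \<comment> \<open>The factor 4 is absorbed by Y^2, as Y >= 2.\<close>
      also have "\<dots> \<le> Y ^ 2 * Y" using Y2 ny power_mono[of 2 Y 2] by (intro mult_mono) (auto simp: Y_def)
      finally have p: "(1 / 0.93) ^ d \<le> Y ^ 3" by (simp add: power3_eq_cube power2_eq_square)
      have "real G ^ d \<le> ((1 / 0.93) ^ c) ^ d" using c by (intro power_mono) auto
      also have "\<dots> = ((1 / 0.93) ^ d) ^ c" by (simp only: power_mult[symmetric] mult.commute)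
      also have "\<dots> \<le> (Y ^ 3) ^ c" using p by (intro power_mono) auto
      finally have "real G ^ d \<le> Y ^ (3 * c)" by (simp add: power_mult)
      then show ?thesis using Suc by (simp add: mult_left_mono)
    qed
    define M where "M = (L + 1) * (L + 1)"
    define S where "S = (n + 1) * G ^ D"
    have M: "L + 1 \<le> M" "1 \<le> M" by (simp_all add: M_def)
    have "D + 1 \<le> (2::nat) ^ D" using Suc_leI[OF less_exp[of D]] by simp
    also have "(2::nat) ^ D \<le> G ^ D" by (intro power_mono) (auto simp: G_def)
    finally have DG: "D + 1 \<le> G ^ D" .
    also have "\<dots> \<le> S" by (simp add: S_def)
    finally have S: "D + 1 \<le> S" .
    have BS: "B + 1 \<le> S" using DG unfolding B S_def G_def[symmetric] by simp
    have S1: "1 \<le> S" using S by simp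
    have "(L + 1) * (2 * k + 100) \<le> (2 * k + 100) * (M * S)"
      using mult_le_mono2[OF mult_mono[OF M(1) S1], of "2 * k + 100"] by (simp add: algebra_simps)
    moreover have "(D + 1) * 500 \<le> 500 * (M * S)" using mult_mono[OF M(2) S] by simp
    moreover have "120 * M \<le> 120 * (M * S)" using S1 by simp
    moreover have "(B + 1) * (A * M + 60) \<le> S * ((A + 60) * M)"
      using BS M(2) by (intro mult_mono) (auto simp: algebra_simps)
    moreover have "(B + 1) * (40 * K + 70) \<le> S * ((40 * K + 70) * M)"
      using BS M(2) by (intro mult_mono) auto
    ultimately have "(L + 1) * (2 * k + 100) + ((D + 1) * 500 + (120 * M +
        ((B + 1) * (A * M + 60) + (B + 1) * (40 * K + 70)))) \<le>
        (2 * k + 100) * (M * S) + (500 * (M * S) + (120 * (M * S) +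
        (S * ((A + 60) * M) + S * ((40 * K + 70) * M))))"
      by (intro add_mono)
    also have "\<dots> = A2 * (M * S)" by (simp add: A2_def algebra_simps)
    finally have T: "(L + 1) * (2 * k + 100) + ((D + 1) * 500 + (120 * M +
        ((B + 1) * (A * M + 60) + (B + 1) * (40 * K + 70)))) \<le> A2 * (M * S)" .
    have "real (L + 1) \<le> real (2 + \<Delta>) * Y"
    proof -
      have "real L \<le> real n * (1 + real \<Delta>)" using L by (metis of_nat_1 of_nat_add of_nat_le_iff of_nat_mult)
      also have "\<dots> \<le> y * (1 + real \<Delta>)" using ny by (intro mult_right_mono) auto
      finally show ?thesis using ny by (simp add: Y_def algebra_simps)
    qed
    then have "real M \<le> (real (2 + \<Delta>) * Y) * (real (2 + \<Delta>) * Y)"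
      unfolding M_def of_nat_mult by (intro mult_mono) auto
    moreover have "real S \<le> Y * (real G * Y ^ (3 * c))"
      unfolding S_def of_nat_mult of_nat_power using GD ny Y2 by (intro mult_mono) (auto simp: Y_def)
    ultimately have "real (A2 * (M * S)) \<le>
        real A2 * (((real (2 + \<Delta>) * Y) * (real (2 + \<Delta>) * Y)) * (Y * (real G * Y ^ (3 * c))))"
      unfolding of_nat_mult using Y2 by (intro mult_left_mono mult_mono) auto
    also have "\<dots> = real (A2 * (2 + \<Delta>)\<^sup>2 * G) * Y ^ (3 + 3 * c)"
      unfolding of_nat_mult of_nat_power power_add power2_eq_square power3_eq_cube by (simp only: mult_ac)
    also have "\<dots> \<le> 2 ^ e * Y ^ (3 + 3 * c)" using e Y2 by (intro mult_right_mono) auto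
    also have "\<dots> \<le> Y ^ e * Y ^ (3 + 3 * c)" using Y2 by (intro mult_right_mono power_mono) auto
    also have "\<dots> = (2 + real n / min 1 \<epsilon>) ^ (e + (3 + 3 * c))" by (simp add: power_add Y_def y_def)
    finally have "real (A2 * (M * S)) \<le> (2 + real n / min 1 \<epsilon>) ^ (e + (3 + 3 * c))" .
    with T show "real ((L + 1) * (2 * k + 100) + ((D + 1) * 500 + (120 * ((L + 1) * (L + 1)) +
      ((B + 1) * (K * ((3 * \<Delta> + 5 * k + 800) * ((L + 1) * (L + 1))) + 60) + (B + 1) * (40 * K + 70)))))
      \<le> (2 + real n / min 1 \<epsilon>) ^ (e + (3 + 3 * c))"
      unfolding A_def M_def mult.assoc using of_nat_mono order_trans by blast
  qed
qed

text \<open>The depth is sufficient for the accuracy; the failure of its predecessor is what limits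
  the running time.\<close>

lemma least_depth:
  fixes \<epsilon> :: real
  assumes "\<epsilon> > 0"
  shows "\<exists>D. 4 * real n * 0.93 ^ D \<le> min 1 \<epsilon> \<and> (D = 0 \<or> min 1 \<epsilon> < 4 * real n * 0.93 ^ (D - 1))"
proof -
  define P where "P D \<longleftrightarrow> 4 * real n * 0.93 ^ D \<le> min 1 \<epsilon>" for D
  have "(\<lambda>D. 4 * real n * 0.93 ^ D) \<longlonglongrightarrow> 4 * real n * 0"
    by (intro tendsto_mult_left LIMSEQ_realpow_zero) auto
  then have "\<forall>\<^sub>F D in sequentially. 4 * real n * 0.93 ^ D < min 1 \<epsilon>"
    using assms by (intro order_tendstoD(2)) auto
  then have "\<forall>\<^sub>F D in sequentially. P D"
    by (rule eventually_mono) (simp add: P_def)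
  then obtain D where "P D" by (metis eventually_sequentially order_refl)
  then have "P (Least P)" by (rule LeastI)
  moreover have "\<not> P (Least P - 1)" if "Least P \<noteq> 0"
    using not_less_Least[of "Least P - 1" P] that by simp
  ultimately show ?thesis unfolding P_def by (meson not_le)
qed

text \<open>The time is measured by 2 + |V| / min 1 \<epsilon>, since |V|/\<epsilon> itself may fall
  below 1, where no power of it bounds a running time. For \<open>k = 0\<close> and a graph with an
  edge the partition function is an empty sum and, being 0, has no multiplicative
  approximation.\<close>

theorem theorem1p5:
  fixes \<Delta> k :: nat
  assumes "k \<ge> 1"
  shows "\<exists>(prog :: com) (C :: nat).
    \<forall>(G :: (nat, nat) multigraph) (n :: nat) (es :: (nat \<times> nat) list)
      (h :: edge_coloring_model) (\<epsilon> :: real).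
      wf_multigraph G \<longrightarrow> max_degree_le G \<Delta> \<longrightarrow> presents n es G \<longrightarrow>
      (\<forall>a. length a = k \<longrightarrow> cmod (h a - 1) \<le> 0.35 / (real \<Delta> + 1)) \<longrightarrow>
      \<epsilon> > 0 \<longrightarrow>
      (\<exists>s t. exec h prog (initial_memory n es \<epsilon>) s t \<and>
         multiplicative_approx \<epsilon> (partition_function k G h) (result s) \<and>
         real t \<le> (2 + real (card (verts G)) / min 1 \<epsilon>) ^ C)"
proof -
  obtain E where E: "\<And>n L D B :: nat. \<And>\<epsilon> :: real. \<epsilon> > 0 \<Longrightarrow> L \<le> n * (1 + \<Delta>) \<Longrightarrow>
    D = 0 \<or> min 1 \<epsilon> < 4 * real n * 0.93 ^ (D - 1) \<Longrightarrow> B = n * (2 + k ^ \<Delta> * (2 * \<Delta>)) ^ D \<Longrightarrow>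
    real ((L + 1) * (2 * k + 100) + ((D + 1) * 500 + (120 * ((L + 1) * (L + 1)) +
      ((B + 1) * (k ^ \<Delta> * ((3 * \<Delta> + 5 * k + 800) * ((L + 1) * (L + 1))) + 60) + (B + 1) * (40 * k ^ \<Delta> + 70)))))
    \<le> (2 + real n / min 1 \<epsilon>) ^ E"
    using time_polynomial[of \<Delta> k] by blast
  show ?thesis
  proof (intro exI[of _ "algorithm \<Delta> k"] exI[of _ E] allI impI)
    fix G :: "(nat, nat) multigraph" and n :: nat and es :: "(nat \<times> nat) list"
      and h :: edge_coloring_model and \<epsilon> :: real
    assume G: "wf_multigraph G" "max_degree_le G \<Delta>" "presents n es G"
      and h: "\<forall>a. length a = k \<longrightarrow> cmod (h a - 1) \<le> 0.35 / (real \<Delta> + 1)" and \<epsilon>: "\<epsilon> > 0"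
    interpret edge_model n k \<Delta> es h
      using edge_model_presented[OF assms G] h by blast
    obtain D where D: "4 * real n * 0.93 ^ D \<le> min 1 \<epsilon>" "D = 0 \<or> min 1 \<epsilon> < 4 * real n * 0.93 ^ (D - 1)"
      using least_depth[OF \<epsilon>, of n] by blast
    have L: "n + length es \<le> n * (1 + \<Delta>)" using length_edges by simp
    obtain s t where "exec h (algorithm \<Delta> k) (initial_memory n es \<epsilon>) s t"
      and t: "t \<le> (L + 1) * (2 * k + 100) + ((D + 1) * 500 + (120 * ((L + 1) * (L + 1)) +
      ((n * (2 + K * (2 * \<Delta>)) ^ D + 1) * (K * ((3 * \<Delta> + 5 * k + 800) * ((L + 1) * (L + 1))) + 60) +
       (n * (2 + K * (2 * \<Delta>)) ^ D + 1) * (40 * K + 70))))"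
      and "multiplicative_approx \<epsilon> (Z {..<n} (\<lambda>_. 0)) (result s)"
      using runs_algorithm[OF D(1) refl] unfolding runs_def by blast
    moreover have "real t \<le> (2 + real n / min 1 \<epsilon>) ^ E"
      using order_trans[OF of_nat_mono[OF t] E[OF \<epsilon> L D(2) refl]] .
    ultimately show "\<exists>s t. exec h (algorithm \<Delta> k) (initial_memory n es \<epsilon>) s t \<and>
         multiplicative_approx \<epsilon> (partition_function k G h) (result s) \<and>
         real t \<le> (2 + real (card (verts G)) / min 1 \<epsilon>) ^ E"
      unfolding partition_function_presented[OF G(1,3)] card_verts_presented[OF G(3)] by blast
  qed
qed

end
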